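(* Let $R$ be a commutative unital ring, let $A$ be an associative unital $R$-algebra, let $M$ be a right $A$-module and let $N$ be a left $A$-module. Let $I$ be a two-sided ideal of $A$ which acts trivially on $M$ and $N$ (that is, $M\cdot I=0$ and $I\cdot N=0$), and which as a left ideal is an (internal) direct sum $I= J_1\oplus\cdots\oplus J_k$ of left ideals $J_1,\dots,J_k$ of $A$. Suppose that each $J_i$ is generated as a left ideal by finitely many commuting idempotents. Then $$\mathrm{Tor}^A_*(M,N)\cong \mathrm{Tor}^{A/I}_*(M,N).$$
   Context: Since $I$ acts trivially, $M$ and $N$ are regarded as right and left $A/I$-modules respectively. An idempotent is an element $e$ with $e^2=e$. *)

theory Defs
  imports "HOL-Algebra.QuotRing" "HOL-Algebra.Module" "HOL-Algebra.Generated_Groups"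
    "HOL-Library.Poly_Mapping"
begin

section \<open>Algebras and one-sided modules\<close>

text \<open>The locale \<^locale>\<open>algebra\<close> of HOL-Algebra is about commutative algebras, and
  \<^locale>\<open>module\<close> is about modules over commutative rings. We reuse the record types.\<close>

locale assoc_algebra = module R A + ring A for R (structure) and A (structure) +
  assumes smult_mult_left:
      "\<lbrakk>r \<in> carrier R; x \<in> carrier A; y \<in> carrier A\<rbrakk>
        \<Longrightarrow> (r \<odot>\<^bsub>A\<^esub> x) \<otimes>\<^bsub>A\<^esub> y = r \<odot>\<^bsub>A\<^esub> (x \<otimes>\<^bsub>A\<^esub> y)"
    and smult_mult_right:
      "\<lbrakk>r \<in> carrier R; x \<in> carrier A; y \<in> carrier A\<rbrakk>
        \<Longrightarrow> x \<otimes>\<^bsub>A\<^esub> (r \<odot>\<^bsub>A\<^esub> y) = r \<odot>\<^bsub>A\<^esub> (x \<otimes>\<^bsub>A\<^esub> y)"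

locale left_module = A: ring A + N: abelian_group N 
  for A :: "('a, 'y) ring_scheme" (structure)
    and N :: "('a, 'u, 'z) module_scheme" (structure) +
  assumes act_closed:
      "\<lbrakk>a \<in> carrier A; x \<in> carrier N\<rbrakk> \<Longrightarrow> a \<odot>\<^bsub>N\<^esub> x \<in> carrier N"
    and act_l_distr:
      "\<lbrakk>a \<in> carrier A; b \<in> carrier A; x \<in> carrier N\<rbrakk>
        \<Longrightarrow> (a \<oplus>\<^bsub>A\<^esub> b) \<odot>\<^bsub>N\<^esub> x = a \<odot>\<^bsub>N\<^esub> x \<oplus>\<^bsub>N\<^esub> b \<odot>\<^bsub>N\<^esub> x"
    and act_r_distr:
      "\<lbrakk>a \<in> carrier A; x \<in> carrier N; y \<in> carrier N\<rbrakk>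
        \<Longrightarrow> a \<odot>\<^bsub>N\<^esub> (x \<oplus>\<^bsub>N\<^esub> y) = a \<odot>\<^bsub>N\<^esub> x \<oplus>\<^bsub>N\<^esub> a \<odot>\<^bsub>N\<^esub> y"
    and act_assoc:
      "\<lbrakk>a \<in> carrier A; b \<in> carrier A; x \<in> carrier N\<rbrakk>
        \<Longrightarrow> (a \<otimes>\<^bsub>A\<^esub> b) \<odot>\<^bsub>N\<^esub> x = a \<odot>\<^bsub>N\<^esub> (b \<odot>\<^bsub>N\<^esub> x)"
    and act_one: "x \<in> carrier N \<Longrightarrow> \<one>\<^bsub>A\<^esub> \<odot>\<^bsub>N\<^esub> x = x"

text \<open>For a right module, \<open>a \<odot>\<^bsub>M\<^esub> x\<close> stands for \<open>x \<cdot> a\<close>; hence the order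
  of \<open>a\<close> and \<open>b\<close> in \<open>act_assoc\<close>.\<close>

locale right_module = A: ring A + M: abelian_group M 
  for A :: "('a, 'y) ring_scheme" (structure)
    and M :: "('a, 'u, 'z) module_scheme" (structure) +
  assumes act_closed:
      "\<lbrakk>a \<in> carrier A; x \<in> carrier M\<rbrakk> \<Longrightarrow> a \<odot>\<^bsub>M\<^esub> x \<in> carrier M"
    and act_l_distr:
      "\<lbrakk>a \<in> carrier A; b \<in> carrier A; x \<in> carrier M\<rbrakk>
        \<Longrightarrow> (a \<oplus>\<^bsub>A\<^esub> b) \<odot>\<^bsub>M\<^esub> x = a \<odot>\<^bsub>M\<^esub> x \<oplus>\<^bsub>M\<^esub> b \<odot>\<^bsub>M\<^esub> x"
    and act_r_distr:
      "\<lbrakk>a \<in> carrier A; x \<in> carrier M; y \<in> carrier M\<rbrakk>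
        \<Longrightarrow> a \<odot>\<^bsub>M\<^esub> (x \<oplus>\<^bsub>M\<^esub> y) = a \<odot>\<^bsub>M\<^esub> x \<oplus>\<^bsub>M\<^esub> a \<odot>\<^bsub>M\<^esub> y"
    and act_assoc:
      "\<lbrakk>a \<in> carrier A; b \<in> carrier A; x \<in> carrier M\<rbrakk>
        \<Longrightarrow> (a \<otimes>\<^bsub>A\<^esub> b) \<odot>\<^bsub>M\<^esub> x = b \<odot>\<^bsub>M\<^esub> (a \<odot>\<^bsub>M\<^esub> x)"
    and act_one: "x \<in> carrier M \<Longrightarrow> \<one>\<^bsub>A\<^esub> \<odot>\<^bsub>M\<^esub> x = x"

text \<open>Linear maps and isomorphisms over \<open>S\<close>, for left modules as well as for right modules.\<close>

definition linear_maps ::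
    "('s, 'y) ring_scheme \<Rightarrow> ('s, 'u, 'z1) module_scheme \<Rightarrow> ('s, 'v, 'z2) module_scheme \<Rightarrow> ('u \<Rightarrow> 'v) set" where
  "linear_maps S U V = {f \<in> carrier U \<rightarrow> carrier V.
     (\<forall>x\<in>carrier U. \<forall>y\<in>carrier U. f (x \<oplus>\<^bsub>U\<^esub> y) = f x \<oplus>\<^bsub>V\<^esub> f y) \<and>
     (\<forall>s\<in>carrier S. \<forall>x\<in>carrier U. f (s \<odot>\<^bsub>U\<^esub> x) = s \<odot>\<^bsub>V\<^esub> f x)}"

definition isomorphic_modules ::
    "('s, 'y) ring_scheme \<Rightarrow> ('s, 'u, 'z1) module_scheme \<Rightarrow> ('s, 'v, 'z2) module_scheme \<Rightarrow> bool" where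
  "isomorphic_modules S U V \<longleftrightarrow>
     (\<exists>f \<in> linear_maps S U V. bij_betw f (carrier U) (carrier V))"

section \<open>Left ideals, idempotents, quotients\<close>

definition left_ideal :: "'a set \<Rightarrow> ('a, 'y) ring_scheme \<Rightarrow> bool" where
  "left_ideal J A \<longleftrightarrow> additive_subgroup J A \<and> (\<forall>a\<in>carrier A. \<forall>x\<in>J. a \<otimes>\<^bsub>A\<^esub> x \<in> J)"

definition gen_left_ideal :: "('a, 'y) ring_scheme \<Rightarrow> 'a set \<Rightarrow> 'a set" where
  "gen_left_ideal A E = \<Inter>{J. left_ideal J A \<and> E \<subseteq> J}"

definition idempotents :: "('a, 'y) ring_scheme \<Rightarrow> 'a set" where
  "idempotents A = {e \<in> carrier A. e \<otimes>\<^bsub>A\<^esub> e = e}"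

text \<open>Every element of \<open>I\<close> is \<open>x 1 \<oplus> \<dots> \<oplus> x k\<close> for exactly one family with \<open>x i \<in> J i\<close>,
  and all these sums lie in \<open>I\<close>.\<close>

definition internal_direct_sum ::
    "('a, 'y) ring_scheme \<Rightarrow> 'a set \<Rightarrow> nat \<Rightarrow> (nat \<Rightarrow> 'a set) \<Rightarrow> bool" where
  "internal_direct_sum A I k J \<longleftrightarrow>
     bij_betw (\<lambda>x. \<Oplus>\<^bsub>A\<^esub>i\<in>{1..k}. x i) (\<Pi>\<^sub>E i\<in>{1..k}. J i) I"

text \<open>The quotient of \<open>U\<close> by a submodule \<open>K\<close>. The fields \<open>mult\<close> and \<open>one\<close> of the record play
  no role for modules.\<close>

definition quot_module :: "('s, 'u) module \<Rightarrow> 'u set \<Rightarrow> ('s, 'u set) module" where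
  "quot_module U K = \<lparr>carrier = a_rcosets\<^bsub>U\<^esub> K, mult = undefined, one = undefined,
     zero = K, add = set_add U, smult = (\<lambda>s X. \<Union>x\<in>X. K +>\<^bsub>U\<^esub> (s \<odot>\<^bsub>U\<^esub> x))\<rparr>"

definition quot_algebra :: "('r, 'a) module \<Rightarrow> 'a set \<Rightarrow> ('r, 'a set) module" where
  "quot_algebra A I = ring.extend (A Quot I) (module.fields (smult (quot_module A I)))"

text \<open>A (left or right) \<open>A\<close>-module on which \<open>I\<close> acts trivially, as a module over the quotient
  algebra: on such a module all representatives \<open>a\<close> of a coset \<open>X\<close> act in the same way.\<close>

definition module_over_quot :: "('a, 'm) module \<Rightarrow> ('a set, 'm) module" where
  "module_over_quot M = ring.extend (ring.truncate M)
     (module.fields (\<lambda>X x. the_elem ((\<lambda>a. a \<odot>\<^bsub>M\<^esub> x) ` X)))"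

section \<open>Tensor products\<close>

text \<open>The free abelian group on pairs of elements of \<open>M\<close> and \<open>N\<close>, modulo the usual relations.
  A scalar \<open>r\<close> of the ground ring acts by \<open>r (x \<otimes> y) = x (r 1) \<otimes> y\<close>; note that
  \<open>tensor_pre\<close> itself is only an abelian group, the scalar action becomes linear
  in the quotient.\<close>

definition tensor_pre :: "('r, 'a) module \<Rightarrow> ('a, 'm) module \<Rightarrow> ('a, 'n) module \<Rightarrow>
    ('r, ('m \<times> 'n) \<Rightarrow>\<^sub>0 int) module" where
  "tensor_pre A M N =
     \<lparr>carrier = {z. Poly_Mapping.keys z \<subseteq> carrier M \<times> carrier N},
      mult = undefined, one = undefined, zero = 0, add = (+),
      smult = (\<lambda>r. frag_extend (\<lambda>(x, y). frag_of ((r \<odot>\<^bsub>A\<^esub> \<one>\<^bsub>A\<^esub>) \<odot>\<^bsub>M\<^esub> x, y)))\<rparr>"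

inductive_set tensor_gens :: "('r, 'a) module \<Rightarrow> ('a, 'm) module \<Rightarrow> ('a, 'n) module \<Rightarrow>
    (('m \<times> 'n) \<Rightarrow>\<^sub>0 int) set"
  for A M N where
  "\<lbrakk>x \<in> carrier M; x' \<in> carrier M; y \<in> carrier N\<rbrakk>
    \<Longrightarrow> frag_of (x \<oplus>\<^bsub>M\<^esub> x', y) - frag_of (x, y) - frag_of (x', y) \<in> tensor_gens A M N"
| "\<lbrakk>x \<in> carrier M; y \<in> carrier N; y' \<in> carrier N\<rbrakk>
    \<Longrightarrow> frag_of (x, y \<oplus>\<^bsub>N\<^esub> y') - frag_of (x, y) - frag_of (x, y') \<in> tensor_gens A M N"
| "\<lbrakk>x \<in> carrier M; a \<in> carrier A; y \<in> carrier N\<rbrakk>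
    \<Longrightarrow> frag_of (a \<odot>\<^bsub>M\<^esub> x, y) - frag_of (x, a \<odot>\<^bsub>N\<^esub> y) \<in> tensor_gens A M N"

definition tensor_rels :: "('r, 'a) module \<Rightarrow> ('a, 'm) module \<Rightarrow> ('a, 'n) module \<Rightarrow>
    (('m \<times> 'n) \<Rightarrow>\<^sub>0 int) set" where
  "tensor_rels A M N = generate (add_monoid (tensor_pre A M N)) (tensor_gens A M N)"

definition tensor :: "('r, 'a) module \<Rightarrow> ('a, 'm) module \<Rightarrow> ('a, 'n) module \<Rightarrow>
    ('r, (('m \<times> 'n) \<Rightarrow>\<^sub>0 int) set) module" where
  "tensor A M N = quot_module (tensor_pre A M N) (tensor_rels A M N)"

text \<open>The map \<open>f \<otimes> id\<close>; only the target module \<open>M'\<close> of \<open>f\<close> is needed.\<close>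

definition tensor_map :: "('r, 'a) module \<Rightarrow> ('a, 'm2) module \<Rightarrow> ('a, 'n) module \<Rightarrow> ('m \<Rightarrow> 'm2)
    \<Rightarrow> (('m \<times> 'n) \<Rightarrow>\<^sub>0 int) set \<Rightarrow> (('m2 \<times> 'n) \<Rightarrow>\<^sub>0 int) set" where
  "tensor_map A M' N f Z =
     (\<Union>z\<in>Z. tensor_rels A M' N +>\<^bsub>tensor_pre A M' N\<^esub>
        frag_extend (\<lambda>(x, y). frag_of (f x, y)) z)"

section \<open>Homology\<close>

text \<open>A chain complex is given by \<open>C n\<close> and \<open>d n : C (n + 1) \<rightarrow> C n\<close> for \<open>n \<ge> 0\<close>.\<close>

definition cycles :: "(nat \<Rightarrow> ('s, 'c) module) \<Rightarrow> (nat \<Rightarrow> 'c \<Rightarrow> 'c) \<Rightarrow> nat \<Rightarrow> 'c set" where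
  "cycles C d n = (case n of 0 \<Rightarrow> carrier (C 0) | Suc k \<Rightarrow> {x \<in> carrier (C n). d k x = \<zero>\<^bsub>C k\<^esub>})"

definition boundaries :: "(nat \<Rightarrow> ('s, 'c) module) \<Rightarrow> (nat \<Rightarrow> 'c \<Rightarrow> 'c) \<Rightarrow> nat \<Rightarrow> 'c set" where
  "boundaries C d n = d n ` carrier (C (Suc n))"

definition homology ::
    "(nat \<Rightarrow> ('s, 'c) module) \<Rightarrow> (nat \<Rightarrow> 'c \<Rightarrow> 'c) \<Rightarrow> nat \<Rightarrow> ('s, 'c set) module" where
  "homology C d n = quot_module (C n\<lparr>carrier := cycles C d n\<rparr>) (boundaries C d n)"

section \<open>Free right modules\<close>

definition free_rmodule :: "('a, 'y) ring_scheme \<Rightarrow> 'b set \<Rightarrow> ('a, 'b \<Rightarrow> 'a) module" where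
  "free_rmodule A B =
     \<lparr>carrier = {f \<in> B \<rightarrow>\<^sub>E carrier A. finite {b \<in> B. f b \<noteq> \<zero>\<^bsub>A\<^esub>}},
      mult = undefined, one = undefined, zero = (\<lambda>b\<in>B. \<zero>\<^bsub>A\<^esub>),
      add = (\<lambda>f g. \<lambda>b\<in>B. f b \<oplus>\<^bsub>A\<^esub> g b), smult = (\<lambda>a f. \<lambda>b\<in>B. f b \<otimes>\<^bsub>A\<^esub> a)\<rparr>"

definition basis_vec :: "('a, 'y) ring_scheme \<Rightarrow> 'b set \<Rightarrow> 'b \<Rightarrow> 'b \<Rightarrow> 'a" where
  "basis_vec A B c = (\<lambda>b\<in>B. if b = c then \<one>\<^bsub>A\<^esub> else \<zero>\<^bsub>A\<^esub>)"

text \<open>The linear map from the free module on \<open>B\<close> to \<open>U\<close> that sends each basis element \<open>b\<close>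
  to \<open>g b\<close>.\<close>

definition lin_ext ::
    "('a, 'y) ring_scheme \<Rightarrow> 'b set \<Rightarrow> ('a, 'u, 'z) module_scheme \<Rightarrow> ('b \<Rightarrow> 'u) \<Rightarrow> ('b \<Rightarrow> 'a) \<Rightarrow> 'u" where
  "lin_ext A B U g f = (\<Oplus>\<^bsub>U\<^esub>b\<in>{b \<in> B. f b \<noteq> \<zero>\<^bsub>A\<^esub>}. f b \<odot>\<^bsub>U\<^esub> g b)"

definition lin_comb :: "('a, 'u, 'z) module_scheme \<Rightarrow> ('b \<Rightarrow> 'u) \<Rightarrow> ('b \<times> 'a) list \<Rightarrow> 'u" where
  "lin_comb U g xs = foldr (\<lambda>(b, a) u. a \<odot>\<^bsub>U\<^esub> g b \<oplus>\<^bsub>U\<^esub> u) xs \<zero>\<^bsub>U\<^esub>"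

section \<open>Tor\<close>

text \<open>As usual, \<open>Tor n M N\<close> is the \<open>n\<close>-th homology of \<open>P \<otimes> N\<close> for a resolution \<open>P\<close> of \<open>M\<close>
  by projective right modules. We fix the standard choice of \<open>P\<close>: the free module on all elements
  of \<open>M\<close>, then in each degree the free module on all cycles of the degree before. So that all
  degrees live in one type, a cycle is represented by a list of basis elements with
  coefficients (a cycle may well occur several times as a basis element, via different lists). The
  lemmas \<open>std_res_*\<close> at the end of the theory show that this is indeed a resolution by free modules.\<close>

datatype ('a, 'm) cell =
    Gen (gen_elt: 'm)
  | Syz (syz_comb: "(('a, 'm) cell \<times> 'a) list")

definition syz_elt ::
    "('a, 'y) ring_scheme \<Rightarrow> ('a, 'm) cell set \<Rightarrow> ('a, 'm) cell \<Rightarrow> ('a, 'm) cell \<Rightarrow> 'a" where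
  "syz_elt A B c = lin_comb (free_rmodule A B) (basis_vec A B) (syz_comb c)"

fun cells :: "('a, 'y) ring_scheme \<Rightarrow> ('a, 'm, 'z) module_scheme \<Rightarrow> nat \<Rightarrow> ('a, 'm) cell set" where
  "cells A M 0 = Gen ` carrier M"
| "cells A M (Suc 0) = {Syz xs |xs. set xs \<subseteq> cells A M 0 \<times> carrier A \<and>
     lin_comb M gen_elt xs = \<zero>\<^bsub>M\<^esub>}"
| "cells A M (Suc (Suc n)) = {Syz xs |xs. set xs \<subseteq> cells A M (Suc n) \<times> carrier A \<and>
     lin_comb (free_rmodule A (cells A M n)) (syz_elt A (cells A M n)) xs
       = \<zero>\<^bsub>free_rmodule A (cells A M n)\<^esub>}"

definition res_mod ::
    "('a, 'y) ring_scheme \<Rightarrow> ('a, 'm, 'z) module_scheme \<Rightarrow> nat \<Rightarrow> ('a, ('a, 'm) cell \<Rightarrow> 'a) module" where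
  "res_mod A M n = free_rmodule A (cells A M n)"

definition res_diff :: "('a, 'y) ring_scheme \<Rightarrow> ('a, 'm, 'z) module_scheme \<Rightarrow> nat \<Rightarrow>
    (('a, 'm) cell \<Rightarrow> 'a) \<Rightarrow> (('a, 'm) cell \<Rightarrow> 'a)" where
  "res_diff A M n =
     lin_ext A (cells A M (Suc n)) (res_mod A M n) (syz_elt A (cells A M n))"

definition res_aug :: "('a, 'y) ring_scheme \<Rightarrow> ('a, 'm, 'z) module_scheme \<Rightarrow> (('a, 'm) cell \<Rightarrow> 'a) \<Rightarrow> 'm" where
  "res_aug A M = lin_ext A (cells A M 0) M gen_elt"

definition Tor :: "('r, 'a) module \<Rightarrow> nat \<Rightarrow> ('a, 'm) module \<Rightarrow> ('a, 'n) module \<Rightarrow>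
    ('r, (((('a, 'm) cell \<Rightarrow> 'a) \<times> 'n) \<Rightarrow>\<^sub>0 int) set set) module" where
  "Tor A n M N = homology (\<lambda>i. tensor A (res_mod A M i) N)
     (\<lambda>i. tensor_map A (res_mod A M i) N (res_diff A M i)) n"

section \<open>The quotient algebra, its modules and the tensor product are well defined\<close>

lemma quot_algebra_sel [simp]:
  "carrier (quot_algebra A I) = a_rcosets\<^bsub>A\<^esub> I"
  "mult (quot_algebra A I) = rcoset_mult A I"
  "one (quot_algebra A I) = I +>\<^bsub>A\<^esub> \<one>\<^bsub>A\<^esub>"
  "zero (quot_algebra A I) = I"
  "add (quot_algebra A I) = set_add A"
  "smult (quot_algebra A I) = (\<lambda>s X. \<Union>x\<in>X. I +>\<^bsub>A\<^esub> (s \<odot>\<^bsub>A\<^esub> x))"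
  by (simp_all add: quot_algebra_def ring.defs module.defs FactRing_def quot_module_def)

lemma module_over_quot_sel [simp]:
  "carrier (module_over_quot M) = carrier M"
  "add (module_over_quot M) = add M"
  "zero (module_over_quot M) = zero M"
  "smult (module_over_quot M) = (\<lambda>X x. the_elem ((\<lambda>a. a \<odot>\<^bsub>M\<^esub> x) ` X))"
  by (simp_all add: module_over_quot_def ring.defs module.defs)

lemma cg_eq: "comm_group G \<Longrightarrow> comm_group \<lparr>carrier=carrier G, mult=mult G, one=one G, \<dots>=x\<rparr>"
  unfolding comm_group_def group_def group_axioms_def comm_monoid_def comm_monoid_axioms_def Group.monoid_def Units_def
    partial_object.select_convs monoid.select_convs .

lemma cm_eq: "Group.comm_monoid G \<Longrightarrow> Group.comm_monoid \<lparr>carrier=carrier G, mult=mult G, one=one G, \<dots>=x\<rparr>"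
  unfolding comm_monoid_def comm_monoid_axioms_def Group.monoid_def
    partial_object.select_convs monoid.select_convs .

lemma ag_eq:
  assumes G: "abelian_group G" and e: "carrier H = carrier G" "add H = add G" "zero H = zero G"
  shows "abelian_group H"
proof -
  interpret abelian_group G by fact
  have "comm_group (add_monoid H)"
    using cg_eq[OF a_comm_group, of undefined] e by simp
  then show ?thesis using comm_group.axioms(1)[of "add_monoid H"]
    by (simp add: abelian_group_def abelian_monoid_def abelian_group_axioms_def comm_group_def)
qed

lemma cg_ag: "comm_group \<lparr>carrier=carrier G, mult=add G, one=zero G\<rparr> \<Longrightarrow> abelian_group G"
  using cg_eq[of "\<lparr>carrier=carrier G, mult=add G, one=zero G\<rparr>" undefined]
  by (simp add: abelian_group_def abelian_monoid_def abelian_group_axioms_def comm_group_def)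

lemma quot_act:
  assumes "additive_subgroup K U" "abelian_group U"
    and st: "\<And>x. x \<in> carrier U \<Longrightarrow> s \<odot>\<^bsub>U\<^esub> x \<in> carrier U"
    and ad: "\<And>x y. x \<in> carrier U \<Longrightarrow> y \<in> carrier U \<Longrightarrow> s \<odot>\<^bsub>U\<^esub> (x \<oplus>\<^bsub>U\<^esub> y) = s \<odot>\<^bsub>U\<^esub> x \<oplus>\<^bsub>U\<^esub> s \<odot>\<^bsub>U\<^esub> y"
    and K: "\<And>x. x \<in> K \<Longrightarrow> s \<odot>\<^bsub>U\<^esub> x \<in> K" and x: "x \<in> carrier U"
  shows "(\<Union>y\<in>K +>\<^bsub>U\<^esub> x. K +>\<^bsub>U\<^esub> (s \<odot>\<^bsub>U\<^esub> y)) = K +>\<^bsub>U\<^esub> (s \<odot>\<^bsub>U\<^esub> x)"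
proof -
  interpret abelian_subgroup K U by (rule abelian_subgroupI3) fact+
  interpret U: abelian_group U by fact
  have KU: "k \<in> carrier U" if "k \<in> K" for k using that a_subset by auto
  have "K +>\<^bsub>U\<^esub> (s \<odot>\<^bsub>U\<^esub> y) = K +>\<^bsub>U\<^esub> (s \<odot>\<^bsub>U\<^esub> x)" if y: "y \<in> K +>\<^bsub>U\<^esub> x" for y
  proof -
    obtain k where k: "k \<in> K" "y = k \<oplus>\<^bsub>U\<^esub> x" using y by (auto simp: a_r_coset_def')
    have "s \<odot>\<^bsub>U\<^esub> y = s \<odot>\<^bsub>U\<^esub> k \<oplus>\<^bsub>U\<^esub> s \<odot>\<^bsub>U\<^esub> x" using k KU x ad by simp
    then have "s \<odot>\<^bsub>U\<^esub> y \<in> K +>\<^bsub>U\<^esub> (s \<odot>\<^bsub>U\<^esub> x)" using K[OF k(1)] by (auto simp: a_r_coset_def')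
    then show ?thesis using a_repr_independence'[OF _ st[OF x]] by metis
  qed
  moreover have "x \<in> K +>\<^bsub>U\<^esub> x" using a_rcos_self x by simp
  ultimately show ?thesis by blast
qed

lemma quot_module_module:
  assumes R: "cring R" and KU: "additive_subgroup K U" and U: "abelian_group U"
    and st: "\<And>s x. s \<in> carrier R \<Longrightarrow> x \<in> carrier U \<Longrightarrow> s \<odot>\<^bsub>U\<^esub> x \<in> carrier U"
    and ad: "\<And>s x y. s \<in> carrier R \<Longrightarrow> x \<in> carrier U \<Longrightarrow> y \<in> carrier U \<Longrightarrow> s \<odot>\<^bsub>U\<^esub> (x \<oplus>\<^bsub>U\<^esub> y) = s \<odot>\<^bsub>U\<^esub> x \<oplus>\<^bsub>U\<^esub> s \<odot>\<^bsub>U\<^esub> y"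
    and K: "\<And>s x. s \<in> carrier R \<Longrightarrow> x \<in> K \<Longrightarrow> s \<odot>\<^bsub>U\<^esub> x \<in> K"
    and ld: "\<And>s t x. s \<in> carrier R \<Longrightarrow> t \<in> carrier R \<Longrightarrow> x \<in> carrier U \<Longrightarrow> K +>\<^bsub>U\<^esub> ((s \<oplus>\<^bsub>R\<^esub> t) \<odot>\<^bsub>U\<^esub> x) = K +>\<^bsub>U\<^esub> (s \<odot>\<^bsub>U\<^esub> x \<oplus>\<^bsub>U\<^esub> t \<odot>\<^bsub>U\<^esub> x)"
    and as: "\<And>s t x. s \<in> carrier R \<Longrightarrow> t \<in> carrier R \<Longrightarrow> x \<in> carrier U \<Longrightarrow> K +>\<^bsub>U\<^esub> ((s \<otimes>\<^bsub>R\<^esub> t) \<odot>\<^bsub>U\<^esub> x) = K +>\<^bsub>U\<^esub> (s \<odot>\<^bsub>U\<^esub> (t \<odot>\<^bsub>U\<^esub> x))"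
    and on: "\<And>x. x \<in> carrier U \<Longrightarrow> K +>\<^bsub>U\<^esub> (\<one>\<^bsub>R\<^esub> \<odot>\<^bsub>U\<^esub> x) = K +>\<^bsub>U\<^esub> x"
  shows "module R (quot_module U K)"
proof -
  interpret R: cring R by fact
  interpret abelian_subgroup K U by (rule abelian_subgroupI3) fact+
  interpret U: abelian_group U by fact
  have G: "abelian_group (quot_module U K)"
    by (rule cg_ag)
      (use a_factorgroup_is_comm_group in \<open>simp add: quot_module_def A_FactGroup_def'\<close>)
  have sel: "carrier (quot_module U K) = a_rcosets\<^bsub>U\<^esub> K" "add (quot_module U K) = set_add U"
    "smult (quot_module U K) = (\<lambda>s X. \<Union>x\<in>X. K +>\<^bsub>U\<^esub> (s \<odot>\<^bsub>U\<^esub> x))"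
    by (simp_all add: quot_module_def)
  have act: "smult (quot_module U K) s (K +>\<^bsub>U\<^esub> x) = K +>\<^bsub>U\<^esub> (s \<odot>\<^bsub>U\<^esub> x)" if "s \<in> carrier R" "x \<in> carrier U" for s x
    unfolding sel using quot_act[OF KU U st[OF that(1)] ad[OF that(1)] K[OF that(1)] that(2)] by simp
  have rep: "\<exists>x\<in>carrier U. X = K +>\<^bsub>U\<^esub> x" if "X \<in> carrier (quot_module U K)" for X
    using that by (auto simp: sel A_RCOSETS_def')
  have mem: "K +>\<^bsub>U\<^esub> x \<in> carrier (quot_module U K)" if "x \<in> carrier U" for x
    using that by (simp add: sel a_rcosetsI a_subset)
  have pl: "add (quot_module U K) (K +>\<^bsub>U\<^esub> x) (K +>\<^bsub>U\<^esub> y) = K +>\<^bsub>U\<^esub> (x \<oplus>\<^bsub>U\<^esub> y)" if "x \<in> carrier U" "y \<in> carrier U" for x y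
    using that a_rcos_sum by (simp add: sel)
  show ?thesis
  proof (rule moduleI[OF R G], goal_cases)
    case (1 a x) then show ?case using rep[OF 1(2)] act mem st by auto
  next
    case (2 a b x) then show ?case using rep[OF 2(3)] act pl ld st by auto
  next
    case (3 a x y) then show ?case using rep[OF 3(2)] rep[OF 3(3)] act pl ad st by auto
  next
    case (4 a b x) then show ?case using rep[OF 4(3)] act as st by auto
  next
    case (5 x) then show ?case using rep[OF 5] act on by auto
  qed
qed

lemma quot_algebra_assoc:
  assumes "assoc_algebra R A" "ideal I A"
  shows "assoc_algebra R (quot_algebra A I)"
proof -
  interpret assoc_algebra R A by fact
  interpret I: ideal I A by fact
  have st: "s \<odot>\<^bsub>A\<^esub> x \<in> I" if "s \<in> carrier R" "x \<in> I" for s x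
  proof -
    have x: "x \<in> carrier A" using that I.a_subset by auto
    have "s \<odot>\<^bsub>A\<^esub> x = (s \<odot>\<^bsub>A\<^esub> \<one>\<^bsub>A\<^esub>) \<otimes>\<^bsub>A\<^esub> x" using that x by (simp add: smult_mult_left)
    then show ?thesis using that I.I_l_closed by simp
  qed
  have m: "module R (quot_module A I)"
    by (rule quot_module_module) (auto simp: st smult_l_distr smult_r_distr smult_assoc1 R.cring_axioms I.additive_subgroup_axioms abelian_group_axioms)
  have r: "ring (quot_algebra A I)"
  proof -
    have q: "ring (A Quot I)" by (rule I.quotient_is_ring)
    interpret q: ring "A Quot I" by (rule q)
    have a: "abelian_group (quot_algebra A I)" by (rule ag_eq[OF q.abelian_group_axioms]) (simp_all add: FactRing_def)
    show ?thesis
      using q a unfolding ring_def ring_axioms_def Group.monoid_def by (simp add: FactRing_def)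
  qed
  have m': "module R (quot_algebra A I)"
    using m r unfolding module_def module_axioms_def ring_def by (auto simp: quot_module_def)
  have act: "smult (quot_algebra A I) s (I +>\<^bsub>A\<^esub> x) = I +>\<^bsub>A\<^esub> (s \<odot>\<^bsub>A\<^esub> x)" if "s \<in> carrier R" "x \<in> carrier A" for s x
    using that quot_act[of I A s x] I.additive_subgroup_axioms abelian_group_axioms st by (simp add: smult_r_distr)
  have rep: "\<exists>x\<in>carrier A. X = I +>\<^bsub>A\<^esub> x" if "X \<in> carrier (quot_algebra A I)" for X
    using that by (auto simp: A_RCOSETS_def')
  have mu: "mult (quot_algebra A I) (I +>\<^bsub>A\<^esub> x) (I +>\<^bsub>A\<^esub> y) = I +>\<^bsub>A\<^esub> (x \<otimes>\<^bsub>A\<^esub> y)" if "x \<in> carrier A" "y \<in> carrier A" for x y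
    using that I.rcoset_mult_add by simp
  show ?thesis
  proof (rule assoc_algebra.intro[OF m' r], rule assoc_algebra_axioms.intro, goal_cases)
    case (1 r x y)
    obtain u v where "u \<in> carrier A" "v \<in> carrier A" "x = I +>\<^bsub>A\<^esub> u" "y = I +>\<^bsub>A\<^esub> v"
      using rep 1 by metis
    then show ?case using 1 by (simp only: act mu smult_mult_left m_closed smult_closed)
  next
    case (2 r x y)
    obtain u v where "u \<in> carrier A" "v \<in> carrier A" "x = I +>\<^bsub>A\<^esub> u" "y = I +>\<^bsub>A\<^esub> v"
      using rep 2 by metis
    then show ?case using 2 by (simp only: act mu smult_mult_right m_closed smult_closed)
  qed
qed

lemma module_over_quot_act:
  assumes "ideal I A" and cl: "\<And>a. a \<in> carrier A \<Longrightarrow> a \<odot>\<^bsub>M\<^esub> x \<in> carrier M"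
    and M: "abelian_group M"
    and ad: "\<And>a b. a \<in> carrier A \<Longrightarrow> b \<in> carrier A \<Longrightarrow> (a \<oplus>\<^bsub>A\<^esub> b) \<odot>\<^bsub>M\<^esub> x = a \<odot>\<^bsub>M\<^esub> x \<oplus>\<^bsub>M\<^esub> b \<odot>\<^bsub>M\<^esub> x"
    and I0: "\<And>a. a \<in> I \<Longrightarrow> a \<odot>\<^bsub>M\<^esub> x = \<zero>\<^bsub>M\<^esub>" and a: "a \<in> carrier A"
  shows "(I +>\<^bsub>A\<^esub> a) \<odot>\<^bsub>module_over_quot M\<^esub> x = a \<odot>\<^bsub>M\<^esub> x"
proof -
  interpret M: abelian_group M by fact
  interpret I: ideal I A by fact
  have "(k \<oplus>\<^bsub>A\<^esub> a) \<odot>\<^bsub>M\<^esub> x = a \<odot>\<^bsub>M\<^esub> x" if "k \<in> I" for k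
    using that ad I0 a cl I.a_subset by (simp add: subsetD)
  moreover have ne: "I \<noteq> {}" using additive_subgroup.zero_closed[OF I.additive_subgroup_axioms] by blast
  ultimately have "(\<lambda>b. b \<odot>\<^bsub>M\<^esub> x) ` (I +>\<^bsub>A\<^esub> a) = {a \<odot>\<^bsub>M\<^esub> x}"
    using ne by (auto simp: a_r_coset_def' image_iff)
  then show ?thesis by simp
qed

lemma right_module_over_quot:
  assumes "assoc_algebra R A" "ideal I A" "right_module A M"
    and I0: "\<And>a x. a \<in> I \<Longrightarrow> x \<in> carrier M \<Longrightarrow> a \<odot>\<^bsub>M\<^esub> x = \<zero>\<^bsub>M\<^esub>"
  shows "right_module (quot_algebra A I) (module_over_quot M)"
proof -
  interpret Q: assoc_algebra R "quot_algebra A I" using assms quot_algebra_assoc by blast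
  interpret I: ideal I A by fact
  interpret right_module A M by fact
  have act: "smult (module_over_quot M) (I +>\<^bsub>A\<^esub> a) x = a \<odot>\<^bsub>M\<^esub> x" if "a \<in> carrier A" "x \<in> carrier M" for a x
    using that module_over_quot_act[OF assms(2), of M x a] act_closed act_l_distr I0 M.abelian_group_axioms by auto
  have G: "abelian_group (module_over_quot M)"
    by (rule ag_eq[OF M.abelian_group_axioms]) simp_all
  have rep: "\<exists>x\<in>carrier A. X = I +>\<^bsub>A\<^esub> x" if "X \<in> carrier (quot_algebra A I)" for X
    using that by (auto simp: A_RCOSETS_def')
  show ?thesis
  proof (intro right_module.intro right_module_axioms.intro Q.ring_axioms G, goal_cases)
    case (1 a x) then show ?case using rep[OF 1(1)] act act_closed by auto
  next
    case (2 a b x) then show ?case using rep[OF 2(1)] rep[OF 2(2)] act act_l_distr I.a_rcos_sum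
      by (auto simp del: module_over_quot_sel(4))
  next
    case (3 a x y) then show ?case using rep[OF 3(1)] act act_r_distr by (auto simp del: module_over_quot_sel(4))
  next
    case (4 a b x) then show ?case using rep[OF 4(1)] rep[OF 4(2)] act act_assoc act_closed I.rcoset_mult_add
      by (auto simp del: module_over_quot_sel(4))
  next
    case (5 x) then show ?case using act act_one by (auto simp del: module_over_quot_sel(4))
  qed
qed

lemma left_module_over_quot:
  assumes "assoc_algebra R A" "ideal I A" "left_module A M"
    and I0: "\<And>a x. a \<in> I \<Longrightarrow> x \<in> carrier M \<Longrightarrow> a \<odot>\<^bsub>M\<^esub> x = \<zero>\<^bsub>M\<^esub>"
  shows "left_module (quot_algebra A I) (module_over_quot M)"
proof -
  interpret Q: assoc_algebra R "quot_algebra A I" using assms quot_algebra_assoc by blast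
  interpret I: ideal I A by fact
  interpret left_module A M by fact
  have act: "smult (module_over_quot M) (I +>\<^bsub>A\<^esub> a) x = a \<odot>\<^bsub>M\<^esub> x" if "a \<in> carrier A" "x \<in> carrier M" for a x
    using that module_over_quot_act[OF assms(2), of M x a] act_closed act_l_distr I0 N.abelian_group_axioms by auto
  have G: "abelian_group (module_over_quot M)"
    by (rule ag_eq[OF N.abelian_group_axioms]) simp_all
  have rep: "\<exists>x\<in>carrier A. X = I +>\<^bsub>A\<^esub> x" if "X \<in> carrier (quot_algebra A I)" for X
    using that by (auto simp: A_RCOSETS_def')
  show ?thesis
  proof (intro left_module.intro left_module_axioms.intro Q.ring_axioms G, goal_cases)
    case (1 a x) then show ?case using rep[OF 1(1)] act act_closed by auto
  next
    case (2 a b x) then show ?case using rep[OF 2(1)] rep[OF 2(2)] act act_l_distr I.a_rcos_sum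
      by (auto simp del: module_over_quot_sel(4))
  next
    case (3 a x y) then show ?case using rep[OF 3(1)] act act_r_distr by (auto simp del: module_over_quot_sel(4))
  next
    case (4 a b x) then show ?case using rep[OF 4(1)] rep[OF 4(2)] act act_assoc act_closed I.rcoset_mult_add
      by (auto simp del: module_over_quot_sel(4))
  next
    case (5 x) then show ?case using act act_one by (auto simp del: module_over_quot_sel(4))
  qed
qed

lemma tensor_is_module:
  assumes "assoc_algebra R A" "right_module A M" "left_module A N"
  shows "module R (tensor A M N)"
proof -
  interpret assoc_algebra R A by fact
  interpret M: right_module A M by fact
  interpret N: left_module A N by fact
  let ?T = "tensor_pre A M N" and ?K = "tensor_rels A M N"
  have sel: "carrier ?T = {z. Poly_Mapping.keys z \<subseteq> carrier M \<times> carrier N}" "add ?T = (+)" "zero ?T = 0"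
    "smult ?T = (\<lambda>r. frag_extend (\<lambda>(x, y). frag_of ((r \<odot>\<^bsub>A\<^esub> \<one>\<^bsub>A\<^esub>) \<odot>\<^bsub>M\<^esub> x, y)))"
    by (simp_all add: tensor_pre_def)
  have G: "abelian_group ?T"
  proof (rule abelian_groupI)
    show "x \<oplus>\<^bsub>?T\<^esub> y \<in> carrier ?T" if "x \<in> carrier ?T" "y \<in> carrier ?T" for x y
      using that Poly_Mapping.keys_add[of x y] by (auto simp: sel)
    show "\<exists>y\<in>carrier ?T. y \<oplus>\<^bsub>?T\<^esub> x = \<zero>\<^bsub>?T\<^esub>" if "x \<in> carrier ?T" for x
      using that by (intro bexI[of _ "- x"]) (auto simp: sel)
  qed (auto simp: sel algebra_simps)
  interpret T: abelian_group ?T by (rule G)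
  have gens: "tensor_gens A M N \<subseteq> carrier ?T"
  proof
    have fr: "frag_of (x, y) \<in> carrier ?T" if "x \<in> carrier M" "y \<in> carrier N" for x y
      using that by (auto simp: sel keys_frag_of)
    have di: "x - y \<in> carrier ?T" if "x \<in> carrier ?T" "y \<in> carrier ?T" for x y
      using that keys_diff[of x y] by (auto simp: sel)
    fix z assume "z \<in> tensor_gens A M N"
    then show "z \<in> carrier ?T"
      by cases (simp_all add: di fr M.act_closed N.act_closed)
  qed
  have K: "additive_subgroup ?K ?T"
    unfolding tensor_rels_def using gens
    by (intro additive_subgroup.intro group.generate_is_subgroup T.a_group) (simp)
  interpret K: additive_subgroup ?K ?T by (rule K)
  interpret K: abelian_subgroup ?K ?T by (rule abelian_subgroupI3[OF K G])
  have neg: "inv\<^bsub>add_monoid ?T\<^esub> z = - z" if "z \<in> carrier ?T" for z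
  proof -
    have "\<ominus>\<^bsub>?T\<^esub> z = - z" by (rule T.minus_equality) (use that in \<open>auto simp: sel\<close>)
    then show ?thesis unfolding a_inv_def .
  qed
  have mK: "- v \<in> ?K" if "v \<in> ?K" for v
  proof -
    have "v \<in> carrier ?T" using that K.a_subset by blast
    moreover have "inv\<^bsub>add_monoid ?T\<^esub> v \<in> ?K" by (rule subgroup.m_inv_closed[OF K.a_subgroup that])
    ultimately show ?thesis by (simp only: neg)
  qed
  let ?c = "\<lambda>r. r \<odot>\<^bsub>A\<^esub> \<one>\<^bsub>A\<^esub>"
  have comm: "a \<otimes>\<^bsub>A\<^esub> ?c r = ?c r \<otimes>\<^bsub>A\<^esub> a" if "a \<in> carrier A" "r \<in> carrier R" for a r
    using that by (simp add: smult_mult_left smult_mult_right)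
  have gstab: "r \<odot>\<^bsub>?T\<^esub> z \<in> ?K" if "r \<in> carrier R" "z \<in> tensor_gens A M N" for r z
    using that(2)
  proof cases
    case (1 x x' y)
    then have "r \<odot>\<^bsub>?T\<^esub> z \<in> tensor_gens A M N"
      using that tensor_gens.intros(1)[of "?c r \<odot>\<^bsub>M\<^esub> x" M "?c r \<odot>\<^bsub>M\<^esub> x'" y N A]
      by (simp add: sel frag_extend_diff M.act_r_distr M.act_closed)
    then show ?thesis by (simp add: tensor_rels_def generate.incl)
  next
    case (2 x y y')
    then have "r \<odot>\<^bsub>?T\<^esub> z \<in> tensor_gens A M N"
      using that tensor_gens.intros(2)[of "?c r \<odot>\<^bsub>M\<^esub> x" M y N y' A]
      by (simp add: sel frag_extend_diff M.act_closed)
    then show ?thesis by (simp add: tensor_rels_def generate.incl)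
  next
    case (3 x a y)
    have "?c r \<odot>\<^bsub>M\<^esub> (a \<odot>\<^bsub>M\<^esub> x) = a \<odot>\<^bsub>M\<^esub> (?c r \<odot>\<^bsub>M\<^esub> x)"
      using 3 that comm[of a r] by (simp add: M.act_assoc[symmetric])
    then have "r \<odot>\<^bsub>?T\<^esub> z \<in> tensor_gens A M N"
      using that 3 tensor_gens.intros(3)[of "?c r \<odot>\<^bsub>M\<^esub> x" M a A y N]
      by (simp add: sel frag_extend_diff M.act_closed)
    then show ?thesis by (simp add: tensor_rels_def generate.incl)
  qed
  have stab: "r \<odot>\<^bsub>?T\<^esub> z \<in> ?K" if r: "r \<in> carrier R" and z: "z \<in> ?K" for r z
    using z unfolding tensor_rels_def
  proof (induction rule: generate.induct)
    case one then show ?case using generate.one[of "add_monoid ?T"] by (simp add: sel)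
  next
    case (incl h) then show ?case using gstab[OF r incl] by (simp only: tensor_rels_def)
  next
    case (inv h)
    then have "r \<odot>\<^bsub>?T\<^esub> h \<in> ?K" using gstab r by blast
    then have "- (r \<odot>\<^bsub>?T\<^esub> h) \<in> ?K" by (rule mK)
    moreover have "inv\<^bsub>add_monoid ?T\<^esub> h = - h" by (rule neg) (use inv gens in blast)
    ultimately show ?case by (simp only: sel(4) frag_extend_minus tensor_rels_def)
  next
    case (eng h1 h2)
    have "r \<odot>\<^bsub>?T\<^esub> (h1 \<otimes>\<^bsub>add_monoid ?T\<^esub> h2) = (r \<odot>\<^bsub>?T\<^esub> h1) \<otimes>\<^bsub>add_monoid ?T\<^esub> (r \<odot>\<^bsub>?T\<^esub> h2)"
      by (simp add: sel frag_extend_add)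
    then show ?case using generate.eng[OF eng(3,4)] by (simp only:)
  qed
  have ext: "f z - g z \<in> ?K"
    if z: "z \<in> carrier ?T"
      and f: "\<And>u v. f (u - v) = f u - f v" "\<And>u v. g (u - v) = g u - g v" "f 0 = 0" "g 0 = 0"
      and b: "\<And>x y. x \<in> carrier M \<Longrightarrow> y \<in> carrier N \<Longrightarrow> f (frag_of (x, y)) - g (frag_of (x, y)) \<in> ?K"
    for f g :: "_ \<Rightarrow> (_ \<Rightarrow>\<^sub>0 int)" and z
  proof -
    have z': "Poly_Mapping.keys z \<subseteq> carrier M \<times> carrier N" using z by (simp add: sel)
    have d: "u - v \<in> ?K" if "u \<in> ?K" "v \<in> ?K" for u v
    proof -
      have "- v \<in> ?K" using that(2) by (rule mK)
      then show ?thesis using K.a_closed[OF that(1), of "-v"] by (simp add: sel)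
    qed
    show ?thesis using z'
    proof (induction z rule: frag_induction)
      case zero then show ?case using f K.zero_closed by (simp add: sel)
    next
      case (one x) then show ?case using b by auto
    next
      case (diff u v)
      have "f (u - v) - g (u - v) = (f u - g u) - (f v - g v)" using f by simp
      then show ?case using d[OF diff(1,2)] by (simp only:)
    qed
  qed
  have coset: "?K +>\<^bsub>?T\<^esub> u = ?K +>\<^bsub>?T\<^esub> v" if "u \<in> carrier ?T" "v \<in> carrier ?T" "u - v \<in> ?K" for u v
  proof -
    have "u \<in> ?K +>\<^bsub>?T\<^esub> v" using that(3) by (auto simp: a_r_coset_def' sel intro: bexI[of _ "u - v"])
    then show ?thesis using K.a_repr_independence'[OF _ that(2)] by simp
  qed
  have cl: "r \<odot>\<^bsub>?T\<^esub> z \<in> carrier ?T" if "r \<in> carrier R" "z \<in> carrier ?T" for r z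
  proof -
    have "Poly_Mapping.keys (r \<odot>\<^bsub>?T\<^esub> z) \<subseteq> carrier M \<times> carrier N"
    proof
      fix p assume "p \<in> Poly_Mapping.keys (r \<odot>\<^bsub>?T\<^esub> z)"
      then obtain q where q: "q \<in> Poly_Mapping.keys z" "p \<in> Poly_Mapping.keys (case q of (x, y) \<Rightarrow> frag_of (?c r \<odot>\<^bsub>M\<^esub> x, y))"
        using keys_frag_extend[of "\<lambda>(x, y). frag_of (?c r \<odot>\<^bsub>M\<^esub> x, y)" z] unfolding sel by blast
      obtain x y where xy: "q = (x, y)" by force
      have "x \<in> carrier M" "y \<in> carrier N" using q(1) xy that(2) by (auto simp: sel)
      then show "p \<in> carrier M \<times> carrier N" using q(2) xy that(1) by (simp add: keys_frag_of M.act_closed)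
    qed
    then show ?thesis by (simp add: sel)
  qed
  have gen: "w \<in> ?K" if "w \<in> tensor_gens A M N" for w
    using that by (simp add: tensor_rels_def generate.incl)
  show ?thesis unfolding tensor_def
  proof (rule quot_module_module[OF R.cring_axioms K G], goal_cases)
    case (1 s x) then show ?case by (rule cl)
  next
    case (2 s x y) then show ?case by (simp add: sel frag_extend_add)
  next
    case (3 s x) then show ?case by (rule stab)
  next
    case (4 s t x)
    show ?case
    proof (rule coset)
      show "(s \<oplus>\<^bsub>R\<^esub> t) \<odot>\<^bsub>?T\<^esub> x - (s \<odot>\<^bsub>?T\<^esub> x \<oplus>\<^bsub>?T\<^esub> t \<odot>\<^bsub>?T\<^esub> x) \<in> ?K"
      proof (rule ext[of x "smult ?T (s \<oplus>\<^bsub>R\<^esub> t)" "\<lambda>z. s \<odot>\<^bsub>?T\<^esub> z \<oplus>\<^bsub>?T\<^esub> t \<odot>\<^bsub>?T\<^esub> z"])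
        fix x y assume "x \<in> carrier M" "y \<in> carrier N"
        then show "(s \<oplus>\<^bsub>R\<^esub> t) \<odot>\<^bsub>?T\<^esub> frag_of (x, y) - (s \<odot>\<^bsub>?T\<^esub> frag_of (x, y) \<oplus>\<^bsub>?T\<^esub> t \<odot>\<^bsub>?T\<^esub> frag_of (x, y)) \<in> ?K"
          using 4 gen[OF tensor_gens.intros(1)[of "?c s \<odot>\<^bsub>M\<^esub> x" M "?c t \<odot>\<^bsub>M\<^esub> x" y N A]]
          by (simp add: sel smult_l_distr M.act_l_distr M.act_closed algebra_simps)
      qed (use 4 in \<open>simp_all add: sel frag_extend_diff\<close>)
    qed (use 4 cl in auto)
  next
    case (5 s t x)
    show ?case
    proof (rule coset)
      show "(s \<otimes>\<^bsub>R\<^esub> t) \<odot>\<^bsub>?T\<^esub> x - (s \<odot>\<^bsub>?T\<^esub> (t \<odot>\<^bsub>?T\<^esub> x)) \<in> ?K"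
      proof (rule ext[of x "smult ?T (s \<otimes>\<^bsub>R\<^esub> t)" "\<lambda>z. s \<odot>\<^bsub>?T\<^esub> (t \<odot>\<^bsub>?T\<^esub> z)"])
        fix x y assume xy: "x \<in> carrier M" "y \<in> carrier N"
        have "?c (s \<otimes>\<^bsub>R\<^esub> t) = ?c t \<otimes>\<^bsub>A\<^esub> ?c s" using 5 smult_assoc1[of s t "\<one>\<^bsub>A\<^esub>"] smult_assoc1[of t s "\<one>\<^bsub>A\<^esub>"] R.m_comm[of s t]
          by (simp add: smult_mult_left)
        then have "?c (s \<otimes>\<^bsub>R\<^esub> t) \<odot>\<^bsub>M\<^esub> x = ?c s \<odot>\<^bsub>M\<^esub> (?c t \<odot>\<^bsub>M\<^esub> x)"
          using M.act_assoc[of "?c t" "?c s" x] 5 xy by simp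
        then show "(s \<otimes>\<^bsub>R\<^esub> t) \<odot>\<^bsub>?T\<^esub> frag_of (x, y) - s \<odot>\<^bsub>?T\<^esub> (t \<odot>\<^bsub>?T\<^esub> frag_of (x, y)) \<in> ?K"
          using K.zero_closed by (simp add: sel)
      qed (use 5 in \<open>simp_all add: sel frag_extend_diff\<close>)
    qed (use 5 cl in auto)
  next
    case (6 x)
    show ?case
    proof (rule coset)
      show "\<one>\<^bsub>R\<^esub> \<odot>\<^bsub>?T\<^esub> x - x \<in> ?K"
      proof (rule ext[of x "smult ?T \<one>\<^bsub>R\<^esub>" "\<lambda>z. z"])
        fix x y assume "x \<in> carrier M" "y \<in> carrier N"
        then show "\<one>\<^bsub>R\<^esub> \<odot>\<^bsub>?T\<^esub> frag_of (x, y) - frag_of (x, y) \<in> ?K"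
          using K.zero_closed by (simp add: sel M.act_one)
      qed (use 6 in \<open>simp_all add: sel frag_extend_diff\<close>)
    qed (use 6 cl in auto)
  qed
qed

section \<open>Exactness of the standard resolution\<close>

context right_module begin

lemma act_zero_r [simp]: assumes "a \<in> carrier A" shows "a \<odot>\<^bsub>M\<^esub> \<zero>\<^bsub>M\<^esub> = \<zero>\<^bsub>M\<^esub>"
proof -
  have "a \<odot>\<^bsub>M\<^esub> \<zero>\<^bsub>M\<^esub> \<oplus>\<^bsub>M\<^esub> a \<odot>\<^bsub>M\<^esub> \<zero>\<^bsub>M\<^esub> = a \<odot>\<^bsub>M\<^esub> \<zero>\<^bsub>M\<^esub>"
    using act_r_distr[OF assms, of "\<zero>\<^bsub>M\<^esub>" "\<zero>\<^bsub>M\<^esub>"] by simp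
  then show ?thesis using act_closed[OF assms M.zero_closed]
    by (metis M.add.r_cancel_one')
qed

lemma act_zero_l [simp]: assumes "x \<in> carrier M" shows "\<zero>\<^bsub>A\<^esub> \<odot>\<^bsub>M\<^esub> x = \<zero>\<^bsub>M\<^esub>"
proof -
  have "\<zero>\<^bsub>A\<^esub> \<odot>\<^bsub>M\<^esub> x \<oplus>\<^bsub>M\<^esub> \<zero>\<^bsub>A\<^esub> \<odot>\<^bsub>M\<^esub> x = \<zero>\<^bsub>A\<^esub> \<odot>\<^bsub>M\<^esub> x"
    using act_l_distr[OF A.zero_closed A.zero_closed assms] by simp
  then show ?thesis using act_closed[OF A.zero_closed assms]
    by (metis M.add.r_cancel_one')
qed

lemma lin_comb_closed:
  "\<lbrakk>set xs \<subseteq> B \<times> carrier A; g \<in> B \<rightarrow> carrier M\<rbrakk> \<Longrightarrow> lin_comb M g xs \<in> carrier M"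
  by (induction xs) (auto simp: lin_comb_def intro!: M.a_closed act_closed)

end

lemma free_right_module:
  assumes "ring A" shows "right_module A (free_rmodule A B)"
proof -
  interpret A: ring A by fact
  have fin: "finite {b \<in> B. f b \<oplus>\<^bsub>A\<^esub> g b \<noteq> \<zero>\<^bsub>A\<^esub>}"
    if "f \<in> B \<rightarrow>\<^sub>E carrier A" "g \<in> B \<rightarrow>\<^sub>E carrier A" "finite {b \<in> B. f b \<noteq> \<zero>\<^bsub>A\<^esub>}" "finite {b \<in> B. g b \<noteq> \<zero>\<^bsub>A\<^esub>}" for f g
    by (rule finite_subset[OF _ finite_UnI[OF that(3,4)]]) (use that in auto)
  have fin2: "finite {b \<in> B. f b \<otimes>\<^bsub>A\<^esub> a \<noteq> \<zero>\<^bsub>A\<^esub>}"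
    if "finite {b \<in> B. f b \<noteq> \<zero>\<^bsub>A\<^esub>}" "a \<in> carrier A" for f a
    by (rule finite_subset[OF _ that(1)]) (use that in auto)
  have fin3: "finite {b \<in> B. \<ominus>\<^bsub>A\<^esub> f b \<noteq> \<zero>\<^bsub>A\<^esub>}"
    if "finite {b \<in> B. f b \<noteq> \<zero>\<^bsub>A\<^esub>}" for f
    by (rule finite_subset[OF _ that(1)]) auto
  have G: "abelian_group (free_rmodule A B)"
  proof (rule abelian_groupI)
    show "\<exists>y\<in>carrier (free_rmodule A B). y \<oplus>\<^bsub>free_rmodule A B\<^esub> x = \<zero>\<^bsub>free_rmodule A B\<^esub>"
      if "x \<in> carrier (free_rmodule A B)" for x
      using that
      by (intro bexI[of _ "\<lambda>b\<in>B. \<ominus>\<^bsub>A\<^esub> x b"])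
        (auto simp: free_rmodule_def fin3 PiE_iff A.l_neg fun_eq_iff restrict_def extensional_def cong: conj_cong)
  qed (auto simp: free_rmodule_def PiE_iff A.a_ac fun_eq_iff fin extensional_def cong: conj_cong)
  show ?thesis
    by (intro right_module.intro right_module_axioms.intro assms G)
      (auto simp: free_rmodule_def PiE_iff A.m_assoc A.l_distr A.r_distr fun_eq_iff fin fin2 extensional_def cong: conj_cong)
qed

lemma basis_vec_closed: "ring A \<Longrightarrow> basis_vec A B c \<in> carrier (free_rmodule A B)"
  by (auto simp: basis_vec_def free_rmodule_def ring.ring_simprules(6) ring.ring_simprules(2) cong: conj_cong
      intro: finite_subset[of _ "{c}"])

context right_module begin

lemma lin_ext_eq:
  assumes g: "g \<in> B \<rightarrow> carrier M" and f: "f \<in> carrier (free_rmodule A B)"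
    and S: "finite S" "S \<subseteq> B" "{b \<in> B. f b \<noteq> \<zero>\<^bsub>A\<^esub>} \<subseteq> S"
  shows "lin_ext A B M g f = (\<Oplus>\<^bsub>M\<^esub>b\<in>S. f b \<odot>\<^bsub>M\<^esub> g b)"
  unfolding lin_ext_def
  using S g f
  by (intro M.add.finprod_mono_neutral_cong_left) (auto 4 4 simp: free_rmodule_def PiE_iff Pi_iff subset_iff intro!: act_closed)

lemma lin_ext_linear:
  assumes g: "g \<in> B \<rightarrow> carrier M"
  shows "lin_ext A B M g \<in> linear_maps A (free_rmodule A B) M"
proof -
  interpret F: right_module A "free_rmodule A B" by (rule free_right_module) (rule A.ring_axioms)
  let ?F = "free_rmodule A B"
  have c: "f b \<odot>\<^bsub>M\<^esub> g b \<in> carrier M" if "f \<in> carrier ?F" "b \<in> B" for f b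
    using that g by (auto simp: free_rmodule_def intro!: act_closed)
  have cl: "lin_ext A B M g f \<in> carrier M" if "f \<in> carrier ?F" for f
    unfolding lin_ext_def using that c by (intro M.finsum_closed) auto
  have fin: "finite {b \<in> B. f b \<noteq> \<zero>\<^bsub>A\<^esub>}" if "f \<in> carrier ?F" for f
    using that by (auto simp: free_rmodule_def)
  have add: "lin_ext A B M g (f \<oplus>\<^bsub>?F\<^esub> h) = lin_ext A B M g f \<oplus>\<^bsub>M\<^esub> lin_ext A B M g h"
    if f: "f \<in> carrier ?F" and h: "h \<in> carrier ?F" for f h
  proof -
    let ?S = "{b \<in> B. f b \<noteq> \<zero>\<^bsub>A\<^esub>} \<union> {b \<in> B. h b \<noteq> \<zero>\<^bsub>A\<^esub>}"
    have S: "finite ?S" "?S \<subseteq> B" using fin f h by auto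
    have "lin_ext A B M g (f \<oplus>\<^bsub>?F\<^esub> h) = (\<Oplus>\<^bsub>M\<^esub>b\<in>?S. (f \<oplus>\<^bsub>?F\<^esub> h) b \<odot>\<^bsub>M\<^esub> g b)"
      by (rule lin_ext_eq[OF g F.M.a_closed[OF f h] S]) (auto simp: free_rmodule_def)
    also have "\<dots> = (\<Oplus>\<^bsub>M\<^esub>b\<in>?S. f b \<odot>\<^bsub>M\<^esub> g b \<oplus>\<^bsub>M\<^esub> h b \<odot>\<^bsub>M\<^esub> g b)"
    proof (rule M.finsum_cong', rule refl)
      show "(\<lambda>b. f b \<odot>\<^bsub>M\<^esub> g b \<oplus>\<^bsub>M\<^esub> h b \<odot>\<^bsub>M\<^esub> g b) \<in> ?S \<rightarrow> carrier M"
        using c f h by auto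
      show "(f \<oplus>\<^bsub>?F\<^esub> h) b \<odot>\<^bsub>M\<^esub> g b = f b \<odot>\<^bsub>M\<^esub> g b \<oplus>\<^bsub>M\<^esub> h b \<odot>\<^bsub>M\<^esub> g b" if "b \<in> ?S" for b
      proof -
        have "b \<in> B" "f b \<in> carrier A" "h b \<in> carrier A" "g b \<in> carrier M"
          using that f h g by (auto simp: free_rmodule_def)
        then show ?thesis by (simp add: free_rmodule_def act_l_distr)
      qed
    qed
    also have "\<dots> = (\<Oplus>\<^bsub>M\<^esub>b\<in>?S. f b \<odot>\<^bsub>M\<^esub> g b) \<oplus>\<^bsub>M\<^esub> (\<Oplus>\<^bsub>M\<^esub>b\<in>?S. h b \<odot>\<^bsub>M\<^esub> g b)"
      using c f h by (intro M.finsum_addf) auto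
    also have "\<dots> = lin_ext A B M g f \<oplus>\<^bsub>M\<^esub> lin_ext A B M g h"
      using lin_ext_eq[OF g f S] lin_ext_eq[OF g h S] by auto
    finally show ?thesis .
  qed
  have sc: "lin_ext A B M g (a \<odot>\<^bsub>?F\<^esub> f) = a \<odot>\<^bsub>M\<^esub> lin_ext A B M g f"
    if a: "a \<in> carrier A" and f: "f \<in> carrier ?F" for a f
  proof -
    let ?S = "{b \<in> B. f b \<noteq> \<zero>\<^bsub>A\<^esub>}"
    have fS: "finite ?S" using fin f by auto
    have lift: "finite T \<Longrightarrow> T \<subseteq> B \<Longrightarrow> a \<odot>\<^bsub>M\<^esub> (\<Oplus>\<^bsub>M\<^esub>b\<in>T. f b \<odot>\<^bsub>M\<^esub> g b) = (\<Oplus>\<^bsub>M\<^esub>b\<in>T. a \<odot>\<^bsub>M\<^esub> (f b \<odot>\<^bsub>M\<^esub> g b))" for T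
    proof (induction T rule: finite_induct)
      case empty then show ?case using a by simp
    next
      case (insert b T)
      then have "(\<lambda>b. f b \<odot>\<^bsub>M\<^esub> g b) \<in> T \<rightarrow> carrier M" "f b \<odot>\<^bsub>M\<^esub> g b \<in> carrier M" using c f by auto
      then show ?case using insert a by (simp add: act_r_distr Pi_iff act_closed)
    qed
    have "lin_ext A B M g (a \<odot>\<^bsub>?F\<^esub> f) = (\<Oplus>\<^bsub>M\<^esub>b\<in>?S. (a \<odot>\<^bsub>?F\<^esub> f) b \<odot>\<^bsub>M\<^esub> g b)"
      by (rule lin_ext_eq[OF g F.act_closed[OF a f] fS]) (use a in \<open>auto simp: free_rmodule_def\<close>)
    also have "\<dots> = (\<Oplus>\<^bsub>M\<^esub>b\<in>?S. a \<odot>\<^bsub>M\<^esub> (f b \<odot>\<^bsub>M\<^esub> g b))"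
    proof (rule M.finsum_cong', rule refl)
      show "(\<lambda>b. a \<odot>\<^bsub>M\<^esub> (f b \<odot>\<^bsub>M\<^esub> g b)) \<in> ?S \<rightarrow> carrier M"
        using c f a act_closed by auto
      show "(a \<odot>\<^bsub>?F\<^esub> f) b \<odot>\<^bsub>M\<^esub> g b = a \<odot>\<^bsub>M\<^esub> (f b \<odot>\<^bsub>M\<^esub> g b)" if "b \<in> ?S" for b
      proof -
        have "b \<in> B" "f b \<in> carrier A" "g b \<in> carrier M"
          using that f g by (auto simp: free_rmodule_def)
        then show ?thesis using a by (simp add: free_rmodule_def act_assoc)
      qed
    qed
    also have "\<dots> = a \<odot>\<^bsub>M\<^esub> lin_ext A B M g f" using lift[of ?S] fS by (simp add: lin_ext_def)
    finally show ?thesis .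
  qed
  show ?thesis unfolding linear_maps_def using cl add sc by auto
qed

lemma lin_ext_basis:
  assumes g: "g \<in> B \<rightarrow> carrier M" and c: "c \<in> B"
  shows "lin_ext A B M g (basis_vec A B c) = g c"
proof -
  have gc: "g c \<in> carrier M" using g c by auto
  have "lin_ext A B M g (basis_vec A B c) = (\<Oplus>\<^bsub>M\<^esub>b\<in>{c}. basis_vec A B c b \<odot>\<^bsub>M\<^esub> g b)"
    by (rule lin_ext_eq[OF g basis_vec_closed[OF A.ring_axioms]])
      (use c in \<open>auto simp: basis_vec_def\<close>)
  then show ?thesis using c gc by (simp add: basis_vec_def act_one)
qed

lemma linear_lin_comb:
  assumes U: "right_module A U" and f: "f \<in> linear_maps A U M"
    and g: "g \<in> B \<rightarrow> carrier U" and xs: "set xs \<subseteq> B \<times> carrier A"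
  shows "f (lin_comb U g xs) = lin_comb M (f \<circ> g) xs"
proof -
  interpret U: right_module A U by fact
  have add: "\<And>x y. x \<in> carrier U \<Longrightarrow> y \<in> carrier U \<Longrightarrow> f (x \<oplus>\<^bsub>U\<^esub> y) = f x \<oplus>\<^bsub>M\<^esub> f y"
    and sc: "\<And>s x. s \<in> carrier A \<Longrightarrow> x \<in> carrier U \<Longrightarrow> f (s \<odot>\<^bsub>U\<^esub> x) = s \<odot>\<^bsub>M\<^esub> f x"
    and cl: "\<And>x. x \<in> carrier U \<Longrightarrow> f x \<in> carrier M"
    using f by (auto simp: linear_maps_def)
  have z: "f \<zero>\<^bsub>U\<^esub> = \<zero>\<^bsub>M\<^esub>"
    using sc[OF A.zero_closed U.M.zero_closed] cl[OF U.M.zero_closed] by simp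
  show ?thesis using xs
  proof (induction xs)
    case Nil then show ?case by (simp add: lin_comb_def z)
  next
    case (Cons p xs)
    obtain b a where p: "p = (b, a)" by force
    have "lin_comb U g xs \<in> carrier U" using U.lin_comb_closed[OF _ g] Cons.prems by auto
    moreover have "g b \<in> carrier U" "a \<in> carrier A" using Cons.prems g p by auto
    ultimately have "f (a \<odot>\<^bsub>U\<^esub> g b \<oplus>\<^bsub>U\<^esub> lin_comb U g xs) = a \<odot>\<^bsub>M\<^esub> f (g b) \<oplus>\<^bsub>M\<^esub> f (lin_comb U g xs)"
      by (simp add: add sc U.act_closed)
    then show ?case using Cons p by (simp add: lin_comb_def)
  qed
qed

lemma lin_comb_cong:
  "\<lbrakk>set xs \<subseteq> B \<times> carrier A; \<And>b. b \<in> B \<Longrightarrow> g b = h b\<rbrakk> \<Longrightarrow> lin_comb M g xs = lin_comb M h xs"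
  by (induction xs) (auto simp: lin_comb_def)

end

lemma free_spanned:
  assumes "ring A" and f: "f \<in> carrier (free_rmodule A B)"
  shows "\<exists>xs. set xs \<subseteq> B \<times> carrier A \<and> f = lin_comb (free_rmodule A B) (basis_vec A B) xs"
proof -
  interpret A: ring A by fact
  interpret F: right_module A "free_rmodule A B" by (rule free_right_module) fact
  let ?F = "free_rmodule A B"
  have "\<exists>xs. set xs \<subseteq> B \<times> carrier A \<and> f = lin_comb ?F (basis_vec A B) xs"
    if "finite S" "f \<in> carrier ?F" "{b \<in> B. f b \<noteq> \<zero>\<^bsub>A\<^esub>} \<subseteq> S" for S f
    using that
  proof (induction S arbitrary: f rule: finite_induct)
    case empty
    then have "f = \<zero>\<^bsub>?F\<^esub>" by (auto simp: free_rmodule_def fun_eq_iff PiE_iff extensional_def)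
    then show ?case by (intro exI[of _ "[]"]) (simp add: lin_comb_def)
  next
    case (insert c S)
    show ?case
    proof (cases "c \<in> B")
      case False
      then have "{b \<in> B. f b \<noteq> \<zero>\<^bsub>A\<^esub>} \<subseteq> S" using insert by auto
      then show ?thesis using insert by auto
    next
      case True
      define h where "h = (\<lambda>b\<in>B. if b = c then \<zero>\<^bsub>A\<^esub> else f b)"
      have fE: "f \<in> B \<rightarrow>\<^sub>E carrier A" and ff: "finite {b \<in> B. f b \<noteq> \<zero>\<^bsub>A\<^esub>}"
        using insert.prems by (auto simp: free_rmodule_def)
      have "finite {b \<in> B. h b \<noteq> \<zero>\<^bsub>A\<^esub>}"
        by (rule finite_subset[OF _ ff]) (auto simp: h_def)
      then have h: "h \<in> carrier ?F" using fE by (auto simp: free_rmodule_def h_def)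
      have "{b \<in> B. h b \<noteq> \<zero>\<^bsub>A\<^esub>} \<subseteq> S" using insert.prems by (auto simp: h_def)
      then obtain xs where xs: "set xs \<subseteq> B \<times> carrier A" "h = lin_comb ?F (basis_vec A B) xs"
        using insert.IH[OF h] by auto
      have "f = f c \<odot>\<^bsub>?F\<^esub> basis_vec A B c \<oplus>\<^bsub>?F\<^esub> h"
      proof
        fix b
        show "f b = (f c \<odot>\<^bsub>?F\<^esub> basis_vec A B c \<oplus>\<^bsub>?F\<^esub> h) b"
          using fE True
          by (cases "b \<in> B") (auto simp: free_rmodule_def basis_vec_def h_def PiE_iff extensional_def)
      qed
      then have "f = lin_comb ?F (basis_vec A B) ((c, f c) # xs)"
        using xs(2) by (simp add: lin_comb_def)
      moreover have "set ((c, f c) # xs) \<subseteq> B \<times> carrier A" using xs True fE by auto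
      ultimately show ?thesis by blast
    qed
  qed
  from this[of "{b \<in> B. f b \<noteq> \<zero>\<^bsub>A\<^esub>}" f] show ?thesis using f by (auto simp: free_rmodule_def)
qed

context right_module begin

text \<open>One step of the resolution: covering the kernel of \<open>lin_ext A B M g\<close>.\<close>

lemma image_eq_kernel:
  assumes g: "g \<in> B \<rightarrow> carrier M"
    and C: "C = {Syz xs |xs. set xs \<subseteq> B \<times> carrier A \<and> lin_comb M g xs = \<zero>\<^bsub>M\<^esub>}"
  shows "lin_ext A C (free_rmodule A B) (syz_elt A B) ` carrier (free_rmodule A C)
       = {f \<in> carrier (free_rmodule A B). lin_ext A B M g f = \<zero>\<^bsub>M\<^esub>}" (is "?L = ?R")
    and "syz_elt A B \<in> C \<rightarrow> carrier (free_rmodule A B)"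
proof -
  let ?F = "free_rmodule A B"
  interpret F: right_module A ?F by (rule free_right_module) (rule A.ring_axioms)
  interpret G: right_module A "free_rmodule A C" by (rule free_right_module) (rule A.ring_axioms)
  have bas: "basis_vec A B \<in> B \<rightarrow> carrier ?F" by (simp add: basis_vec_closed A.ring_axioms)
  show s: "syz_elt A B \<in> C \<rightarrow> carrier ?F"
    using F.lin_comb_closed[OF _ bas] by (auto simp: syz_elt_def C)
  have ext: "lin_ext A B M g (lin_comb ?F (basis_vec A B) xs) = lin_comb M g xs"
    if xs: "set xs \<subseteq> B \<times> carrier A" for xs
    using linear_lin_comb[OF F.right_module_axioms lin_ext_linear[OF g] bas xs]
      lin_comb_cong[OF xs, of "lin_ext A B M g \<circ> basis_vec A B" g] lin_ext_basis[OF g] by simp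
  have ker: "lin_ext A B M g (syz_elt A B c) = \<zero>\<^bsub>M\<^esub>" if "c \<in> C" for c
    using that ext by (auto simp: syz_elt_def C)
  note lin1 = lin_ext_linear[OF g] and lin2 = F.lin_ext_linear[OF s]
  have basC: "basis_vec A C \<in> C \<rightarrow> carrier (free_rmodule A C)"
    by (simp add: basis_vec_closed A.ring_axioms)
  show "?L = ?R"
  proof (intro equalityI subsetI)
    fix u assume "u \<in> ?L"
    then obtain f where f: "f \<in> carrier (free_rmodule A C)" and u: "u = lin_ext A C ?F (syz_elt A B) f" by auto
    have uc: "u \<in> carrier ?F" using f u lin2 by (auto simp: linear_maps_def)
    obtain xs where xs: "set xs \<subseteq> C \<times> carrier A" "f = lin_comb (free_rmodule A C) (basis_vec A C) xs"
      using free_spanned[OF A.ring_axioms f] by auto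
    have "u = lin_comb ?F (lin_ext A C ?F (syz_elt A B) \<circ> basis_vec A C) xs"
      unfolding u xs(2) by (rule F.linear_lin_comb[OF G.right_module_axioms lin2 basC xs(1)])
    also have "\<dots> = lin_comb ?F (syz_elt A B) xs"
      by (rule F.lin_comb_cong[OF xs(1)]) (simp add: F.lin_ext_basis[OF s])
    finally have "lin_ext A B M g u = lin_comb M (lin_ext A B M g \<circ> syz_elt A B) xs"
      using linear_lin_comb[OF F.right_module_axioms lin1 s xs(1)] by simp
    also have "\<dots> = lin_comb M (\<lambda>_. \<zero>\<^bsub>M\<^esub>) xs"
      by (rule lin_comb_cong[OF xs(1)]) (simp add: ker)
    also have "\<dots> = \<zero>\<^bsub>M\<^esub>" using xs(1) by (induction xs) (auto simp: lin_comb_def)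
    finally show "u \<in> ?R" using uc by simp
  next
    fix f assume f: "f \<in> ?R"
    then obtain xs where xs: "set xs \<subseteq> B \<times> carrier A" "f = lin_comb ?F (basis_vec A B) xs"
      using free_spanned[OF A.ring_axioms] by auto
    then have "Syz xs \<in> C" using f ext C by auto
    then have "lin_ext A C ?F (syz_elt A B) (basis_vec A C (Syz xs)) = f"
      using F.lin_ext_basis[OF s] xs by (simp add: syz_elt_def)
    then show "f \<in> ?L" using basis_vec_closed[OF A.ring_axioms, of C] by (metis imageI)
  qed
qed

lemma gen_elt_cells: "gen_elt \<in> cells A M 0 \<rightarrow> carrier M"
  by auto

end

lemma
  assumes "right_module A M"
  shows std_res_module: "right_module A (res_mod A M n)"
    and std_res_aug_linear: "res_aug A M \<in> linear_maps A (res_mod A M 0) M"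
    and std_res_diff_linear:
      "res_diff A M n \<in> linear_maps A (res_mod A M (Suc n)) (res_mod A M n)"
    and std_res_aug_surj: "res_aug A M ` carrier (res_mod A M 0) = carrier M"
    and std_res_exact_0: "res_diff A M 0 ` carrier (res_mod A M (Suc 0))
      = {f \<in> carrier (res_mod A M 0). res_aug A M f = \<zero>\<^bsub>M\<^esub>}"
    and std_res_exact: "res_diff A M (Suc n) ` carrier (res_mod A M (Suc (Suc n)))
      = {f \<in> carrier (res_mod A M (Suc n)). res_diff A M n f = \<zero>\<^bsub>res_mod A M n\<^esub>}"
proof -
  interpret right_module A M by fact
  have P: "right_module A (res_mod A M n)" for n
    unfolding res_mod_def by (rule free_right_module) (rule A.ring_axioms)
  have s: "syz_elt A (cells A M n) \<in> cells A M (Suc n) \<rightarrow> carrier (res_mod A M n)" for n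
  proof (induction n)
    case 0
    show ?case unfolding res_mod_def by (rule image_eq_kernel(2)[OF gen_elt_cells]) simp
  next
    case (Suc n)
    interpret P: right_module A "res_mod A M n" by (rule P)
    show ?case unfolding res_mod_def
      by (rule P.image_eq_kernel(2)[OF Suc]) (simp add: res_mod_def)
  qed
  show "right_module A (res_mod A M n)" by (rule P)
  show aug: "res_aug A M \<in> linear_maps A (res_mod A M 0) M"
    unfolding res_aug_def res_mod_def by (rule lin_ext_linear[OF gen_elt_cells])
  interpret P: right_module A "res_mod A M n" by (rule P)
  show "res_diff A M n \<in> linear_maps A (res_mod A M (Suc n)) (res_mod A M n)"
    unfolding res_diff_def using P.lin_ext_linear[OF s] by (simp add: res_mod_def[of _ _ "Suc n"])
  show "res_aug A M ` carrier (res_mod A M 0) = carrier M"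
  proof (intro equalityI subsetI)
    fix x assume "x \<in> carrier M"
    then have "res_aug A M (basis_vec A (cells A M 0) (Gen x)) = x"
      unfolding res_aug_def by (subst lin_ext_basis[OF gen_elt_cells]) auto
    moreover have "basis_vec A (cells A M 0) (Gen x) \<in> carrier (res_mod A M 0)"
      unfolding res_mod_def by (rule basis_vec_closed[OF A.ring_axioms])
    ultimately show "x \<in> res_aug A M ` carrier (res_mod A M 0)" by (metis imageI)
  qed (use aug in \<open>auto simp: linear_maps_def\<close>)
  show "res_diff A M 0 ` carrier (res_mod A M (Suc 0))
      = {f \<in> carrier (res_mod A M 0). res_aug A M f = \<zero>\<^bsub>M\<^esub>}"
    unfolding res_diff_def res_mod_def res_aug_def
    by (rule image_eq_kernel(1)[OF gen_elt_cells]) simp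
  show "res_diff A M (Suc n) ` carrier (res_mod A M (Suc (Suc n)))
      = {f \<in> carrier (res_mod A M (Suc n)). res_diff A M n f = \<zero>\<^bsub>res_mod A M n\<^esub>}"
    using P.image_eq_kernel(1)[OF s, of "cells A M (Suc (Suc n))"]
    unfolding res_diff_def by (simp add: res_mod_def)
qed

end

theory Submission
  imports Defs
begin

text \<open>Finitely many commuting idempotents can be joined (\<open>e \<or> f = e + f - e f\<close>), so each \<open>J\<^sub>i\<close> has the form
  \<open>A e\<^sub>i\<close> with \<open>x e\<^sub>i = x\<close> for \<open>x \<in> J\<^sub>i\<close>. Let \<open>P \<rightarrow> M\<close> be a resolution by free right \<open>A\<close>-modules. Since
  \<open>I\<close> is the direct sum of the \<open>A e\<^sub>i\<close>, the complex \<open>P I\<close> is the direct sum of the complexes \<open>P e\<^sub>i\<close>.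
  These are exact, also in degree \<open>0\<close> because \<open>M e\<^sub>i = 0\<close>; hence so is \<open>P I\<close>, and \<open>P / P I\<close> is a
  resolution of \<open>M\<close> by free \<open>A / I\<close>-modules. As \<open>I N = 0\<close>, the complexes \<open>P \<otimes>\<^sub>A N\<close> and
  \<open>(P / P I) \<otimes>\<^bsub>A / I\<^esub> N\<close> are isomorphic, and any free resolution computes \<open>Tor\<close>.\<close>

section \<open>Linear maps, quotients and homology\<close>

text \<open>The obstacle is one of sides. The \<open>J i\<close> are left ideals while the
  resolution consists of right modules, so the pieces \<open>P e\<^sub>i\<close> are in general only
  subgroups of P. They form subcomplexes nevertheless: a right linear map between free right modules
  acts on coefficients as left multiplication by a matrix, hence commutes with every left linear map
  applied to all coefficients, in particular with the projections of I onto \<open>J i\<close>.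
  Since \<open>x e\<^sub>i = x\<close> on \<open>J i\<close>, right multiplication by
  \<open>e\<^sub>i\<close>, which commutes with the differential, turns any preimage of a
  \<open>J i\<close>-valued vector into a \<open>J i\<close>-valued preimage. Exactness of P thus
  passes to each piece without any flatness. Independence of the resolution is needed because
  \<open>Tor\<close> is fixed by one particular choice, built from \<open>cells\<close>: reducing
  the standard resolution over A gives modules that are free on the cells over A, whereas
  \<open>Tor\<close> over the quotient is built from the cells over the quotient.\<close>

definition additive_maps ::
    "('u, 'z1) ring_scheme \<Rightarrow> ('v, 'z2) ring_scheme \<Rightarrow> ('u \<Rightarrow> 'v) set" where
  "additive_maps U V = {f \<in> carrier U \<rightarrow> carrier V.
     \<forall>x\<in>carrier U. \<forall>y\<in>carrier U. f (x \<oplus>\<^bsub>U\<^esub> y) = f x \<oplus>\<^bsub>V\<^esub> f y}"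

lemma additive_maps_hom:
  assumes "abelian_group U" "abelian_group V" "f \<in> additive_maps U V"
  shows "abelian_group_hom U V f"
proof (intro abelian_group_homI assms group_hom.intro group_hom_axioms.intro)
  show "f \<in> hom (add_monoid U) (add_monoid V)" using assms(3) by (auto simp: additive_maps_def hom_def)
qed (use assms abelian_group.a_group in auto)

lemma linear_maps_additive: "f \<in> linear_maps S U V \<Longrightarrow> f \<in> additive_maps U V"
  by (auto simp: linear_maps_def additive_maps_def)

lemma linear_maps_closed: "f \<in> linear_maps S U V \<Longrightarrow> x \<in> carrier U \<Longrightarrow> f x \<in> carrier V"
  and linear_maps_add: "f \<in> linear_maps S U V \<Longrightarrow> x \<in> carrier U \<Longrightarrow> y \<in> carrier U
    \<Longrightarrow> f (x \<oplus>\<^bsub>U\<^esub> y) = f x \<oplus>\<^bsub>V\<^esub> f y"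
  and linear_maps_smult: "f \<in> linear_maps S U V \<Longrightarrow> s \<in> carrier S \<Longrightarrow> x \<in> carrier U
    \<Longrightarrow> f (s \<odot>\<^bsub>U\<^esub> x) = s \<odot>\<^bsub>V\<^esub> f x"
  by (auto simp: linear_maps_def)

lemma linear_maps_comp:
  "f \<in> linear_maps S U V \<Longrightarrow> g \<in> linear_maps S V W \<Longrightarrow> (\<lambda>x. g (f x)) \<in> linear_maps S U W"
  by (auto simp: linear_maps_def Pi_iff)

lemma linear_maps_id: "(\<lambda>x. x) \<in> linear_maps S U U"
  by (auto simp: linear_maps_def)

lemma isomorphic_modules_trans:
  assumes "isomorphic_modules S U V" "isomorphic_modules S V W"
  shows "isomorphic_modules S U W"
proof -
  obtain f g where "f \<in> linear_maps S U V" "bij_betw f (carrier U) (carrier V)"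
    "g \<in> linear_maps S V W" "bij_betw g (carrier V) (carrier W)"
    using assms by (auto simp: isomorphic_modules_def)
  then show ?thesis unfolding isomorphic_modules_def
    using linear_maps_comp bij_betw_trans[unfolded comp_def] by blast
qed

text \<open>The action is not assumed to make \<open>U\<close> a module: for \<open>tensor_pre\<close> it is linear in the scalar
  only modulo the relations.\<close>

locale action_subgroup = abelian_subgroup K U for R :: "'r set" and K and U :: "('r, 'u) module" +
  assumes smult_closed: "s \<in> R \<Longrightarrow> x \<in> carrier U \<Longrightarrow> s \<odot>\<^bsub>U\<^esub> x \<in> carrier U"
    and smult_add: "s \<in> R \<Longrightarrow> x \<in> carrier U \<Longrightarrow> y \<in> carrier U
      \<Longrightarrow> s \<odot>\<^bsub>U\<^esub> (x \<oplus>\<^bsub>U\<^esub> y) = s \<odot>\<^bsub>U\<^esub> x \<oplus>\<^bsub>U\<^esub> s \<odot>\<^bsub>U\<^esub> y"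
    and smult_sub: "s \<in> R \<Longrightarrow> x \<in> K \<Longrightarrow> s \<odot>\<^bsub>U\<^esub> x \<in> K"
begin

lemma quot_smult: "s \<in> R \<Longrightarrow> x \<in> carrier U
    \<Longrightarrow> s \<odot>\<^bsub>quot_module U K\<^esub> (K +>\<^bsub>U\<^esub> x) = K +>\<^bsub>U\<^esub> (s \<odot>\<^bsub>U\<^esub> x)"
  using quot_act[OF additive_subgroup_axioms abelian_group_axioms smult_closed smult_add smult_sub]
  by (simp add: quot_module_def)

lemma quot_add: "x \<in> carrier U \<Longrightarrow> y \<in> carrier U
    \<Longrightarrow> (K +>\<^bsub>U\<^esub> x) \<oplus>\<^bsub>quot_module U K\<^esub> (K +>\<^bsub>U\<^esub> y) = K +>\<^bsub>U\<^esub> (x \<oplus>\<^bsub>U\<^esub> y)"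
  by (simp add: quot_module_def a_rcos_sum)

lemma quot_carrier: "carrier (quot_module U K) = (\<lambda>x. K +>\<^bsub>U\<^esub> x) ` carrier U"
  by (auto simp: quot_module_def A_RCOSETS_def')

lemma coset_eq_iff:
  assumes "x \<in> carrier U" "y \<in> carrier U"
  shows "K +>\<^bsub>U\<^esub> x = K +>\<^bsub>U\<^esub> y \<longleftrightarrow> x \<ominus>\<^bsub>U\<^esub> y \<in> K"
proof -
  have "K +>\<^bsub>U\<^esub> x = K +>\<^bsub>U\<^esub> y \<longleftrightarrow> x \<in> K +>\<^bsub>U\<^esub> y"
    using a_rcos_self[OF assms(1)] a_repr_independence'[OF _ assms(2)] by blast
  then show ?thesis using a_rcos_module[OF assms(2,1)] by (simp add: a_minus_def)
qed

lemma coset_mem_eq: "x \<in> carrier U \<Longrightarrow> y \<in> K +>\<^bsub>U\<^esub> x \<Longrightarrow> K +>\<^bsub>U\<^esub> y = K +>\<^bsub>U\<^esub> x"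
  using a_repr_independence' by blast

end

text \<open>Injectivity of the induced map is the condition
  \<open>f x \<in> L \<longleftrightarrow> x \<in> K\<close>, and \<open>f\<close> has to be onto
  only up to \<open>L\<close>. The lemma is applied to cycles modulo boundaries and to formal sums
  modulo tensor relations.\<close>

lemma quot_module_iso:
  assumes "action_subgroup R K U" "action_subgroup R L V"
    and f: "f \<in> additive_maps U V"
    and fs: "\<And>s x. s \<in> R \<Longrightarrow> x \<in> carrier U \<Longrightarrow> f (s \<odot>\<^bsub>U\<^esub> x) = s \<odot>\<^bsub>V\<^esub> f x"
    and fK: "\<And>x. x \<in> carrier U \<Longrightarrow> f x \<in> L \<longleftrightarrow> x \<in> K"
    and sur: "\<And>y. y \<in> carrier V \<Longrightarrow> \<exists>x\<in>carrier U. y \<ominus>\<^bsub>V\<^esub> f x \<in> L"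
  obtains F where "bij_betw F (carrier (quot_module U K)) (carrier (quot_module V L))"
    and "\<And>x. x \<in> carrier U \<Longrightarrow> F (K +>\<^bsub>U\<^esub> x) = L +>\<^bsub>V\<^esub> f x"
    and "F \<in> additive_maps (quot_module U K) (quot_module V L)"
    and "\<And>s X. s \<in> R \<Longrightarrow> X \<in> carrier (quot_module U K)
      \<Longrightarrow> F (s \<odot>\<^bsub>quot_module U K\<^esub> X) = s \<odot>\<^bsub>quot_module V L\<^esub> F X"
proof -
  interpret U: action_subgroup R K U by fact
  interpret V: action_subgroup R L V by fact
  interpret f: abelian_group_hom U V f
    by (rule additive_maps_hom[OF U.abelian_group_axioms V.abelian_group_axioms f])
  have eq: "L +>\<^bsub>V\<^esub> f x = L +>\<^bsub>V\<^esub> f y \<longleftrightarrow> K +>\<^bsub>U\<^esub> x = K +>\<^bsub>U\<^esub> y"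
    if "x \<in> carrier U" "y \<in> carrier U" for x y
  proof -
    have "f x \<ominus>\<^bsub>V\<^esub> f y = f (x \<ominus>\<^bsub>U\<^esub> y)" using that by (simp add: a_minus_def)
    then show ?thesis using that fK[of "x \<ominus>\<^bsub>U\<^esub> y"] by (simp add: U.coset_eq_iff V.coset_eq_iff)
  qed
  \<comment> \<open>\<open>eq\<close> shows that this description determines a single coset; read in
    the other direction it gives injectivity.\<close>
  define F where "F X = (THE Y. \<exists>x\<in>carrier U. X = K +>\<^bsub>U\<^esub> x \<and> Y = L +>\<^bsub>V\<^esub> f x)" for X
  have F: "F (K +>\<^bsub>U\<^esub> x) = L +>\<^bsub>V\<^esub> f x" if "x \<in> carrier U" for x
    unfolding F_def using that eq by (intro the_equality) blast+
  show thesis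
  proof
    show "bij_betw F (carrier (quot_module U K)) (carrier (quot_module V L))"
      unfolding bij_betw_def
    proof
      show "inj_on F (carrier (quot_module U K))"
        by (rule inj_onI) (auto simp: U.quot_carrier F eq)
      have "L +>\<^bsub>V\<^esub> y \<in> F ` carrier (quot_module U K)" if y: "y \<in> carrier V" for y
      proof -
        obtain x where "x \<in> carrier U" "y \<ominus>\<^bsub>V\<^esub> f x \<in> L" using sur y by blast
        then have "L +>\<^bsub>V\<^esub> y = F (K +>\<^bsub>U\<^esub> x)" "x \<in> carrier U" using y by (simp_all add: F V.coset_eq_iff)
        then show ?thesis by (auto simp: U.quot_carrier)
      qed
      then show "F ` carrier (quot_module U K) = carrier (quot_module V L)"
        by (auto simp: U.quot_carrier V.quot_carrier F)
    qed
    show "F (K +>\<^bsub>U\<^esub> x) = L +>\<^bsub>V\<^esub> f x" if "x \<in> carrier U" for x using F that .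
    show "F \<in> additive_maps (quot_module U K) (quot_module V L)"
      unfolding additive_maps_def
      by (auto simp: U.quot_carrier V.quot_carrier F U.quot_add V.quot_add)
    show "F (s \<odot>\<^bsub>quot_module U K\<^esub> X) = s \<odot>\<^bsub>quot_module V L\<^esub> F X"
      if "s \<in> R" "X \<in> carrier (quot_module U K)" for s X
      using that by (auto simp: U.quot_carrier F fs U.quot_smult V.quot_smult U.smult_closed)
  qed
qed

section \<open>Chain complexes of R-modules and their homology\<close>

locale chain_complex =
  fixes R :: "'r ring" and C :: "nat \<Rightarrow> ('r, 'c) module" and d
  assumes mod: "module R (C n)"
    and d_linear: "d n \<in> linear_maps R (C (Suc n)) (C n)"
    and d_d: "x \<in> carrier (C (Suc (Suc n))) \<Longrightarrow> d n (d (Suc n) x) = \<zero>\<^bsub>C n\<^esub>"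
begin

lemma boundaries_subset: "boundaries C d n \<subseteq> cycles C d n"
  using linear_maps_closed[OF d_linear] d_d
  by (auto simp: boundaries_def cycles_def split: nat.split)

lemma cycles_closed: "x \<in> cycles C d n \<Longrightarrow> x \<in> carrier (C n)"
  by (auto simp: cycles_def split: nat.splits)

lemma d_cycle: "x \<in> carrier (C (Suc n)) \<Longrightarrow> d n x \<in> cycles C d n"
  using boundaries_subset by (auto simp: boundaries_def)

lemma hom_group: "abelian_group (C n\<lparr>carrier := cycles C d n\<rparr>)"
  and hom_action: "action_subgroup (carrier R) (boundaries C d n) (C n\<lparr>carrier := cycles C d n\<rparr>)"
proof -
  have ag: "abelian_group (C n)" for n using mod by (simp add: module_def)
  interpret C: module R "C n" by (rule mod)
  interpret D: module R "C (Suc n)" by (rule mod)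
  interpret d: abelian_group_hom "C (Suc m)" "C m" "d m" for m
    by (intro additive_maps_hom ag linear_maps_additive[OF d_linear])
  have z: "\<zero>\<^bsub>C n\<^esub> \<in> cycles C d n" by (auto simp: cycles_def split: nat.split)
  have a: "x \<oplus>\<^bsub>C n\<^esub> y \<in> cycles C d n" if "x \<in> cycles C d n" "y \<in> cycles C d n" for x y
    using that by (auto simp: cycles_def linear_maps_add[OF d_linear] split: nat.splits)
  have i: "\<ominus>\<^bsub>C n\<^esub> x \<in> cycles C d n" if "x \<in> cycles C d n" for x
    using that by (auto simp: cycles_def split: nat.splits)
  have s: "r \<odot>\<^bsub>C n\<^esub> x \<in> cycles C d n" if "x \<in> cycles C d n" "r \<in> carrier R" for r x
  proof (cases n)
    case (Suc k)
    interpret C': module R "C k" by (rule mod)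
    interpret C1: module R "C (Suc k)" by (rule mod)
    have "d k (r \<odot>\<^bsub>C n\<^esub> x) = r \<odot>\<^bsub>C k\<^esub> d k x"
      using that linear_maps_smult[OF d_linear] by (simp add: cycles_def Suc)
    then show ?thesis using that C1.smult_closed by (simp add: cycles_def Suc)
  next
    case 0
    interpret C0: module R "C 0" by (rule mod)
    show ?thesis using that C0.smult_closed by (simp add: cycles_def 0)
  qed
  show G: "abelian_group (C n\<lparr>carrier := cycles C d n\<rparr>)"
  proof (rule abelian_groupI, goal_cases)
    case (6 x)
    then have x: "x \<in> cycles C d n" by simp
    show ?case using i[OF x] C.M.l_neg[OF cycles_closed[OF x]] by (intro bexI[of _ "\<ominus>\<^bsub>C n\<^esub> x"]) simp_all
  qed (use a z cycles_closed C.M.a_ac in \<open>auto\<close>)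
  then interpret G: abelian_group "C n\<lparr>carrier := cycles C d n\<rparr>" .
  have B: "additive_subgroup (boundaries C d n) (C n\<lparr>carrier := cycles C d n\<rparr>)"
  proof (rule additive_subgroup.intro, rule group.subgroupI)
    show "group (add_monoid (C n\<lparr>carrier := cycles C d n\<rparr>))" by (rule G.a_group)
    show "boundaries C d n \<subseteq> carrier (add_monoid (C n\<lparr>carrier := cycles C d n\<rparr>))"
      using boundaries_subset by simp
    show "boundaries C d n \<noteq> {}" unfolding boundaries_def using D.M.zero_closed by blast
    fix u v assume "u \<in> boundaries C d n" "v \<in> boundaries C d n"
    then obtain x y where xy: "u = d n x" "v = d n y" "x \<in> carrier (C (Suc n))" "y \<in> carrier (C (Suc n))"
      by (auto simp: boundaries_def)
    then have "u \<oplus>\<^bsub>C n\<^esub> v = d n (x \<oplus>\<^bsub>C (Suc n)\<^esub> y)" by simp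
    then show "u \<otimes>\<^bsub>add_monoid (C n\<lparr>carrier := cycles C d n\<rparr>)\<^esub> v \<in> boundaries C d n"
      using xy by (simp add: boundaries_def del: d.hom_add)
    have "\<ominus>\<^bsub>C n\<lparr>carrier := cycles C d n\<rparr>\<^esub> u = d n (\<ominus>\<^bsub>C (Suc n)\<^esub> x)"
      using xy d_cycle i by (intro G.minus_equality) (auto simp: C.M.l_neg)
    then show "inv\<^bsub>add_monoid (C n\<lparr>carrier := cycles C d n\<rparr>)\<^esub> u \<in> boundaries C d n"
      using xy by (auto simp: boundaries_def a_inv_def)
  qed
  have sB: "r \<odot>\<^bsub>C n\<^esub> u \<in> boundaries C d n" if "r \<in> carrier R" "u \<in> boundaries C d n" for r u
    using that linear_maps_smult[OF d_linear, symmetric] D.smult_closed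
    by (auto simp: boundaries_def)
  show "action_subgroup (carrier R) (boundaries C d n) (C n\<lparr>carrier := cycles C d n\<rparr>)"
    by (intro action_subgroup.intro abelian_subgroupI3 B G action_subgroup_axioms.intro)
      (use s sB C.smult_r_distr cycles_closed in auto)
qed

text \<open>A chain homotopy yields \<open>x \<oplus> b\<close> with a boundary \<open>b\<close>
  where \<open>x\<close> is wanted. The first part then serves injectivity on homology, the second
  surjectivity; both amount to closure of the boundaries under subtraction and negation.\<close>

lemma boundaries_cancel:
  assumes x: "x \<in> carrier (C n)" and b: "b \<in> boundaries C d n"
  shows "x \<oplus>\<^bsub>C n\<^esub> b \<in> boundaries C d n \<Longrightarrow> x \<in> boundaries C d n"
    and "x \<ominus>\<^bsub>C n\<^esub> (x \<oplus>\<^bsub>C n\<^esub> b) \<in> boundaries C d n"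
proof -
  interpret C: module R "C n" by (rule mod)
  interpret D: module R "C (Suc n)" by (rule mod)
  interpret d: abelian_group_hom "C (Suc n)" "C n" "d n"
    by (intro additive_maps_hom linear_maps_additive[OF d_linear] C.M.abelian_group_axioms D.M.abelian_group_axioms)
  obtain y where y: "y \<in> carrier (C (Suc n))" "b = d n y" using b by (auto simp: boundaries_def)
  have "x \<ominus>\<^bsub>C n\<^esub> (x \<oplus>\<^bsub>C n\<^esub> b) = d n (\<ominus>\<^bsub>C (Suc n)\<^esub> y)"
    using x y by (simp add: a_minus_def C.M.minus_add C.M.a_assoc[symmetric] C.M.r_neg)
  then show "x \<ominus>\<^bsub>C n\<^esub> (x \<oplus>\<^bsub>C n\<^esub> b) \<in> boundaries C d n"
    using y by (simp add: boundaries_def del: d.hom_a_inv)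
  assume "x \<oplus>\<^bsub>C n\<^esub> b \<in> boundaries C d n"
  then obtain z where z: "z \<in> carrier (C (Suc n))" "x \<oplus>\<^bsub>C n\<^esub> b = d n z" by (auto simp: boundaries_def)
  have "x = (x \<oplus>\<^bsub>C n\<^esub> b) \<ominus>\<^bsub>C n\<^esub> b" using x y by (simp add: a_minus_def C.M.a_assoc C.M.r_neg)
  also have "\<dots> = d n (z \<ominus>\<^bsub>C (Suc n)\<^esub> y)" using z y by (simp add: a_minus_def)
  finally show "x \<in> boundaries C d n" using z y by (simp add: boundaries_def)
qed

text \<open>Negation is defined through the carrier of the record, so shrinking the carrier to the
  cycles changes the term for the difference. Uniqueness of inverses in \<open>C n\<close> shows
  that its value stays the same.\<close>

lemma cycles_minus:
  assumes "x \<in> cycles C d n" "y \<in> cycles C d n"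
  shows "x \<ominus>\<^bsub>C n\<lparr>carrier := cycles C d n\<rparr>\<^esub> y = x \<ominus>\<^bsub>C n\<^esub> y"
proof -
  interpret G: abelian_group "C n\<lparr>carrier := cycles C d n\<rparr>" by (rule hom_group)
  interpret C: module R "C n" by (rule mod)
  have "\<ominus>\<^bsub>C n\<^esub> y = \<ominus>\<^bsub>C n\<lparr>carrier := cycles C d n\<rparr>\<^esub> y"
    by (rule C.minus_equality) (use G.l_neg assms cycles_closed G.a_inv_closed in auto)
  then show ?thesis by (simp add: a_minus_def)
qed

end

lemma chain_map_cycles:
  assumes "chain_complex R C d" "chain_complex R D e"
    and lin: "\<And>n. \<phi> n \<in> linear_maps R (C n) (D n)"
    and comm: "\<And>n x. x \<in> carrier (C (Suc n)) \<Longrightarrow> \<phi> n (d n x) = e n (\<phi> (Suc n) x)"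
    and x: "x \<in> cycles C d n"
  shows "\<phi> n x \<in> cycles D e n"
proof -
  interpret C: chain_complex R C d by fact
  interpret D: chain_complex R D e by fact
  interpret \<phi>: abelian_group_hom "C m" "D m" "\<phi> m" for m
    using C.mod[of m] D.mod[of m] by (intro additive_maps_hom linear_maps_additive[OF lin]) (simp_all add: module_def)
  show ?thesis using x comm[symmetric] by (auto simp: cycles_def split: nat.splits)
qed

text \<open>The conditions on kernel and image are imposed on cycles in the single degree
  \<open>n\<close>, not on homology classes. In this form they can be read off both from an
  isomorphism of complexes and from two chain maps that are inverse up to homotopy.\<close>

lemma homology_iso:
  assumes "chain_complex R C d" "chain_complex R D e"
    and lin: "\<And>n. \<phi> n \<in> linear_maps R (C n) (D n)"
    and comm: "\<And>n x. x \<in> carrier (C (Suc n)) \<Longrightarrow> \<phi> n (d n x) = e n (\<phi> (Suc n) x)"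
    and inj: "\<And>x. x \<in> cycles C d n \<Longrightarrow> \<phi> n x \<in> boundaries D e n \<Longrightarrow> x \<in> boundaries C d n"
    and sur: "\<And>y. y \<in> cycles D e n \<Longrightarrow> \<exists>x\<in>cycles C d n. y \<ominus>\<^bsub>D n\<^esub> \<phi> n x \<in> boundaries D e n"
  shows "isomorphic_modules R (homology C d n) (homology D e n)"
proof -
  interpret C: chain_complex R C d by fact
  interpret D: chain_complex R D e by fact
  interpret \<phi>: abelian_group_hom "C m" "D m" "\<phi> m" for m
    using C.mod[of m] D.mod[of m] by (intro additive_maps_hom linear_maps_additive[OF lin]) (simp_all add: module_def)
  have cyc: "\<phi> n x \<in> cycles D e n" if "x \<in> cycles C d n" for x
    by (rule chain_map_cycles[where \<phi> = \<phi>, OF C.chain_complex_axioms D.chain_complex_axioms lin comm that])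
  have bd: "\<phi> n x \<in> boundaries D e n" if "x \<in> boundaries C d n" for x
    using that comm by (auto simp: boundaries_def)
  obtain F where "bij_betw F (carrier (homology C d n)) (carrier (homology D e n))"
    "F \<in> additive_maps (homology C d n) (homology D e n)"
    "\<And>s X. s \<in> carrier R \<Longrightarrow> X \<in> carrier (homology C d n)
      \<Longrightarrow> F (s \<odot>\<^bsub>homology C d n\<^esub> X) = s \<odot>\<^bsub>homology D e n\<^esub> F X"
    unfolding homology_def
  proof (rule quot_module_iso[OF C.hom_action[of n] D.hom_action[of n], where f = "\<phi> n"])
    show "\<phi> n \<in> additive_maps (C n\<lparr>carrier := cycles C d n\<rparr>) (D n\<lparr>carrier := cycles D e n\<rparr>)"
      using cyc C.cycles_closed by (auto simp: additive_maps_def)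
  next
    fix y assume "y \<in> carrier (D n\<lparr>carrier := cycles D e n\<rparr>)"
    then have y: "y \<in> cycles D e n" by simp
    obtain x where x: "x \<in> cycles C d n" "y \<ominus>\<^bsub>D n\<^esub> \<phi> n x \<in> boundaries D e n"
      using sur[OF y] by blast
    then show "\<exists>x\<in>carrier (C n\<lparr>carrier := cycles C d n\<rparr>).
      y \<ominus>\<^bsub>D n\<lparr>carrier := cycles D e n\<rparr>\<^esub> \<phi> n x \<in> boundaries D e n"
      by (intro bexI[of _ x]) (simp_all add: D.cycles_minus[OF y cyc])
  qed (use bd inj C.cycles_closed linear_maps_smult[OF lin] in \<open>auto\<close>)
  then show ?thesis
    unfolding isomorphic_modules_def linear_maps_def additive_maps_def by blast
qed

section \<open>Functoriality of the tensor product\<close>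

abbreviation frag_map :: "('m \<Rightarrow> 'k) \<Rightarrow> (('m \<times> 'n) \<Rightarrow>\<^sub>0 int) \<Rightarrow> (('k \<times> 'n) \<Rightarrow>\<^sub>0 int)" where
  "frag_map f \<equiv> frag_extend (\<lambda>(x, y). frag_of (f x, y))"

abbreviation tensor_class ::
    "('r, 'a) module \<Rightarrow> ('a, 'm) module \<Rightarrow> ('a, 'n) module \<Rightarrow> (('m \<times> 'n) \<Rightarrow>\<^sub>0 int) \<Rightarrow> (('m \<times> 'n) \<Rightarrow>\<^sub>0 int) set" where
  "tensor_class A M N z \<equiv> tensor_rels A M N +>\<^bsub>tensor_pre A M N\<^esub> z"

lemma tensor_pre_sel [simp]:
  "carrier (tensor_pre A M N) = {z. Poly_Mapping.keys z \<subseteq> carrier M \<times> carrier N}"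
  "add (tensor_pre A M N) = (+)" "zero (tensor_pre A M N) = 0"
  "r \<odot>\<^bsub>tensor_pre A M N\<^esub> z = frag_map (\<lambda>x. (r \<odot>\<^bsub>A\<^esub> \<one>\<^bsub>A\<^esub>) \<odot>\<^bsub>M\<^esub> x) z"
  by (simp_all add: tensor_pre_def)

lemma tensor_pre_group: "abelian_group (tensor_pre A M N)"
proof (rule abelian_groupI)
  show "x \<oplus>\<^bsub>tensor_pre A M N\<^esub> y \<in> carrier (tensor_pre A M N)"
    if "x \<in> carrier (tensor_pre A M N)" "y \<in> carrier (tensor_pre A M N)" for x y
    using that Poly_Mapping.keys_add[of x y] by auto
  show "\<exists>y\<in>carrier (tensor_pre A M N). y \<oplus>\<^bsub>tensor_pre A M N\<^esub> x = \<zero>\<^bsub>tensor_pre A M N\<^esub>"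
    if "x \<in> carrier (tensor_pre A M N)" for x
    using that by (intro bexI[of _ "- x"]) auto
qed (auto simp: algebra_simps)

lemma tensor_pre_minus:
  assumes "x \<in> carrier (tensor_pre A M N)" "y \<in> carrier (tensor_pre A M N)"
  shows "x \<ominus>\<^bsub>tensor_pre A M N\<^esub> y = x - y"
proof -
  interpret T: abelian_group "tensor_pre A M N" by (rule tensor_pre_group)
  have "\<ominus>\<^bsub>tensor_pre A M N\<^esub> y = - y" by (rule T.minus_equality) (use assms in auto)
  then show ?thesis by (simp add: a_minus_def)
qed

lemma frag_map_carrier:
  assumes f: "f \<in> S \<rightarrow> S'" and z: "Poly_Mapping.keys z \<subseteq> S \<times> T"
  shows "Poly_Mapping.keys (frag_map f z) \<subseteq> S' \<times> T"
proof
  fix p assume "p \<in> Poly_Mapping.keys (frag_map f z)"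
  then obtain x y where "(x, y) \<in> Poly_Mapping.keys z" "p = (f x, y)"
    using keys_frag_extend[of "\<lambda>(x, y). frag_of (f x, y)" z] by (force simp: keys_frag_of)
  then show "p \<in> S' \<times> T" using assms by auto
qed

lemma frag_map_comp: "frag_map g (frag_map f z) = frag_map (\<lambda>x. g (f x)) z"
proof -
  have *: "(\<lambda>(x, y). frag_of (f x, y)) = frag_of \<circ> (\<lambda>(x, y). (f x, y))" by auto
  show ?thesis unfolding * by (subst frag_extend_compose) (simp add: comp_def case_prod_unfold)
qed

lemma frag_map_cong:
  assumes "\<And>x. x \<in> S \<Longrightarrow> f x = g x" and "Poly_Mapping.keys z \<subseteq> S \<times> T"
  shows "frag_map f z = frag_map g z"
  using assms by (intro frag_extend_eq) auto

lemma frag_map_id: "frag_map (\<lambda>x. x) z = z"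
proof -
  have "frag_map (\<lambda>x. x) z = frag_extend frag_of z" by (intro frag_extend_eq) auto
  then show ?thesis by (simp only: frag_expansion[symmetric])
qed

section \<open>Tensor relations, the action of the ground ring, and induced maps\<close>

locale algebra_left_module = assoc_algebra R A + N: left_module A N
  for R :: "'r ring" and A :: "('r, 'a) module" and N :: "('a, 'n) module"
begin

abbreviation "unit_multiple r \<equiv> r \<odot>\<^bsub>A\<^esub> \<one>\<^bsub>A\<^esub>"

text \<open>Scalars act on \<open>tensor_pre\<close> through the elements
  \<open>unit_multiple r\<close>. As these are central, acting by one of them is linear over A and
  so respects the balancing relation.\<close>

lemma unit_multiple_central:
  "a \<in> carrier A \<Longrightarrow> r \<in> carrier R \<Longrightarrow> a \<otimes>\<^bsub>A\<^esub> unit_multiple r = unit_multiple r \<otimes>\<^bsub>A\<^esub> a"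
  by (simp add: smult_mult_left smult_mult_right)

context
  fixes M :: "('a, 'm) module"
  assumes M: "right_module A M"
begin

interpretation M: right_module A M by (rule M)
interpretation T: abelian_group "tensor_pre A M N" by (rule tensor_pre_group)

lemma tensor_gens_carrier: "tensor_gens A M N \<subseteq> carrier (tensor_pre A M N)"
proof
  have fr: "frag_of (x, y) \<in> carrier (tensor_pre A M N)" if "x \<in> carrier M" "y \<in> carrier N" for x y
    using that by (auto simp: keys_frag_of)
  have di: "x - y \<in> carrier (tensor_pre A M N)"
    if "x \<in> carrier (tensor_pre A M N)" "y \<in> carrier (tensor_pre A M N)" for x y
    using that keys_diff[of x y] by auto
  fix z assume "z \<in> tensor_gens A M N"
  then show "z \<in> carrier (tensor_pre A M N)"
    by cases (simp_all add: di fr M.act_closed N.act_closed del: tensor_pre_sel)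
qed

lemma tensor_rels_subgroup: "additive_subgroup (tensor_rels A M N) (tensor_pre A M N)"
  unfolding tensor_rels_def using tensor_gens_carrier
  by (intro additive_subgroup.intro group.generate_is_subgroup T.a_group) simp

interpretation K: additive_subgroup "tensor_rels A M N" "tensor_pre A M N"
  by (rule tensor_rels_subgroup)

lemma tensor_rels_incl: "z \<in> tensor_gens A M N \<Longrightarrow> z \<in> tensor_rels A M N"
  by (simp add: tensor_rels_def generate.incl)

lemma tensor_rels_zero: "0 \<in> tensor_rels A M N"
  using K.zero_closed by simp

lemma tensor_rels_add: "u \<in> tensor_rels A M N \<Longrightarrow> v \<in> tensor_rels A M N \<Longrightarrow> u + v \<in> tensor_rels A M N"
  using K.a_closed by simp

lemma tensor_rels_diff:
  assumes "u \<in> tensor_rels A M N" "v \<in> tensor_rels A M N" shows "u - v \<in> tensor_rels A M N"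
proof -
  have "u \<ominus>\<^bsub>tensor_pre A M N\<^esub> v \<in> tensor_rels A M N"
    unfolding a_minus_def by (rule K.a_closed[OF assms(1) K.a_inv_closed[OF assms(2)]])
  moreover have "u \<ominus>\<^bsub>tensor_pre A M N\<^esub> v = u - v"
    using assms K.a_subset by (intro tensor_pre_minus) auto
  ultimately show ?thesis by metis
qed

text \<open>\<open>frag_extend g\<close> is a homomorphism and a set that contains zero and is
  closed under differences is a subgroup, so generators are enough. The target \<open>S\<close> is
  left general because relations over A are also carried to relations over the quotient algebra, and
  back.\<close>

lemma tensor_rels_frag_extend:
  assumes z: "z \<in> tensor_rels A M N" and S: "0 \<in> S" "\<And>u v. u \<in> S \<Longrightarrow> v \<in> S \<Longrightarrow> u - v \<in> S"
    and g: "\<And>w. w \<in> tensor_gens A M N \<Longrightarrow> frag_extend g w \<in> S"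
  shows "frag_extend g z \<in> S"
proof -
  have neg: "inv\<^bsub>add_monoid (tensor_pre A M N)\<^esub> w = - w" if "w \<in> tensor_gens A M N" for w
  proof -
    have "\<ominus>\<^bsub>tensor_pre A M N\<^esub> w = - w"
      by (rule T.minus_equality) (use that tensor_gens_carrier in auto)
    then show ?thesis by (simp add: a_inv_def)
  qed
  have minus: "- v \<in> S" if "v \<in> S" for v using S(2)[OF S(1) that] by simp
  have plus: "u + v \<in> S" if "u \<in> S" "v \<in> S" for u v using S(2)[OF that(1) minus[OF that(2)]] by simp
  show ?thesis using z unfolding tensor_rels_def
  proof (induction rule: generate.induct)
    \<comment> \<open>\<open>generate\<close> uses the inverse of the group record;
      \<open>neg\<close> replaces it by the minus of formal sums.\<close>
    case (inv h) then show ?case by (simp only: neg frag_extend_minus minus g)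
  qed (simp_all add: S(1) g frag_extend_add plus)
qed

text \<open>The difference of two homomorphisms is a homomorphism, so congruence modulo the
  relations can be checked on single pairs. This handles maps that agree after tensoring but not on
  formal sums.\<close>

lemma tensor_rels_ext:
  assumes z: "Poly_Mapping.keys z \<subseteq> S" and "\<And>p. p \<in> S \<Longrightarrow> f p - g p \<in> tensor_rels A M N"
  shows "frag_extend f z - frag_extend g z \<in> tensor_rels A M N"
  using z
proof (induction z rule: frag_induction)
  case zero then show ?case by (simp add: tensor_rels_zero)
next
  case (one x) then show ?case using assms(2) by simp
next
  case (diff a b)
  have "frag_extend f (a - b) - frag_extend g (a - b) =
    (frag_extend f a - frag_extend g a) - (frag_extend f b - frag_extend g b)"
    by (simp add: frag_extend_diff)
  then show ?case using tensor_rels_diff[OF diff] by (simp only:)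
qed

end

lemma frag_map_rels:
  assumes M: "right_module A M" and M': "right_module A M'"
    and f: "f \<in> linear_maps A M M'" and z: "z \<in> tensor_rels A M N"
  shows "frag_map f z \<in> tensor_rels A M' N"
proof (rule tensor_rels_frag_extend[OF M z])
  note f = linear_maps_closed[OF f] linear_maps_add[OF f] linear_maps_smult[OF f]
  show "frag_map f w \<in> tensor_rels A M' N" if "w \<in> tensor_gens A M N" for w
    using that
  proof cases
    case (1 x x' y)
    then show ?thesis
      using f tensor_gens.intros(1)[of "f x" M' "f x'" y N A] by (intro tensor_rels_incl[OF M']) (simp add: frag_extend_diff)
  next
    case (2 x y y')
    then show ?thesis
      using f tensor_gens.intros(2)[of "f x" M' y N y' A] by (intro tensor_rels_incl[OF M']) (simp add: frag_extend_diff)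
  next
    case (3 x a y)
    then show ?thesis
      using f tensor_gens.intros(3)[of "f x" M' a A y N] by (intro tensor_rels_incl[OF M']) (simp add: frag_extend_diff)
  qed
qed (use tensor_rels_zero[OF M'] tensor_rels_diff[OF M'] in auto)

lemma unit_multiple_linear:
  assumes M: "right_module A M" and r: "r \<in> carrier R"
  shows "(\<lambda>x. unit_multiple r \<odot>\<^bsub>M\<^esub> x) \<in> linear_maps A M M"
proof -
  interpret M: right_module A M by (rule M)
  have "unit_multiple r \<odot>\<^bsub>M\<^esub> (a \<odot>\<^bsub>M\<^esub> x) = a \<odot>\<^bsub>M\<^esub> (unit_multiple r \<odot>\<^bsub>M\<^esub> x)"
    if "a \<in> carrier A" "x \<in> carrier M" for a x
    using that r unit_multiple_central[of a r] by (simp add: M.act_assoc[symmetric])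
  then show ?thesis using r by (auto simp: linear_maps_def M.act_closed M.act_r_distr)
qed

text \<open>A scalar acts on formal sums as \<open>frag_map\<close> of an A-linear map, so
  invariance of the relations is an instance of \<open>frag_map_rels\<close>.\<close>

lemma tensor_action_subgroup:
  assumes M: "right_module A M"
  shows "action_subgroup (carrier R) (tensor_rels A M N) (tensor_pre A M N)"
proof (intro action_subgroup.intro abelian_subgroupI3 tensor_rels_subgroup M tensor_pre_group
    action_subgroup_axioms.intro, goal_cases)
  case (1 s x)
  then show ?case using linear_maps_closed[OF unit_multiple_linear[OF M]]
    frag_map_carrier[of "\<lambda>x. unit_multiple s \<odot>\<^bsub>M\<^esub> x" "carrier M" "carrier M" x "carrier N"] by auto
next
  case (2 s x y) then show ?case by (simp add: frag_extend_add)
next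
  case (3 s x) then show ?case using frag_map_rels[OF M M unit_multiple_linear[OF M]] by simp
qed

lemma tensor_module: "right_module A M \<Longrightarrow> module R (tensor A M N)"
  using tensor_is_module assoc_algebra_axioms N.left_module_axioms by blast

context
  fixes M :: "('a, 'm) module"
  assumes M: "right_module A M"
begin

interpretation K: action_subgroup "carrier R" "tensor_rels A M N" "tensor_pre A M N"
  by (rule tensor_action_subgroup[OF M])

lemmas tensor_add = K.quot_add[folded tensor_def]
lemmas tensor_smult = K.quot_smult[folded tensor_def]
lemmas tensor_carrier = K.quot_carrier[folded tensor_def]

lemma tensor_class_eq_iff:
  "u \<in> carrier (tensor_pre A M N) \<Longrightarrow> v \<in> carrier (tensor_pre A M N)
    \<Longrightarrow> tensor_class A M N u = tensor_class A M N v \<longleftrightarrow> u - v \<in> tensor_rels A M N"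
  using K.coset_eq_iff by (simp add: tensor_pre_minus del: tensor_pre_sel)

text \<open>The union that defines \<open>tensor_map\<close> runs over all representatives of a
  class. Two of them differ by a relation, which \<open>frag_map f\<close> sends to a relation, so
  all members of the union are one coset.\<close>

lemma tensor_map_class:
  assumes M': "right_module A M'" and f: "f \<in> linear_maps A M M'"
    and z: "z \<in> carrier (tensor_pre A M N)"
  shows "tensor_map A M' N f (tensor_class A M N z) = tensor_class A M' N (frag_map f z)"
proof -
  interpret K': action_subgroup "carrier R" "tensor_rels A M' N" "tensor_pre A M' N"
    by (rule tensor_action_subgroup[OF M'])
  have fc: "frag_map f w \<in> carrier (tensor_pre A M' N)" if "w \<in> carrier (tensor_pre A M N)" for w
    using that linear_maps_closed[OF f] frag_map_carrier[of f "carrier M" "carrier M'" w "carrier N"] by auto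
  have "tensor_class A M' N (frag_map f w) = tensor_class A M' N (frag_map f z)"
    if w: "w \<in> tensor_class A M N z" for w
  proof -
    obtain k where k: "k \<in> tensor_rels A M N" "w = k + z" using w by (auto simp: a_r_coset_def')
    then have "frag_map f w = frag_map f k + frag_map f z" by (simp add: frag_extend_add)
    then have "frag_map f w \<in> tensor_class A M' N (frag_map f z)"
      using frag_map_rels[OF M M' f k(1)] by (auto simp: a_r_coset_def')
    then show ?thesis by (rule K'.coset_mem_eq[OF fc[OF z]])
  qed
  then show ?thesis unfolding tensor_map_def using K.a_rcos_self[OF z] by blast
qed

lemma frag_map_in_carrier:
  "f \<in> linear_maps A M M' \<Longrightarrow> z \<in> carrier (tensor_pre A M N) \<Longrightarrow> frag_map f z \<in> carrier (tensor_pre A M' N)"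
  using frag_map_carrier[of f "carrier M" "carrier M'" z "carrier N"] by (simp add: linear_maps_def)

end

lemma tensor_map_linear:
  assumes M: "right_module A M" and M': "right_module A M'" and f: "f \<in> linear_maps A M M'"
  shows "tensor_map A M' N f \<in> linear_maps R (tensor A M N) (tensor A M' N)"
proof -
  note fc = frag_map_in_carrier[OF M f]
  interpret K: action_subgroup "carrier R" "tensor_rels A M N" "tensor_pre A M N"
    by (rule tensor_action_subgroup[OF M])
  have comm: "frag_map f (r \<odot>\<^bsub>tensor_pre A M N\<^esub> z) = r \<odot>\<^bsub>tensor_pre A M' N\<^esub> frag_map f z"
    if "r \<in> carrier R" "z \<in> carrier (tensor_pre A M N)" for r z
  proof -
    have "frag_map (\<lambda>x. f (unit_multiple r \<odot>\<^bsub>M\<^esub> x)) z = frag_map (\<lambda>x. unit_multiple r \<odot>\<^bsub>M'\<^esub> f x) z"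
      by (rule frag_map_cong[of "carrier M" _ _ _ "carrier N"])
        (use that linear_maps_smult[OF f] in simp_all)
    then show ?thesis by (simp only: tensor_pre_sel(4) frag_map_comp)
  qed
  show ?thesis
    unfolding linear_maps_def
  proof (intro CollectI conjI ballI Pi_I)
    fix X assume "X \<in> carrier (tensor A M N)"
    then obtain x where x: "x \<in> carrier (tensor_pre A M N)" "X = tensor_class A M N x"
      unfolding tensor_carrier[OF M] by blast
    show "tensor_map A M' N f X \<in> carrier (tensor A M' N)"
      unfolding x(2) tensor_map_class[OF M M' f x(1)] tensor_carrier[OF M'] using fc[OF x(1)] by (rule imageI)
    show "tensor_map A M' N f (r \<odot>\<^bsub>tensor A M N\<^esub> X) = r \<odot>\<^bsub>tensor A M' N\<^esub> tensor_map A M' N f X"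
      if r: "r \<in> carrier R" for r
      unfolding x(2) tensor_smult[OF M r x(1)] tensor_map_class[OF M M' f x(1)]
        tensor_map_class[OF M M' f K.smult_closed[OF r x(1)]] tensor_smult[OF M' r fc[OF x(1)]] comm[OF r x(1)] ..
    fix Y assume "Y \<in> carrier (tensor A M N)"
    then obtain y where y: "y \<in> carrier (tensor_pre A M N)" "Y = tensor_class A M N y"
      unfolding tensor_carrier[OF M] by blast
    show "tensor_map A M' N f (X \<oplus>\<^bsub>tensor A M N\<^esub> Y)
        = tensor_map A M' N f X \<oplus>\<^bsub>tensor A M' N\<^esub> tensor_map A M' N f Y"
      unfolding x(2) y(2) tensor_add[OF M x(1) y(1)] tensor_map_class[OF M M' f x(1)]
        tensor_map_class[OF M M' f y(1)] tensor_map_class[OF M M' f K.add.m_closed[OF x(1) y(1)]]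
        tensor_add[OF M' fc[OF x(1)] fc[OF y(1)]]
      by (simp only: tensor_pre_sel(2) frag_extend_add)
  qed
qed

lemma tensor_map_comp:
  assumes "right_module A M" "right_module A M'" "right_module A M''"
    and f: "f \<in> linear_maps A M M'" and g: "g \<in> linear_maps A M' M''" and Z: "Z \<in> carrier (tensor A M N)"
  shows "tensor_map A M'' N g (tensor_map A M' N f Z) = tensor_map A M'' N (\<lambda>x. g (f x)) Z"
proof -
  obtain z where z: "z \<in> carrier (tensor_pre A M N)" and Zz: "Z = tensor_class A M N z"
    using Z unfolding tensor_carrier[OF assms(1)] by blast
  show ?thesis
    unfolding Zz tensor_map_class[OF assms(1,2) f z] tensor_map_class[OF assms(1,3) linear_maps_comp[OF f g] z]
      tensor_map_class[OF assms(2,3) g frag_map_in_carrier[OF assms(1) f z]] frag_map_comp ..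
qed

lemma tensor_map_cong:
  assumes M: "right_module A M" "right_module A M'"
    and f: "f \<in> linear_maps A M M'" "g \<in> linear_maps A M M'"
    and eq: "\<And>x. x \<in> carrier M \<Longrightarrow> f x = g x" and Z: "Z \<in> carrier (tensor A M N)"
  shows "tensor_map A M' N f Z = tensor_map A M' N g Z"
proof -
  obtain z where z: "z \<in> carrier (tensor_pre A M N)" "Z = tensor_class A M N z"
    using Z unfolding tensor_carrier[OF M(1)] by blast
  have "frag_map f z = frag_map g z"
    by (rule frag_map_cong[OF eq]) (use z in auto)
  then show ?thesis
    unfolding z(2) tensor_map_class[OF M f(1) z(1)] tensor_map_class[OF M f(2) z(1)] by simp
qed

lemma tensor_map_id:
  assumes M: "right_module A M" and Z: "Z \<in> carrier (tensor A M N)"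
  shows "tensor_map A M N (\<lambda>x. x) Z = Z"
proof -
  obtain z where z: "z \<in> carrier (tensor_pre A M N)" and Zz: "Z = tensor_class A M N z"
    using Z unfolding tensor_carrier[OF M] by blast
  show ?thesis
    unfolding Zz tensor_map_class[OF M M linear_maps_id z] frag_map_id ..
qed

lemma tensor_map_add:
  assumes M: "right_module A M" and M': "right_module A M'"
    and f: "f \<in> linear_maps A M M'" and g: "g \<in> linear_maps A M M'" and h: "h \<in> linear_maps A M M'"
    and eq: "\<And>x. x \<in> carrier M \<Longrightarrow> f x = g x \<oplus>\<^bsub>M'\<^esub> h x" and Z: "Z \<in> carrier (tensor A M N)"
  shows "tensor_map A M' N f Z = tensor_map A M' N g Z \<oplus>\<^bsub>tensor A M' N\<^esub> tensor_map A M' N h Z"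
proof -
  interpret T: abelian_group "tensor_pre A M' N" by (rule tensor_pre_group)
  obtain z where z: "z \<in> carrier (tensor_pre A M N)" "Z = tensor_class A M N z"
    using Z unfolding tensor_carrier[OF M] by blast
  note fz = frag_map_in_carrier[OF M f z(1)] frag_map_in_carrier[OF M g z(1)] frag_map_in_carrier[OF M h z(1)]
  \<comment> \<open>On formal sums \<open>frag_map f z\<close> and
    \<open>frag_map g z + frag_map h z\<close> are different. Writing the second as one extension
    along \<open>?s\<close> makes the comparison pointwise, where it is the additivity relation in
    the first slot.\<close>
  let ?s = "\<lambda>(x, y). frag_of (g x, y) + frag_of (h x, y)"
  have s: "frag_extend ?s w = frag_map g w + frag_map h w" for w :: "('b \<times> 'n) \<Rightarrow>\<^sub>0 int"
  proof -
    have "Poly_Mapping.keys w \<subseteq> UNIV" by simp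
    then show ?thesis
    proof (induction w rule: frag_induction)
      case (one p) then show ?case by (cases p) simp
    next
      case (diff a b) then show ?case by (simp add: frag_extend_diff)
    qed simp
  qed
  have fs: "frag_map f z - frag_extend ?s z \<in> tensor_rels A M' N"
  proof (rule tensor_rels_ext[OF M'])
    show "Poly_Mapping.keys z \<subseteq> carrier M \<times> carrier N" using z by simp
    show "(case p of (x, y) \<Rightarrow> frag_of (f x, y)) - ?s p \<in> tensor_rels A M' N"
      if p: "p \<in> carrier M \<times> carrier N" for p
    proof -
      obtain x y where xy: "p = (x, y)" "x \<in> carrier M" "y \<in> carrier N" using p by blast
      have "frag_of (f x, y) - frag_of (g x, y) - frag_of (h x, y) \<in> tensor_rels A M' N"
        unfolding eq[OF xy(2)] using xy
        by (intro tensor_rels_incl[OF M'] tensor_gens.intros(1) linear_maps_closed[OF g] linear_maps_closed[OF h])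
      then show ?thesis by (simp add: xy(1) diff_diff_eq)
    qed
  qed
  have gh: "frag_map g z + frag_map h z \<in> carrier (tensor_pre A M' N)"
    using T.a_closed[OF fz(2,3)] by (simp only: tensor_pre_sel(2))
  have "tensor_class A M' N (frag_map f z) = tensor_class A M' N (frag_map g z + frag_map h z)"
    unfolding tensor_class_eq_iff[OF M' fz(1) gh] using fs by (simp only: s)
  then show ?thesis
    unfolding z(2) tensor_map_class[OF M M' f z(1)] tensor_map_class[OF M M' g z(1)] tensor_map_class[OF M M' h z(1)]
      tensor_add[OF M' fz(2,3)] by simp
qed

end

section \<open>Free resolutions\<close>

context right_module begin

lemma r_neg_act:
  assumes "a \<in> carrier A" "x \<in> carrier M" shows "a \<odot>\<^bsub>M\<^esub> (\<ominus>\<^bsub>M\<^esub> x) = \<ominus>\<^bsub>M\<^esub> (a \<odot>\<^bsub>M\<^esub> x)"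
proof -
  have "a \<odot>\<^bsub>M\<^esub> (\<ominus>\<^bsub>M\<^esub> x) \<oplus>\<^bsub>M\<^esub> a \<odot>\<^bsub>M\<^esub> x = \<zero>\<^bsub>M\<^esub>"
    using assms by (simp add: act_r_distr[symmetric] M.l_neg)
  then show ?thesis using assms act_closed by (metis M.minus_equality M.a_inv_closed)
qed

lemma linear_maps_diff:
  assumes "f \<in> linear_maps A U M" "g \<in> linear_maps A U M"
  shows "(\<lambda>x. f x \<ominus>\<^bsub>M\<^esub> g x) \<in> linear_maps A U M"
  using assms
  by (auto simp: linear_maps_def Pi_iff a_minus_def M.a_ac M.minus_add act_r_distr r_neg_act)

lemma linear_maps_sum:
  assumes "f \<in> linear_maps A U M" "g \<in> linear_maps A U M"
  shows "(\<lambda>x. f x \<oplus>\<^bsub>M\<^esub> g x) \<in> linear_maps A U M"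
  using assms by (auto simp: linear_maps_def Pi_iff M.a_ac act_r_distr)

lemma linear_maps_zero: "(\<lambda>x. \<zero>\<^bsub>M\<^esub>) \<in> linear_maps A U M"
  by (auto simp: linear_maps_def)

lemma linear_hom: "right_module A U \<Longrightarrow> f \<in> linear_maps A U M \<Longrightarrow> abelian_group_hom U M f"
  by (intro additive_maps_hom linear_maps_additive) (auto simp: right_module_def M.abelian_group_axioms)

lemma linear_eq_on_basis:
  assumes f: "f \<in> linear_maps A (free_rmodule A B) M" and g: "g \<in> linear_maps A (free_rmodule A B) M"
    and eq: "\<And>b. b \<in> B \<Longrightarrow> f (basis_vec A B b) = g (basis_vec A B b)"
    and x: "x \<in> carrier (free_rmodule A B)"
  shows "f x = g x"
proof -
  have bas: "basis_vec A B \<in> B \<rightarrow> carrier (free_rmodule A B)"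
    by (simp add: basis_vec_closed A.ring_axioms)
  obtain xs where xs: "set xs \<subseteq> B \<times> carrier A" "x = lin_comb (free_rmodule A B) (basis_vec A B) xs"
    using free_spanned[OF A.ring_axioms x] by auto
  have "lin_comb M (f \<circ> basis_vec A B) xs = lin_comb M (g \<circ> basis_vec A B) xs"
    by (rule lin_comb_cong[OF xs(1)]) (simp add: eq)
  then show ?thesis
    using linear_lin_comb[OF free_right_module[OF A.ring_axioms] f bas xs(1)]
      linear_lin_comb[OF free_right_module[OF A.ring_axioms] g bas xs(1)] by (simp add: xs(2))
qed

text \<open>Projectivity of free modules, by choosing preimages of the basis vectors. Only the
  values of \<open>\<phi>\<close> have to lie in the image of \<open>\<delta>\<close>, which is the
  situation in a resolution: cycles lift because they are boundaries.\<close>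

lemma free_lift:
  assumes W: "right_module A W" and \<delta>: "\<delta> \<in> linear_maps A W M"
    and \<phi>: "\<phi> \<in> linear_maps A (free_rmodule A B) M"
    and im: "\<And>x. x \<in> carrier (free_rmodule A B) \<Longrightarrow> \<phi> x \<in> \<delta> ` carrier W"
  obtains \<psi> where "\<psi> \<in> linear_maps A (free_rmodule A B) W"
    and "\<And>x. x \<in> carrier (free_rmodule A B) \<Longrightarrow> \<delta> (\<psi> x) = \<phi> x"
proof -
  interpret W: right_module A W by (rule W)
  \<comment> \<open>For \<open>b\<close> outside \<open>B\<close> the basis vector is zero, so the
    choice is possible for every \<open>b\<close>.\<close>
  have "\<exists>w\<in>carrier W. \<delta> w = \<phi> (basis_vec A B b)" for b
    using im[OF basis_vec_closed[OF A.ring_axioms, of B b]] by (metis imageE)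
  then obtain s where s: "\<And>b. s b \<in> carrier W" "\<And>b. \<delta> (s b) = \<phi> (basis_vec A B b)"
    by metis
  have lin: "lin_ext A B W s \<in> linear_maps A (free_rmodule A B) W"
    by (rule W.lin_ext_linear) (use s in auto)
  show thesis
  proof
    show "lin_ext A B W s \<in> linear_maps A (free_rmodule A B) W" by (rule lin)
    show "\<delta> (lin_ext A B W s x) = \<phi> x" if "x \<in> carrier (free_rmodule A B)" for x
      by (rule linear_eq_on_basis[OF linear_maps_comp[OF lin \<delta>] \<phi> _ that])
        (subst W.lin_ext_basis, use s in auto)
  qed
qed

end

text \<open>The ring and the basis sets are arbitrary so that the standard resolutions and the
  reduction modulo I are all instances; the reduction is free over \<open>quot_algebra A I\<close>
  on the cells of M over A.\<close>

locale free_resolution = right_module S M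
  for S :: "('a, 'y) ring_scheme" and M :: "('a, 'm, 'z) module_scheme" +
  fixes B :: "nat \<Rightarrow> 'b set" and d :: "nat \<Rightarrow> ('b \<Rightarrow> 'a) \<Rightarrow> ('b \<Rightarrow> 'a)" and \<epsilon> :: "('b \<Rightarrow> 'a) \<Rightarrow> 'm"
  assumes d_linear: "d n \<in> linear_maps S (free_rmodule S (B (Suc n))) (free_rmodule S (B n))"
    and aug_linear: "\<epsilon> \<in> linear_maps S (free_rmodule S (B 0)) M"
    and aug_surj: "\<epsilon> ` carrier (free_rmodule S (B 0)) = carrier M"
    and exact_0: "d 0 ` carrier (free_rmodule S (B (Suc 0)))
      = {f \<in> carrier (free_rmodule S (B 0)). \<epsilon> f = \<zero>\<^bsub>M\<^esub>}"
    and exact: "d (Suc n) ` carrier (free_rmodule S (B (Suc (Suc n))))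
      = {f \<in> carrier (free_rmodule S (B (Suc n))). d n f = \<zero>\<^bsub>free_rmodule S (B n)\<^esub>}"
begin

abbreviation F where "F n \<equiv> free_rmodule S (B n)"

lemma F_module: "right_module S (F n)"
  by (rule free_right_module[OF A.ring_axioms])

lemma d_d: "x \<in> carrier (F (Suc (Suc n))) \<Longrightarrow> d n (d (Suc n) x) = \<zero>\<^bsub>F n\<^esub>"
  using exact[of n] by blast

lemma aug_d: "x \<in> carrier (F (Suc 0)) \<Longrightarrow> \<epsilon> (d 0 x) = \<zero>\<^bsub>M\<^esub>"
  using exact_0 by blast

end

text \<open>Existence half of the comparison theorem, obtained by lifting degree by degree along the
  second resolution.\<close>

lemma free_resolution_chain_map:
  assumes "free_resolution S M B d \<epsilon>" "free_resolution S M C e \<eta>"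
  obtains \<phi> where "\<And>n. \<phi> n \<in> linear_maps S (free_rmodule S (B n)) (free_rmodule S (C n))"
    and "\<And>x. x \<in> carrier (free_rmodule S (B 0)) \<Longrightarrow> \<eta> (\<phi> 0 x) = \<epsilon> x"
    and "\<And>n x. x \<in> carrier (free_rmodule S (B (Suc n))) \<Longrightarrow> e n (\<phi> (Suc n) x) = \<phi> n (d n x)"
proof -
  interpret P: free_resolution S M B d \<epsilon> by fact
  interpret Q: free_resolution S M C e \<eta> by fact
  \<comment> \<open>Besides linearity the invariant keeps what the next lift requires:
    \<open>f\<close> after \<open>d n\<close> takes values in the image of \<open>e n\<close>. In
    degree 0 this follows from compatibility with the augmentations, later from
    \<open>d_d\<close>.\<close>
  define Inv where "Inv n f \<longleftrightarrow> f \<in> linear_maps S (P.F n) (Q.F n)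
      \<and> (\<forall>x\<in>carrier (P.F (Suc n)). f (d n x) \<in> e n ` carrier (Q.F (Suc n)))
      \<and> (n = 0 \<longrightarrow> (\<forall>x\<in>carrier (P.F 0). \<eta> (f x) = \<epsilon> x))" for n f
  have "\<exists>f. \<forall>n. Inv n (f n) \<and> (\<forall>x\<in>carrier (P.F (Suc n)). e n (f (Suc n) x) = f n (d n x))"
  proof (rule dependent_nat_choice)
    obtain f where f: "f \<in> linear_maps S (P.F 0) (Q.F 0)" "\<And>x. x \<in> carrier (P.F 0) \<Longrightarrow> \<eta> (f x) = \<epsilon> x"
      by (rule P.free_lift[OF Q.F_module Q.aug_linear P.aug_linear])
        (use Q.aug_surj linear_maps_closed[OF P.aug_linear] in auto)
    have "f (d 0 x) \<in> e 0 ` carrier (Q.F (Suc 0))" if "x \<in> carrier (P.F (Suc 0))" for x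
      using that f P.aug_d linear_maps_closed[OF P.d_linear] linear_maps_closed[OF f(1)]
      by (simp add: Q.exact_0)
    then show "\<exists>f. Inv 0 f" using f by (auto simp: Inv_def)
  next
    fix f n assume f: "Inv n f"
    interpret QF: right_module S "Q.F n" by (rule Q.F_module)
    have fl: "f \<in> linear_maps S (P.F n) (Q.F n)" using f by (simp add: Inv_def)
    interpret f: abelian_group_hom "P.F n" "Q.F n" f by (rule QF.linear_hom[OF P.F_module fl])
    obtain g where g: "g \<in> linear_maps S (P.F (Suc n)) (Q.F (Suc n))"
        "\<And>x. x \<in> carrier (P.F (Suc n)) \<Longrightarrow> e n (g x) = f (d n x)"
      by (rule QF.free_lift[OF Q.F_module Q.d_linear linear_maps_comp[OF P.d_linear fl]])
        (use f in \<open>auto simp: Inv_def\<close>)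
    have "g (d (Suc n) x) \<in> e (Suc n) ` carrier (Q.F (Suc (Suc n)))"
      if "x \<in> carrier (P.F (Suc (Suc n)))" for x
      using that linear_maps_closed[OF P.d_linear] linear_maps_closed[OF g(1)] g(2) P.d_d
      by (simp add: Q.exact)
    then show "\<exists>g. Inv (Suc n) g \<and> (\<forall>x\<in>carrier (P.F (Suc n)). e n (g x) = f (d n x))"
      using g by (auto simp: Inv_def)
  qed
  then show thesis using that unfolding Inv_def by metis
qed

text \<open>Uniqueness half of the comparison theorem, for a lift of the identity of M compared with
  the identity. Degree 0 has a formula of its own because no differential starts there.\<close>

lemma (in free_resolution) chain_homotopy:
  assumes u: "\<And>n. u n \<in> linear_maps S (F n) (F n)"
    and u0: "\<And>x. x \<in> carrier (F 0) \<Longrightarrow> \<epsilon> (u 0 x) = \<epsilon> x"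
    and ud: "\<And>n x. x \<in> carrier (F (Suc n)) \<Longrightarrow> d n (u (Suc n) x) = u n (d n x)"
  obtains h where "\<And>n. h n \<in> linear_maps S (F n) (F (Suc n))"
    and "\<And>x. x \<in> carrier (F 0) \<Longrightarrow> u 0 x = x \<oplus>\<^bsub>F 0\<^esub> d 0 (h 0 x)"
    and "\<And>n x. x \<in> carrier (F (Suc n)) \<Longrightarrow>
      u (Suc n) x = x \<oplus>\<^bsub>F (Suc n)\<^esub> (d (Suc n) (h (Suc n) x) \<oplus>\<^bsub>F (Suc n)\<^esub> h n (d n x))"
proof -
  interpret F: right_module S "F m" for m by (rule F_module)
  interpret d: abelian_group_hom "F (Suc m)" "F m" "d m" for m by (rule F.linear_hom[OF F_module d_linear])
  interpret e: abelian_group_hom "F 0" M \<epsilon> by (rule linear_hom[OF F_module aug_linear])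
  have mz: "\<ominus>\<^bsub>F n\<^esub> \<zero>\<^bsub>F n\<^esub> = \<zero>\<^bsub>F n\<^esub>" for n
    by (rule F.M.minus_equality) simp_all
  \<comment> \<open>\<open>w\<close> is a chain map over the zero map of M, and the homotopy sought
    is a null homotopy of it.\<close>
  define w where "w n x = u n x \<ominus>\<^bsub>F n\<^esub> x" for n x
  have w: "w n \<in> linear_maps S (F n) (F n)" for n
    unfolding w_def by (rule F.linear_maps_diff[OF u linear_maps_id])
  have w0: "\<epsilon> (w 0 x) = \<zero>\<^bsub>M\<^esub>" if "x \<in> carrier (F 0)" for x
    using that linear_maps_closed[OF u] u0 by (simp add: w_def a_minus_def M.r_neg)
  have wd: "d n (w (Suc n) x) = w n (d n x)" if "x \<in> carrier (F (Suc n))" for n x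
    using that linear_maps_closed[OF u] ud by (simp add: w_def a_minus_def)
  have uw: "u n x = x \<oplus>\<^bsub>F n\<^esub> w n x" if "x \<in> carrier (F n)" for n x
  proof -
    have "x \<oplus>\<^bsub>F n\<^esub> w n x = u n x \<oplus>\<^bsub>F n\<^esub> (x \<oplus>\<^bsub>F n\<^esub> \<ominus>\<^bsub>F n\<^esub> x)"
      using that linear_maps_closed[OF u that] by (simp add: w_def a_minus_def F.M.a_lcomm)
    then show ?thesis using that linear_maps_closed[OF u that] by (simp add: F.M.r_neg)
  qed
  \<comment> \<open>The map to be lifted next is \<open>w (Suc n)\<close> minus \<open>f\<close>
    after \<open>d n\<close>, so its values have to be boundaries. By exactness it is enough that
    their differential vanishes, and this follows from the equation for \<open>d n\<close> after
    \<open>f\<close> together with \<open>d_d\<close>.\<close>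
  define Inv where "Inv n f \<longleftrightarrow> f \<in> linear_maps S (F n) (F (Suc n))
      \<and> (\<forall>x\<in>carrier (F (Suc n)). w (Suc n) x \<ominus>\<^bsub>F (Suc n)\<^esub> f (d n x) \<in> d (Suc n) ` carrier (F (Suc (Suc n))))
      \<and> (n = 0 \<longrightarrow> (\<forall>x\<in>carrier (F 0). d 0 (f x) = w 0 x))" for n f
  have "\<exists>h. \<forall>n. Inv n (h n) \<and>
    (\<forall>x\<in>carrier (F (Suc n)). d (Suc n) (h (Suc n) x) = w (Suc n) x \<ominus>\<^bsub>F (Suc n)\<^esub> h n (d n x))"
  proof (rule dependent_nat_choice)
    obtain f where f: "f \<in> linear_maps S (F 0) (F (Suc 0))" "\<And>x. x \<in> carrier (F 0) \<Longrightarrow> d 0 (f x) = w 0 x"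
      by (rule F.free_lift[OF F_module d_linear w])
        (use exact_0 linear_maps_closed[OF w] w0 in auto)
    have "w (Suc 0) x \<ominus>\<^bsub>F (Suc 0)\<^esub> f (d 0 x) \<in> d (Suc 0) ` carrier (F (Suc (Suc 0)))"
      if "x \<in> carrier (F (Suc 0))" for x
      using that linear_maps_closed[OF w] linear_maps_closed[OF f(1)] f(2) wd
      by (simp add: exact a_minus_def F.M.r_neg mz)
    then show "\<exists>f. Inv 0 f" using f by (auto simp: Inv_def)
  next
    fix f n assume f: "Inv n f"
    have fl: "f \<in> linear_maps S (F n) (F (Suc n))" using f by (simp add: Inv_def)
    interpret f: abelian_group_hom "F n" "F (Suc n)" f by (rule F.linear_hom[OF F_module fl])
    have "(\<lambda>x. w (Suc n) x \<ominus>\<^bsub>F (Suc n)\<^esub> f (d n x)) \<in> linear_maps S (F (Suc n)) (F (Suc n))"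
      by (rule F.linear_maps_diff[OF w linear_maps_comp[OF d_linear fl]])
    then obtain g where g: "g \<in> linear_maps S (F (Suc n)) (F (Suc (Suc n)))"
        "\<And>x. x \<in> carrier (F (Suc n)) \<Longrightarrow> d (Suc n) (g x) = w (Suc n) x \<ominus>\<^bsub>F (Suc n)\<^esub> f (d n x)"
      by (rule F.free_lift[OF F_module d_linear])
        (use f in \<open>auto simp: Inv_def\<close>)
    have "w (Suc (Suc n)) x \<ominus>\<^bsub>F (Suc (Suc n))\<^esub> g (d (Suc n) x)
        \<in> d (Suc (Suc n)) ` carrier (F (Suc (Suc (Suc n))))"
      if "x \<in> carrier (F (Suc (Suc n)))" for x
      using that linear_maps_closed[OF w] linear_maps_closed[OF g(1)] g(2) wd d_d
      by (simp add: exact a_minus_def F.M.r_neg mz)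
    then show "\<exists>g. Inv (Suc n) g \<and>
        (\<forall>x\<in>carrier (F (Suc n)). d (Suc n) (g x) = w (Suc n) x \<ominus>\<^bsub>F (Suc n)\<^esub> f (d n x))"
      using g by (auto simp: Inv_def)
  qed
  then obtain h where h: "\<And>n. Inv n (h n)"
    "\<And>n x. x \<in> carrier (F (Suc n)) \<Longrightarrow> d (Suc n) (h (Suc n) x) = w (Suc n) x \<ominus>\<^bsub>F (Suc n)\<^esub> h n (d n x)"
    by metis
  have hl: "h n \<in> linear_maps S (F n) (F (Suc n))" for n using h(1)[of n] by (simp add: Inv_def)
  show thesis
  proof
    show "u 0 x = x \<oplus>\<^bsub>F 0\<^esub> d 0 (h 0 x)" if "x \<in> carrier (F 0)" for x
      using h(1)[of 0] that by (simp add: Inv_def uw)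
    show "u (Suc n) x = x \<oplus>\<^bsub>F (Suc n)\<^esub> (d (Suc n) (h (Suc n) x) \<oplus>\<^bsub>F (Suc n)\<^esub> h n (d n x))"
      if "x \<in> carrier (F (Suc n))" for n x
      using that linear_maps_closed[OF w] linear_maps_closed[OF hl]
      by (simp add: h(2) uw a_minus_def F.M.a_assoc F.M.l_neg)
  qed (rule hl)
qed

section \<open>Tensored resolutions: their homology does not depend on the resolution\<close>

context algebra_left_module begin

lemma tensor_map_zero:
  assumes M: "right_module A M" and M': "right_module A M'" and Z: "Z \<in> carrier (tensor A M N)"
  shows "tensor_map A M' N (\<lambda>x. \<zero>\<^bsub>M'\<^esub>) Z = \<zero>\<^bsub>tensor A M' N\<^esub>"
proof -
  interpret M': right_module A M' by (rule M')
  interpret T: module R "tensor A M' N" by (rule tensor_module[OF M'])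
  have "tensor_map A M' N (\<lambda>x. \<zero>\<^bsub>M'\<^esub>) Z \<in> carrier (tensor A M' N)"
    using linear_maps_closed[OF tensor_map_linear[OF M M' M'.linear_maps_zero] Z] .
  \<comment> \<open>The zero map is the sum of itself with itself, so additivity in the map gives an
    element equal to its own double, hence zero.\<close>
  moreover have "tensor_map A M' N (\<lambda>x. \<zero>\<^bsub>M'\<^esub>) Z =
      tensor_map A M' N (\<lambda>x. \<zero>\<^bsub>M'\<^esub>) Z \<oplus>\<^bsub>tensor A M' N\<^esub> tensor_map A M' N (\<lambda>x. \<zero>\<^bsub>M'\<^esub>) Z"
    by (rule tensor_map_add[OF M M' _ _ _ _ Z]) (use M'.linear_maps_zero in auto)
  ultimately show ?thesis by (metis T.M.add.r_cancel_one')
qed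

lemma tensor_chain_complex:
  assumes P: "free_resolution A M B d \<epsilon>"
  shows "chain_complex R (\<lambda>i. tensor A (free_rmodule A (B i)) N)
    (\<lambda>i. tensor_map A (free_rmodule A (B i)) N (d i))"
proof -
  interpret P: free_resolution A M B d \<epsilon> by fact
  show ?thesis
  proof (rule chain_complex.intro, goal_cases)
    case (1 n) show ?case by (rule tensor_module[OF P.F_module])
  next
    case (2 n) show ?case by (rule tensor_map_linear[OF P.F_module P.F_module P.d_linear])
  next
    case (3 Z n)
    then have Z: "Z \<in> carrier (tensor A (P.F (Suc (Suc n))) N)" .
    interpret F: right_module A "P.F n" by (rule P.F_module)
    have "tensor_map A (P.F n) N (d n) (tensor_map A (P.F (Suc n)) N (d (Suc n)) Z)
        = tensor_map A (P.F n) N (\<lambda>x. d n (d (Suc n) x)) Z"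
      by (rule tensor_map_comp[OF P.F_module P.F_module P.F_module P.d_linear P.d_linear Z])
    also have "\<dots> = tensor_map A (P.F n) N (\<lambda>x. \<zero>\<^bsub>P.F n\<^esub>) Z"
      by (rule tensor_map_cong[OF P.F_module P.F_module linear_maps_comp[OF P.d_linear P.d_linear]
            F.linear_maps_zero P.d_d Z])
    also have "\<dots> = \<zero>\<^bsub>tensor A (P.F n) N\<^esub>"
      by (rule tensor_map_zero[OF P.F_module P.F_module Z])
    finally show ?case .
  qed
qed

text \<open>After tensoring the homotopy formula, the term through \<open>d n\<close> after
  \<open>h n\<close> is a boundary and the term through \<open>h m\<close> after \<open>d m\<close>
  vanishes on cycles. So a lift of the identity of M acts trivially on homology.\<close>

lemma tensor_homotopic_id:
  assumes P: "free_resolution A M B d \<epsilon>"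
    and u: "\<And>n. u n \<in> linear_maps A (free_rmodule A (B n)) (free_rmodule A (B n))"
    and u0: "\<And>x. x \<in> carrier (free_rmodule A (B 0)) \<Longrightarrow> \<epsilon> (u 0 x) = \<epsilon> x"
    and ud: "\<And>n x. x \<in> carrier (free_rmodule A (B (Suc n))) \<Longrightarrow> d n (u (Suc n) x) = u n (d n x)"
    and Z: "Z \<in> cycles (\<lambda>i. tensor A (free_rmodule A (B i)) N)
      (\<lambda>i. tensor_map A (free_rmodule A (B i)) N (d i)) n"
  obtains b where "b \<in> boundaries (\<lambda>i. tensor A (free_rmodule A (B i)) N)
      (\<lambda>i. tensor_map A (free_rmodule A (B i)) N (d i)) n"
    and "tensor_map A (free_rmodule A (B n)) N (u n) Z = Z \<oplus>\<^bsub>tensor A (free_rmodule A (B n)) N\<^esub> b"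
proof -
  interpret P: free_resolution A M B d \<epsilon> by fact
  interpret C: chain_complex R "\<lambda>i. tensor A (P.F i) N" "\<lambda>i. tensor_map A (P.F i) N (d i)"
    by (rule tensor_chain_complex[OF P])
  interpret F: right_module A "P.F n" by (rule P.F_module)
  interpret T: module R "tensor A (P.F n) N" by (rule C.mod)
  obtain h where hl: "\<And>n. h n \<in> linear_maps A (P.F n) (P.F (Suc n))"
    and h0: "\<And>x. x \<in> carrier (P.F 0) \<Longrightarrow> u 0 x = x \<oplus>\<^bsub>P.F 0\<^esub> d 0 (h 0 x)"
    and hS: "\<And>n x. x \<in> carrier (P.F (Suc n)) \<Longrightarrow>
      u (Suc n) x = x \<oplus>\<^bsub>P.F (Suc n)\<^esub> (d (Suc n) (h (Suc n) x) \<oplus>\<^bsub>P.F (Suc n)\<^esub> h n (d n x))"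
    using P.chain_homotopy[OF u u0 ud] by metis
  have Zc: "Z \<in> carrier (tensor A (P.F n) N)" by (rule C.cycles_closed[OF Z])
  let ?T = "tensor_map A (P.F n) N"
  have dh: "(\<lambda>x. d n (h n x)) \<in> linear_maps A (P.F n) (P.F n)"
    by (rule linear_maps_comp[OF hl P.d_linear])
  have hZ: "tensor_map A (P.F (Suc n)) N (h n) Z \<in> carrier (tensor A (P.F (Suc n)) N)"
    using linear_maps_closed[OF tensor_map_linear[OF P.F_module P.F_module hl] Zc] .
  have dhT: "?T (\<lambda>x. d n (h n x)) Z = ?T (d n) (tensor_map A (P.F (Suc n)) N (h n) Z)"
    by (rule tensor_map_comp[OF P.F_module P.F_module P.F_module hl P.d_linear Zc, symmetric])
  have "?T (u n) Z = Z \<oplus>\<^bsub>tensor A (P.F n) N\<^esub> ?T (\<lambda>x. d n (h n x)) Z"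
  proof (cases n)
    case 0
    have "?T (u n) Z = ?T (\<lambda>x. x) Z \<oplus>\<^bsub>tensor A (P.F n) N\<^esub> ?T (\<lambda>x. d n (h n x)) Z"
      by (rule tensor_map_add[OF P.F_module[of n] P.F_module[of n] u[of n] linear_maps_id dh _ Zc]) (simp add: 0 h0)
    then show ?thesis by (simp add: tensor_map_id[OF P.F_module Zc])
  next
    case (Suc m)
    have hd: "(\<lambda>x. h m (d m x)) \<in> linear_maps A (P.F n) (P.F n)"
      unfolding Suc by (rule linear_maps_comp[OF P.d_linear hl])
    note sum = F.linear_maps_sum[OF dh hd]
    have hdT: "?T (\<lambda>x. h m (d m x)) Z = \<zero>\<^bsub>tensor A (P.F n) N\<^esub>"
    proof -
      have th: "tensor_map A (P.F n) N (h m) \<in> linear_maps R (tensor A (P.F m) N) (tensor A (P.F n) N)"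
        unfolding Suc by (rule tensor_map_linear[OF P.F_module P.F_module hl])
      interpret th: abelian_group_hom "tensor A (P.F m) N" "tensor A (P.F n) N" "tensor_map A (P.F n) N (h m)"
        using C.mod[of m] C.mod[of n] by (intro additive_maps_hom linear_maps_additive[OF th]) (auto simp: module_def)
      have "?T (\<lambda>x. h m (d m x)) Z = ?T (h m) (tensor_map A (P.F m) N (d m) Z)"
        using Zc unfolding Suc
        by (intro tensor_map_comp[OF P.F_module P.F_module P.F_module P.d_linear hl, symmetric])
      also have "tensor_map A (P.F m) N (d m) Z = \<zero>\<^bsub>tensor A (P.F m) N\<^esub>"
        using Z by (simp add: cycles_def Suc)
      finally show ?thesis by simp
    qed
    have "?T (u n) Z = ?T (\<lambda>x. x) Z \<oplus>\<^bsub>tensor A (P.F n) N\<^esub>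
        ?T (\<lambda>x. d n (h n x) \<oplus>\<^bsub>P.F n\<^esub> h m (d m x)) Z"
      by (rule tensor_map_add[OF P.F_module[of n] P.F_module[of n] u[of n] linear_maps_id sum _ Zc]) (simp add: Suc hS)
    also have "?T (\<lambda>x. d n (h n x) \<oplus>\<^bsub>P.F n\<^esub> h m (d m x)) Z
        = ?T (\<lambda>x. d n (h n x)) Z \<oplus>\<^bsub>tensor A (P.F n) N\<^esub> ?T (\<lambda>x. h m (d m x)) Z"
      by (rule tensor_map_add[OF P.F_module[of n] P.F_module[of n] sum dh hd _ Zc]) simp
    finally show ?thesis
      using linear_maps_closed[OF tensor_map_linear[OF P.F_module P.F_module dh] Zc]
      by (simp add: hdT tensor_map_id[OF P.F_module Zc])
  qed
  then show thesis using that[of "?T (\<lambda>x. d n (h n x)) Z"] hZ unfolding boundaries_def dhT by blast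
qed

text \<open>Chain maps over the identity of M exist in both directions, and both composites are
  homotopic to the identity. Injectivity comes from \<open>\<psi>\<close> after
  \<open>\<phi>\<close>, surjectivity from \<open>\<phi>\<close> after
  \<open>\<psi>\<close>.\<close>

lemma free_resolution_homology_iso:
  assumes P: "free_resolution A M B d \<epsilon>" and Q: "free_resolution A M C e \<eta>"
  shows "isomorphic_modules R
    (homology (\<lambda>i. tensor A (free_rmodule A (B i)) N) (\<lambda>i. tensor_map A (free_rmodule A (B i)) N (d i)) n)
    (homology (\<lambda>i. tensor A (free_rmodule A (C i)) N) (\<lambda>i. tensor_map A (free_rmodule A (C i)) N (e i)) n)"
proof -
  interpret P: free_resolution A M B d \<epsilon> by fact
  interpret Q: free_resolution A M C e \<eta> by fact
  interpret PN: chain_complex R "\<lambda>i. tensor A (P.F i) N" "\<lambda>i. tensor_map A (P.F i) N (d i)"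
    by (rule tensor_chain_complex[OF P])
  interpret QN: chain_complex R "\<lambda>i. tensor A (Q.F i) N" "\<lambda>i. tensor_map A (Q.F i) N (e i)"
    by (rule tensor_chain_complex[OF Q])
  note md = P.F_module Q.F_module
  obtain \<phi> where \<phi>: "\<And>n. \<phi> n \<in> linear_maps A (P.F n) (Q.F n)"
    "\<And>x. x \<in> carrier (P.F 0) \<Longrightarrow> \<eta> (\<phi> 0 x) = \<epsilon> x"
    "\<And>n x. x \<in> carrier (P.F (Suc n)) \<Longrightarrow> e n (\<phi> (Suc n) x) = \<phi> n (d n x)"
    using free_resolution_chain_map[OF P Q] by metis
  obtain \<psi> where \<psi>: "\<And>n. \<psi> n \<in> linear_maps A (Q.F n) (P.F n)"
    "\<And>x. x \<in> carrier (Q.F 0) \<Longrightarrow> \<epsilon> (\<psi> 0 x) = \<eta> x"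
    "\<And>n x. x \<in> carrier (Q.F (Suc n)) \<Longrightarrow> d n (\<psi> (Suc n) x) = \<psi> n (e n x)"
    using free_resolution_chain_map[OF Q P] by metis
  note \<phi>c = linear_maps_closed[OF \<phi>(1)] and \<psi>c = linear_maps_closed[OF \<psi>(1)]
  have comm\<phi>: "tensor_map A (Q.F n) N (\<phi> n) (tensor_map A (P.F n) N (d n) Z)
      = tensor_map A (Q.F n) N (e n) (tensor_map A (Q.F (Suc n)) N (\<phi> (Suc n)) Z)"
    if "Z \<in> carrier (tensor A (P.F (Suc n)) N)" for n Z
    using tensor_map_cong[OF md linear_maps_comp[OF P.d_linear \<phi>(1)] linear_maps_comp[OF \<phi>(1) Q.d_linear] \<phi>(3)[symmetric] that]
    by (simp add: tensor_map_comp[OF md(1) md(1) md(2) P.d_linear \<phi>(1) that] 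
        tensor_map_comp[OF md(1) md(2) md(2) \<phi>(1) Q.d_linear that])
  have comm\<psi>: "tensor_map A (P.F n) N (\<psi> n) (tensor_map A (Q.F n) N (e n) Z)
      = tensor_map A (P.F n) N (d n) (tensor_map A (P.F (Suc n)) N (\<psi> (Suc n)) Z)"
    if "Z \<in> carrier (tensor A (Q.F (Suc n)) N)" for n Z
    using tensor_map_cong[OF md(2,1) linear_maps_comp[OF Q.d_linear \<psi>(1)] linear_maps_comp[OF \<psi>(1) P.d_linear] \<psi>(3)[symmetric] that]
    by (simp add: tensor_map_comp[OF md(2) md(2) md(1) Q.d_linear \<psi>(1) that] 
        tensor_map_comp[OF md(2) md(1) md(1) \<psi>(1) P.d_linear that])
  have t\<psi>: "tensor_map A (P.F n) N (\<psi> n) \<in> linear_maps R (tensor A (Q.F n) N) (tensor A (P.F n) N)" for n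
    by (rule tensor_map_linear[OF md(2,1) \<psi>(1)])
  have t\<phi>: "tensor_map A (Q.F n) N (\<phi> n) \<in> linear_maps R (tensor A (P.F n) N) (tensor A (Q.F n) N)" for n
    by (rule tensor_map_linear[OF md(1,2) \<phi>(1)])
  show ?thesis
  proof (rule homology_iso[where \<phi> = "\<lambda>n. tensor_map A (Q.F n) N (\<phi> n)",
        OF PN.chain_complex_axioms QN.chain_complex_axioms t\<phi> comm\<phi>])
    fix Z assume Z: "Z \<in> cycles (\<lambda>i. tensor A (P.F i) N) (\<lambda>i. tensor_map A (P.F i) N (d i)) n"
      and \<phi>Z: "tensor_map A (Q.F n) N (\<phi> n) Z \<in> boundaries (\<lambda>i. tensor A (Q.F i) N) (\<lambda>i. tensor_map A (Q.F i) N (e i)) n"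
    have Zc: "Z \<in> carrier (tensor A (P.F n) N)" by (rule PN.cycles_closed[OF Z])
    obtain b where b: "b \<in> boundaries (\<lambda>i. tensor A (P.F i) N) (\<lambda>i. tensor_map A (P.F i) N (d i)) n"
      and bZ: "tensor_map A (P.F n) N (\<lambda>x. \<psi> n (\<phi> n x)) Z = Z \<oplus>\<^bsub>tensor A (P.F n) N\<^esub> b"
      by (rule tensor_homotopic_id[where u = "\<lambda>n x. \<psi> n (\<phi> n x)", OF P linear_maps_comp[OF \<phi>(1) \<psi>(1)] _ _ Z])
        (simp_all add: \<phi>(2,3) \<psi>(2,3) \<phi>c)
    obtain Y where Y: "Y \<in> carrier (tensor A (Q.F (Suc n)) N)" "tensor_map A (Q.F n) N (\<phi> n) Z = tensor_map A (Q.F n) N (e n) Y"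
      using \<phi>Z by (auto simp: boundaries_def)
    have "tensor_map A (P.F n) N (\<lambda>x. \<psi> n (\<phi> n x)) Z
        = tensor_map A (P.F n) N (d n) (tensor_map A (P.F (Suc n)) N (\<psi> (Suc n)) Y)"
      unfolding tensor_map_comp[OF md(1,2,1) \<phi>(1) \<psi>(1) Zc, symmetric] Y(2) by (rule comm\<psi>[OF Y(1)])
    then have "Z \<oplus>\<^bsub>tensor A (P.F n) N\<^esub> b \<in> boundaries (\<lambda>i. tensor A (P.F i) N) (\<lambda>i. tensor_map A (P.F i) N (d i)) n"
      using linear_maps_closed[OF t\<psi> Y(1)] unfolding bZ boundaries_def by blast
    then show "Z \<in> boundaries (\<lambda>i. tensor A (P.F i) N) (\<lambda>i. tensor_map A (P.F i) N (d i)) n"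
      by (rule PN.boundaries_cancel(1)[OF Zc b])
  next
    fix Z assume Z: "Z \<in> cycles (\<lambda>i. tensor A (Q.F i) N) (\<lambda>i. tensor_map A (Q.F i) N (e i)) n"
    have Zc: "Z \<in> carrier (tensor A (Q.F n) N)" by (rule QN.cycles_closed[OF Z])
    obtain b where b: "b \<in> boundaries (\<lambda>i. tensor A (Q.F i) N) (\<lambda>i. tensor_map A (Q.F i) N (e i)) n"
      and bZ: "tensor_map A (Q.F n) N (\<lambda>x. \<phi> n (\<psi> n x)) Z = Z \<oplus>\<^bsub>tensor A (Q.F n) N\<^esub> b"
      by (rule tensor_homotopic_id[where u = "\<lambda>n x. \<phi> n (\<psi> n x)", OF Q linear_maps_comp[OF \<psi>(1) \<phi>(1)] _ _ Z])
        (simp_all add: \<phi>(2,3) \<psi>(2,3) \<psi>c)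
    show "\<exists>x\<in>cycles (\<lambda>i. tensor A (P.F i) N) (\<lambda>i. tensor_map A (P.F i) N (d i)) n.
      Z \<ominus>\<^bsub>tensor A (Q.F n) N\<^esub> tensor_map A (Q.F n) N (\<phi> n) x
        \<in> boundaries (\<lambda>i. tensor A (Q.F i) N) (\<lambda>i. tensor_map A (Q.F i) N (e i)) n"
    \<comment> \<open>The cycle that hits \<open>Z\<close> up to a boundary is the image of
      \<open>Z\<close> under \<open>\<psi>\<close>.\<close>
    proof (rule bexI)
      show "Z \<ominus>\<^bsub>tensor A (Q.F n) N\<^esub> tensor_map A (Q.F n) N (\<phi> n) (tensor_map A (P.F n) N (\<psi> n) Z)
        \<in> boundaries (\<lambda>i. tensor A (Q.F i) N) (\<lambda>i. tensor_map A (Q.F i) N (e i)) n"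
        unfolding tensor_map_comp[OF md(2,1,2) \<psi>(1) \<phi>(1) Zc] bZ by (rule QN.boundaries_cancel(2)[OF Zc b])
      show "tensor_map A (P.F n) N (\<psi> n) Z \<in> cycles (\<lambda>i. tensor A (P.F i) N) (\<lambda>i. tensor_map A (P.F i) N (d i)) n"
        by (rule chain_map_cycles[where \<phi> = "\<lambda>n. tensor_map A (P.F n) N (\<psi> n)", OF QN.chain_complex_axioms PN.chain_complex_axioms t\<psi> comm\<psi> Z])
    qed
  qed
qed

end

lemma standard_free_resolution:
  assumes "right_module A M" shows "free_resolution A M (cells A M) (res_diff A M) (res_aug A M)"
proof -
  interpret right_module A M by fact
  show ?thesis
    using std_res_aug_linear[OF assms] std_res_diff_linear[OF assms] std_res_aug_surj[OF assms]
      std_res_exact_0[OF assms] std_res_exact[OF assms]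
    by unfold_locales (simp_all add: res_mod_def)
qed

section \<open>Reduction modulo an ideal\<close>

text \<open>For \<open>T = I\<close> this is the submodule P I of the overview: a vector of a free
  module lies in P I exactly when all its coefficients lie in I.\<close>

definition valued_in :: "('a, 'y) ring_scheme \<Rightarrow> 'b set \<Rightarrow> 'a set \<Rightarrow> ('b \<Rightarrow> 'a) set" where
  "valued_in A B T = {f \<in> carrier (free_rmodule A B). \<forall>b\<in>B. f b \<in> T}"

lemma free_rmodule_sel:
  "carrier (free_rmodule A B) = {f \<in> B \<rightarrow>\<^sub>E carrier A. finite {b \<in> B. f b \<noteq> \<zero>\<^bsub>A\<^esub>}}"
  "\<zero>\<^bsub>free_rmodule A B\<^esub> = (\<lambda>b\<in>B. \<zero>\<^bsub>A\<^esub>)"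
  "f \<oplus>\<^bsub>free_rmodule A B\<^esub> g = (\<lambda>b\<in>B. f b \<oplus>\<^bsub>A\<^esub> g b)"
  "a \<odot>\<^bsub>free_rmodule A B\<^esub> f = (\<lambda>b\<in>B. f b \<otimes>\<^bsub>A\<^esub> a)"
  by (simp_all add: free_rmodule_def)

context ring begin

text \<open>Induction on the support: removing the term at \<open>c\<close> puts a zero there, and
  since \<open>T\<close> contains zero the remaining vector is again
  \<open>T\<close>-valued.\<close>

lemma free_valued_induct [consumes 3, case_names zero step]:
  assumes f: "f \<in> valued_in R B T"
    and T: "\<zero> \<in> T" "T \<subseteq> carrier R"
    and zero: "P \<zero>\<^bsub>free_rmodule R B\<^esub>"
    and step: "\<And>c a x. \<lbrakk>c \<in> B; a \<in> T; x \<in> valued_in R B T; P x\<rbrakk>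
      \<Longrightarrow> P (a \<odot>\<^bsub>free_rmodule R B\<^esub> basis_vec R B c \<oplus>\<^bsub>free_rmodule R B\<^esub> x)"
  shows "P f"
proof -
  let ?F = "free_rmodule R B"
  have "P f" if "finite S" "f \<in> valued_in R B T" "{b \<in> B. f b \<noteq> \<zero>} \<subseteq> S" for S f
    using that
  proof (induction S arbitrary: f rule: finite_induct)
    case empty
    then have "f = \<zero>\<^bsub>?F\<^esub>" by (auto simp: valued_in_def free_rmodule_sel fun_eq_iff PiE_iff extensional_def)
    then show ?case using zero by simp
  next
    case (insert c S)
    show ?case
    proof (cases "c \<in> B")
      case False
      then have "{b \<in> B. f b \<noteq> \<zero>} \<subseteq> S" using insert by auto
      then show ?thesis using insert by auto
    next
      case True
      define h where "h = (\<lambda>b\<in>B. if b = c then \<zero> else f b)"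
      have fE: "f \<in> B \<rightarrow>\<^sub>E carrier R" and ff: "finite {b \<in> B. f b \<noteq> \<zero>}" and fT: "\<And>b. b \<in> B \<Longrightarrow> f b \<in> T"
        using insert.prems by (auto simp: valued_in_def free_rmodule_sel)
      have "finite {b \<in> B. h b \<noteq> \<zero>}"
        by (rule finite_subset[OF _ ff]) (auto simp: h_def)
      then have h: "h \<in> valued_in R B T" using fE fT T by (auto simp: valued_in_def free_rmodule_sel h_def)
      have "{b \<in> B. h b \<noteq> \<zero>} \<subseteq> S" using insert.prems by (auto simp: h_def)
      then have "P h" using insert.IH[OF h] by auto
      moreover have "f = f c \<odot>\<^bsub>?F\<^esub> basis_vec R B c \<oplus>\<^bsub>?F\<^esub> h"
      proof
        fix b
        show "f b = (f c \<odot>\<^bsub>?F\<^esub> basis_vec R B c \<oplus>\<^bsub>?F\<^esub> h) b"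
          using fE True
          by (cases "b \<in> B") (auto simp: free_rmodule_sel basis_vec_def h_def PiE_iff extensional_def)
      qed
      ultimately show ?thesis using step[OF True fT[OF True] h] by simp
    qed
  qed
  from this[of "{b \<in> B. f b \<noteq> \<zero>}" f] show ?thesis using f by (auto simp: valued_in_def free_rmodule_sel)
qed

end

lemma (in right_module) linear_step:
  assumes "\<phi> \<in> linear_maps A (free_rmodule A B) M" "c \<in> B" "a \<in> carrier A" "x \<in> carrier (free_rmodule A B)"
  shows "\<phi> (a \<odot>\<^bsub>free_rmodule A B\<^esub> basis_vec A B c \<oplus>\<^bsub>free_rmodule A B\<^esub> x)
    = a \<odot>\<^bsub>M\<^esub> \<phi> (basis_vec A B c) \<oplus>\<^bsub>M\<^esub> \<phi> x"
proof -
  interpret F: right_module A "free_rmodule A B" by (rule free_right_module[OF A.ring_axioms])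
  note bv = basis_vec_closed[OF A.ring_axioms, of B c]
  show ?thesis
    unfolding linear_maps_add[OF assms(1) F.act_closed[OF assms(3) bv] assms(4)]
      linear_maps_smult[OF assms(1,3) bv] ..
qed

text \<open>A \<open>T\<close>-valued vector is a sum of basis vectors acted on by scalars from
  \<open>T\<close>, and linearity moves these scalars into M, where they act as zero. For
  \<open>T = I\<close> this makes the augmentation vanish on P I.\<close>

lemma (in right_module) linear_kills_valued:
  assumes \<phi>: "\<phi> \<in> linear_maps A (free_rmodule A B) M" and f: "f \<in> valued_in A B T"
    and T: "\<zero>\<^bsub>A\<^esub> \<in> T" "T \<subseteq> carrier A" "\<And>a x. a \<in> T \<Longrightarrow> x \<in> carrier M \<Longrightarrow> a \<odot>\<^bsub>M\<^esub> x = \<zero>\<^bsub>M\<^esub>"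
  shows "\<phi> f = \<zero>\<^bsub>M\<^esub>"
proof -
  interpret \<phi>: abelian_group_hom "free_rmodule A B" M \<phi>
    by (rule linear_hom[OF free_right_module[OF A.ring_axioms] \<phi>])
  show ?thesis using f T(1,2)
  proof (induction rule: A.free_valued_induct)
    case (step c a x)
    have "a \<in> carrier A" "x \<in> carrier (free_rmodule A B)"
      using step T by (auto simp: valued_in_def)
    then show ?case using step T linear_maps_closed[OF \<phi> basis_vec_closed[OF A.ring_axioms]]
      by (simp add: linear_step[OF \<phi>])
  qed simp
qed

section \<open>Coefficientwise reduction of free modules modulo I\<close>

locale algebra_ideal = assoc_algebra R A + I: ideal I A
  for R :: "'r ring" and A :: "('r, 'a) module" and I :: "'a set"
begin

abbreviation "Q \<equiv> quot_algebra A I"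
abbreviation "F B \<equiv> free_rmodule A B"
abbreviation "FQ B \<equiv> free_rmodule Q B"
abbreviation "FI B \<equiv> valued_in A B I"

lemma Q_algebra: "assoc_algebra R Q"
  by (rule quot_algebra_assoc[OF assoc_algebra_axioms I.ideal_axioms])

lemma Q_ring: "ring Q"
  using Q_algebra by (simp add: assoc_algebra_def)

lemma F_module: "right_module A (F B)" and FQ_module: "right_module Q (FQ B)"
  by (rule free_right_module[OF ring_axioms], rule free_right_module[OF Q_ring])

lemma coset_in_Q: "a \<in> carrier A \<Longrightarrow> I +>\<^bsub>A\<^esub> a \<in> carrier Q"
  by (auto simp: A_RCOSETS_def')

lemma Q_coset: "X \<in> carrier Q \<Longrightarrow> \<exists>a\<in>carrier A. X = I +>\<^bsub>A\<^esub> a"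
  by (auto simp: A_RCOSETS_def')

lemma coset_zero_iff: assumes "a \<in> carrier A" shows "I +>\<^bsub>A\<^esub> a = I \<longleftrightarrow> a \<in> I"
proof
  show "I +>\<^bsub>A\<^esub> a = I \<Longrightarrow> a \<in> I" using I.a_rcos_self[OF assms] by simp
  show "a \<in> I \<Longrightarrow> I +>\<^bsub>A\<^esub> a = I" by (rule I.a_rcos_const)
qed

lemma coset_zero: "I +>\<^bsub>A\<^esub> \<zero>\<^bsub>A\<^esub> = I"
  by (simp add: coset_zero_iff)

lemma coset_add: "a \<in> carrier A \<Longrightarrow> b \<in> carrier A
    \<Longrightarrow> (I +>\<^bsub>A\<^esub> a) \<oplus>\<^bsub>Q\<^esub> (I +>\<^bsub>A\<^esub> b) = I +>\<^bsub>A\<^esub> (a \<oplus>\<^bsub>A\<^esub> b)"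
  by (simp add: I.a_rcos_sum)

lemma coset_mult: "a \<in> carrier A \<Longrightarrow> b \<in> carrier A
    \<Longrightarrow> (I +>\<^bsub>A\<^esub> a) \<otimes>\<^bsub>Q\<^esub> (I +>\<^bsub>A\<^esub> b) = I +>\<^bsub>A\<^esub> (a \<otimes>\<^bsub>A\<^esub> b)"
  by (simp add: I.rcoset_mult_add)

text \<open>This realises the projection from P onto P / P I. Taking the quotient coefficientwise
  gives again a \<open>free_rmodule\<close> on the same basis, now over the quotient
  algebra.\<close>

definition reduce :: "'b set \<Rightarrow> ('b \<Rightarrow> 'a) \<Rightarrow> 'b \<Rightarrow> 'a set" where
  "reduce B f = (\<lambda>b\<in>B. I +>\<^bsub>A\<^esub> f b)"

lemma reduce_closed: assumes f: "f \<in> carrier (F B)" shows "reduce B f \<in> carrier (FQ B)"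
proof -
  have "finite {b \<in> B. reduce B f b \<noteq> \<zero>\<^bsub>Q\<^esub>}"
    by (rule finite_subset[of _ "{b \<in> B. f b \<noteq> \<zero>\<^bsub>A\<^esub>}"])
      (use f in \<open>auto simp: reduce_def free_rmodule_sel coset_zero\<close>)
  then show ?thesis using f coset_in_Q by (auto simp: reduce_def free_rmodule_sel simp del: quot_algebra_sel)
qed

lemma reduce_add: "f \<in> carrier (F B) \<Longrightarrow> g \<in> carrier (F B)
    \<Longrightarrow> reduce B (f \<oplus>\<^bsub>F B\<^esub> g) = reduce B f \<oplus>\<^bsub>FQ B\<^esub> reduce B g"
  by (auto simp: reduce_def free_rmodule_sel fun_eq_iff coset_add PiE_iff simp del: quot_algebra_sel)

lemma reduce_smult: "a \<in> carrier A \<Longrightarrow> f \<in> carrier (F B)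
    \<Longrightarrow> reduce B (a \<odot>\<^bsub>F B\<^esub> f) = (I +>\<^bsub>A\<^esub> a) \<odot>\<^bsub>FQ B\<^esub> reduce B f"
  by (auto simp: reduce_def free_rmodule_sel fun_eq_iff coset_mult PiE_iff simp del: quot_algebra_sel)

lemma reduce_hom: "abelian_group_hom (F B) (FQ B) (reduce B)"
proof (rule additive_maps_hom)
  show "abelian_group (F B)" "abelian_group (FQ B)"
    using F_module[of B] FQ_module[of B] by (auto simp: right_module_def)
  show "reduce B \<in> additive_maps (F B) (FQ B)"
    by (auto simp: additive_maps_def reduce_closed reduce_add)
qed

lemma reduce_zero_iff: "f \<in> carrier (F B) \<Longrightarrow> reduce B f = \<zero>\<^bsub>FQ B\<^esub> \<longleftrightarrow> f \<in> FI B"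
  by (auto simp: reduce_def valued_in_def free_rmodule_sel fun_eq_iff coset_zero_iff PiE_iff)

lemma reduce_surj: assumes X: "X \<in> carrier (FQ B)" shows "\<exists>f\<in>carrier (F B). reduce B f = X"
proof -
  have XE: "X \<in> B \<rightarrow>\<^sub>E carrier Q" "finite {b \<in> B. X b \<noteq> I}" using X by (simp_all add: free_rmodule_sel)
  have "\<exists>a\<in>carrier A. X b = I +>\<^bsub>A\<^esub> a" if "b \<in> B" for b
    using XE(1) that Q_coset by (auto simp del: quot_algebra_sel)
  then obtain g where g: "\<And>b. b \<in> B \<Longrightarrow> g b \<in> carrier A" "\<And>b. b \<in> B \<Longrightarrow> X b = I +>\<^bsub>A\<^esub> g b" by metis
  \<comment> \<open>Zero cosets get the representative zero, so that the support of \<open>f\<close>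
    is no larger than that of \<open>X\<close>.\<close>
  define f where "f = (\<lambda>b\<in>B. if X b = I then \<zero>\<^bsub>A\<^esub> else g b)"
  have "finite {b \<in> B. f b \<noteq> \<zero>\<^bsub>A\<^esub>}"
    by (rule finite_subset[OF _ XE(2)]) (auto simp: f_def)
  then have f: "f \<in> carrier (F B)" using g by (auto simp: f_def free_rmodule_sel)
  have "reduce B f b = X b" for b
    using XE(1) g coset_zero_iff[OF zero_closed] I.zero_closed
    by (cases "b \<in> B") (auto simp: reduce_def f_def PiE_iff extensional_def)
  then show ?thesis using f by blast
qed

text \<open>A section of \<open>reduce\<close> chosen without any linearity. Its defects lie in
  \<open>FI B\<close>, so they are invisible to every additive map that kills
  \<open>FI B\<close>.\<close>

definition lift :: "'b set \<Rightarrow> ('b \<Rightarrow> 'a set) \<Rightarrow> 'b \<Rightarrow> 'a" where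
  "lift B X = (SOME f. f \<in> carrier (F B) \<and> reduce B f = X)"

lemma lift: assumes "X \<in> carrier (FQ B)"
  shows "lift B X \<in> carrier (F B)" "reduce B (lift B X) = X"
proof -
  have "\<exists>f. f \<in> carrier (F B) \<and> reduce B f = X" using reduce_surj[OF assms] by blast
  from someI_ex[OF this] show "lift B X \<in> carrier (F B)" "reduce B (lift B X) = X"
    unfolding lift_def by blast+
qed

lemma reduce_eq_imp:
  assumes "f \<in> carrier (F B)" "g \<in> carrier (F B)" "reduce B f = reduce B g"
  obtains z where "z \<in> FI B" "f = g \<oplus>\<^bsub>F B\<^esub> z"
proof -
  interpret F: right_module A "F B" by (rule F_module)
  interpret r: abelian_group_hom "F B" "FQ B" "reduce B" by (rule reduce_hom)
  have "reduce B (f \<ominus>\<^bsub>F B\<^esub> g) = \<zero>\<^bsub>FQ B\<^esub>"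
    using assms by (simp add: a_minus_def r.H.r_neg)
  then have "f \<ominus>\<^bsub>F B\<^esub> g \<in> FI B" using assms by (simp add: reduce_zero_iff)
  moreover have "f = g \<oplus>\<^bsub>F B\<^esub> (f \<ominus>\<^bsub>F B\<^esub> g)"
    using assms by (simp add: a_minus_def F.M.a_lcomm F.M.r_neg)
  ultimately show thesis by (rule that)
qed

text \<open>If \<open>g\<close> is additive and kills \<open>FI B\<close>, this is the map on P / P
  I through which \<open>g\<close> factors; the choice made by \<open>lift\<close> then has no
  influence.\<close>

definition descend :: "'b set \<Rightarrow> (('b \<Rightarrow> 'a) \<Rightarrow> 'v) \<Rightarrow> ('b \<Rightarrow> 'a set) \<Rightarrow> 'v" where
  "descend B g X = g (lift B X)"

lemma
  assumes V: "abelian_group V"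
    and g: "g \<in> additive_maps (F B) V"
    and gs: "\<And>a x. a \<in> carrier A \<Longrightarrow> x \<in> carrier (F B) \<Longrightarrow> g (a \<odot>\<^bsub>F B\<^esub> x) = (I +>\<^bsub>A\<^esub> a) \<odot>\<^bsub>V\<^esub> g x"
    and g0: "\<And>x. x \<in> FI B \<Longrightarrow> g x = \<zero>\<^bsub>V\<^esub>"
  shows descend_reduce: "x \<in> carrier (F B) \<Longrightarrow> descend B g (reduce B x) = g x"
    and descend_linear: "descend B g \<in> linear_maps Q (FQ B) V"
proof -
  interpret F: right_module A "F B" by (rule F_module)
  interpret g: abelian_group_hom "F B" V g by (rule additive_maps_hom[OF F.M.abelian_group_axioms V g])
  show dr: "descend B g (reduce B x) = g x" if x: "x \<in> carrier (F B)" for x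
  proof -
    note l = lift[OF reduce_closed[OF x]]
    obtain z where z: "z \<in> FI B" "lift B (reduce B x) = x \<oplus>\<^bsub>F B\<^esub> z"
      by (rule reduce_eq_imp[OF l(1) x l(2)])
    then have "z \<in> carrier (F B)" by (simp add: valued_in_def)
    then show ?thesis using x by (simp add: descend_def z(2) g0[OF z(1)])
  qed
  show "descend B g \<in> linear_maps Q (FQ B) V"
    unfolding linear_maps_def
  proof (intro CollectI conjI ballI Pi_I)
    fix X assume X: "X \<in> carrier (FQ B)"
    then obtain x where x: "x \<in> carrier (F B)" "X = reduce B x" using reduce_surj by blast
    show "descend B g X \<in> carrier V" using x by (simp add: dr)
    show "descend B g (s \<odot>\<^bsub>FQ B\<^esub> X) = s \<odot>\<^bsub>V\<^esub> descend B g X" if "s \<in> carrier Q" for s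
    proof -
      obtain a where a: "a \<in> carrier A" "s = I +>\<^bsub>A\<^esub> a" using Q_coset \<open>s \<in> carrier Q\<close> by blast
      show ?thesis using x a by (simp add: reduce_smult[symmetric] dr gs F.act_closed)
    qed
    fix Y assume Y: "Y \<in> carrier (FQ B)"
    then obtain y where y: "y \<in> carrier (F B)" "Y = reduce B y" using reduce_surj by blast
    show "descend B g (X \<oplus>\<^bsub>FQ B\<^esub> Y) = descend B g X \<oplus>\<^bsub>V\<^esub> descend B g Y"
      using x y by (simp add: reduce_add[symmetric] dr)
  qed
qed

text \<open>When \<open>a\<close> in I acts on a basis vector, the image has coefficients of the
  form \<open>\<phi> (basis_vec A B c) b \<otimes> a\<close>. These are left multiples of
  \<open>a\<close>, so they stay in I.\<close>

lemma linear_preserves_FI: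
  assumes \<phi>: "\<phi> \<in> linear_maps A (F B) (F C)" and f: "f \<in> FI B"
  shows "\<phi> f \<in> FI C"
proof -
  interpret C: right_module A "F C" by (rule F_module)
  interpret B: right_module A "F B" by (rule F_module)
  interpret \<phi>: abelian_group_hom "F B" "F C" \<phi> by (rule C.linear_hom[OF F_module \<phi>])
  have sub: "I \<subseteq> carrier A" by (rule I.a_subset)
  show ?thesis using f I.zero_closed sub
  proof (induction rule: free_valued_induct)
    case zero
    have "\<zero>\<^bsub>F C\<^esub> \<in> carrier (F C)" by simp
    moreover have "\<zero>\<^bsub>F C\<^esub> b \<in> I" if "b \<in> C" for b using that I.zero_closed by (simp add: free_rmodule_sel)
    ultimately show ?case by (simp add: valued_in_def)
  next
    case (step c a x)
    note bv = basis_vec_closed[OF ring_axioms, of B c]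
    have a: "a \<in> carrier A" using step sub by auto
    have x: "x \<in> carrier (F B)" using step by (simp add: valued_in_def)
    have pv: "\<phi> (basis_vec A B c) \<in> carrier (F C)" using bv by simp
    then have pvb: "\<phi> (basis_vec A B c) b \<in> carrier A" if "b \<in> C" for b
      using that by (auto simp: free_rmodule_sel)
    show ?case unfolding C.linear_step[OF \<phi> \<open>c \<in> B\<close> a x] valued_in_def
    proof (intro CollectI conjI ballI)
      show "a \<odot>\<^bsub>F C\<^esub> \<phi> (basis_vec A B c) \<oplus>\<^bsub>F C\<^esub> \<phi> x \<in> carrier (F C)"
        using a x pv C.act_closed by simp
      fix b assume b: "b \<in> C"
      then have "\<phi> x b \<in> I" using step by (simp add: valued_in_def)
      then show "(a \<odot>\<^bsub>F C\<^esub> \<phi> (basis_vec A B c) \<oplus>\<^bsub>F C\<^esub> \<phi> x) b \<in> I"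
        using b I.I_l_closed[OF \<open>a \<in> I\<close> pvb[OF b]] by (simp add: free_rmodule_sel)
    qed
  qed
qed

lemma
  assumes \<phi>: "\<phi> \<in> linear_maps A (F B) (F C)"
  shows reduced_map_reduce: "x \<in> carrier (F B)
      \<Longrightarrow> descend B (\<lambda>x. reduce C (\<phi> x)) (reduce B x) = reduce C (\<phi> x)"
    and reduced_map_linear: "descend B (\<lambda>x. reduce C (\<phi> x)) \<in> linear_maps Q (FQ B) (FQ C)"
proof -
  interpret C: right_module A "F C" by (rule F_module)
  interpret QC: right_module Q "FQ C" by (rule FQ_module)
  note cl = linear_maps_closed[OF \<phi>]
  have 1: "(\<lambda>x. reduce C (\<phi> x)) \<in> additive_maps (F B) (FQ C)"
    by (auto simp: additive_maps_def cl reduce_closed reduce_add linear_maps_add[OF \<phi>])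
  have 2: "reduce C (\<phi> (a \<odot>\<^bsub>F B\<^esub> x)) = (I +>\<^bsub>A\<^esub> a) \<odot>\<^bsub>FQ C\<^esub> reduce C (\<phi> x)"
    if "a \<in> carrier A" "x \<in> carrier (F B)" for a x
    using that by (simp add: linear_maps_smult[OF \<phi>] reduce_smult cl)
  have 3: "reduce C (\<phi> x) = \<zero>\<^bsub>FQ C\<^esub>" if "x \<in> FI B" for x
    using linear_preserves_FI[OF \<phi> that] that cl by (simp add: reduce_zero_iff valued_in_def)
  show "x \<in> carrier (F B) \<Longrightarrow> descend B (\<lambda>x. reduce C (\<phi> x)) (reduce B x) = reduce C (\<phi> x)"
    by (rule descend_reduce[OF QC.M.abelian_group_axioms 1 2 3])
  show "descend B (\<lambda>x. reduce C (\<phi> x)) \<in> linear_maps Q (FQ B) (FQ C)"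
    by (rule descend_linear[OF QC.M.abelian_group_axioms 1 2 3])
qed

text \<open>\<open>ex0\<close> and \<open>exS\<close> are the exactness of P I, which in degree 0
  means that every element is a boundary. The long exact sequence for P I inside P is replaced by
  correcting lifts of cycles.\<close>

lemma reduced_resolution:
  assumes P: "free_resolution A M B d \<epsilon>"
    and IM: "\<And>a x. \<lbrakk>a \<in> I; x \<in> carrier M\<rbrakk> \<Longrightarrow> a \<odot>\<^bsub>M\<^esub> x = \<zero>\<^bsub>M\<^esub>"
    and ex0: "\<And>x. x \<in> FI (B 0) \<Longrightarrow> \<exists>z\<in>FI (B (Suc 0)). d 0 z = x"
    and exS: "\<And>n x. x \<in> FI (B (Suc n)) \<Longrightarrow> d n x = \<zero>\<^bsub>F (B n)\<^esub> \<Longrightarrow> \<exists>z\<in>FI (B (Suc (Suc n))). d (Suc n) z = x"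
  shows "free_resolution Q (module_over_quot M) B
    (\<lambda>n. descend (B (Suc n)) (\<lambda>x. reduce (B n) (d n x))) (descend (B 0) \<epsilon>)"
proof -
  interpret P: free_resolution A M B d \<epsilon> by fact
  interpret PF: right_module A "F C" for C by (rule F_module)
  interpret r: abelian_group_hom "F C" "FQ C" "reduce C" for C by (rule reduce_hom)
  interpret d: abelian_group_hom "F (B (Suc m))" "F (B m)" "d m" for m
    by (rule PF.linear_hom[OF F_module P.d_linear])
  interpret e: abelian_group_hom "F (B 0)" M \<epsilon> by (rule P.linear_hom[OF F_module P.aug_linear])
  let ?d = "\<lambda>n. descend (B (Suc n)) (\<lambda>x. reduce (B n) (d n x))" and ?e = "descend (B 0) \<epsilon>"
  let ?M = "module_over_quot M"
  have MQ: "right_module Q ?M"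
    by (rule right_module_over_quot[OF assoc_algebra_axioms I.ideal_axioms P.right_module_axioms IM])
  interpret MQ: right_module Q ?M by (rule MQ)
  have e1: "\<epsilon> \<in> additive_maps (F (B 0)) ?M"
    by (auto simp: additive_maps_def)
  have act: "(I +>\<^bsub>A\<^esub> a) \<odot>\<^bsub>?M\<^esub> y = a \<odot>\<^bsub>M\<^esub> y" if "a \<in> carrier A" "y \<in> carrier M" for a y
    by (rule module_over_quot_act[OF I.ideal_axioms])
      (use that P.act_closed P.act_l_distr P.M.abelian_group_axioms IM in auto)
  have e2: "\<epsilon> (a \<odot>\<^bsub>F (B 0)\<^esub> x) = (I +>\<^bsub>A\<^esub> a) \<odot>\<^bsub>?M\<^esub> \<epsilon> x" if "a \<in> carrier A" "x \<in> carrier (F (B 0))" for a x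
    using that act by (simp add: linear_maps_smult[OF P.aug_linear] del: module_over_quot_sel(4))
  have e3: "\<epsilon> x = \<zero>\<^bsub>?M\<^esub>" if "x \<in> FI (B 0)" for x
    using P.linear_kills_valued[OF P.aug_linear that] I.zero_closed I.a_subset IM by auto
  note er = descend_reduce[OF MQ.M.abelian_group_axioms e1 e2 e3]
    and el = descend_linear[OF MQ.M.abelian_group_axioms e1 e2 e3]
  note dr = reduced_map_reduce[OF P.d_linear] and dl = reduced_map_linear[OF P.d_linear]
  have imd: "?d n ` carrier (FQ (B (Suc n))) = (\<lambda>x. reduce (B n) (d n x)) ` carrier (F (B (Suc n)))" for n
  proof -
    have "carrier (FQ (B (Suc n))) = reduce (B (Suc n)) ` carrier (F (B (Suc n)))"
      using reduce_surj reduce_closed by blast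
    then show ?thesis by (simp only: image_image) (rule image_cong[OF refl dr])
  qed
  have cor: "reduce (B n) (z \<oplus>\<^bsub>F (B n)\<^esub> y) = reduce (B n) y" if "z \<in> FI (B n)" "y \<in> carrier (F (B n))" for n z y
    using that reduce_zero_iff[of z "B n"] by (simp add: valued_in_def)
  have split: "z \<oplus>\<^bsub>F (B n)\<^esub> (x \<ominus>\<^bsub>F (B n)\<^esub> z) = x" if "z \<in> FI (B n)" "x \<in> carrier (F (B n))" for n x z
    using that by (simp add: valued_in_def a_minus_def PF.M.a_lcomm PF.M.r_neg)
  show ?thesis
  proof (intro free_resolution.intro free_resolution_axioms.intro MQ dl el)
    show "?e ` carrier (FQ (B 0)) = carrier ?M"
    proof
      show "?e ` carrier (FQ (B 0)) \<subseteq> carrier ?M"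
        by (intro image_subsetI linear_maps_closed[OF el])
      show "carrier ?M \<subseteq> ?e ` carrier (FQ (B 0))"
      proof
        fix y assume "y \<in> carrier ?M"
        then obtain x where "x \<in> carrier (F (B 0))" "y = \<epsilon> x" using P.aug_surj by auto
        then have "y = ?e (reduce (B 0) x)" "reduce (B 0) x \<in> carrier (FQ (B 0))"
          using er reduce_closed by auto
        then show "y \<in> ?e ` carrier (FQ (B 0))" by blast
      qed
    qed
  next
    show "?d 0 ` carrier (FQ (B (Suc 0))) = {f \<in> carrier (FQ (B 0)). ?e f = \<zero>\<^bsub>?M\<^esub>}"
      unfolding imd
    proof (intro equalityI subsetI)
      fix X assume "X \<in> (\<lambda>x. reduce (B 0) (d 0 x)) ` carrier (F (B (Suc 0)))"
      then obtain x where "x \<in> carrier (F (B (Suc 0)))" "X = reduce (B 0) (d 0 x)" by blast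
      then show "X \<in> {f \<in> carrier (FQ (B 0)). ?e f = \<zero>\<^bsub>?M\<^esub>}" by (simp add: er P.aug_d)
    next
      fix X assume X: "X \<in> {f \<in> carrier (FQ (B 0)). ?e f = \<zero>\<^bsub>?M\<^esub>}"
      then obtain x where x: "x \<in> carrier (F (B 0))" "X = reduce (B 0) x" using reduce_surj[of X] by blast
      then have "\<epsilon> x = \<zero>\<^bsub>M\<^esub>" using X by (simp add: er)
      then obtain w where "w \<in> carrier (F (B (Suc 0)))" "x = d 0 w" using x P.exact_0 by blast
      then show "X \<in> (\<lambda>x. reduce (B 0) (d 0 x)) ` carrier (F (B (Suc 0)))" using x by blast
    qed
  next
    fix n
    show "?d (Suc n) ` carrier (FQ (B (Suc (Suc n)))) = {f \<in> carrier (FQ (B (Suc n))). ?d n f = \<zero>\<^bsub>FQ (B n)\<^esub>}"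
      unfolding imd
    proof (intro equalityI subsetI)
      fix X assume "X \<in> (\<lambda>x. reduce (B (Suc n)) (d (Suc n) x)) ` carrier (F (B (Suc (Suc n))))"
      then obtain x where "x \<in> carrier (F (B (Suc (Suc n))))" "X = reduce (B (Suc n)) (d (Suc n) x)" by blast
      then show "X \<in> {f \<in> carrier (FQ (B (Suc n))). ?d n f = \<zero>\<^bsub>FQ (B n)\<^esub>}" by (simp add: dr P.d_d)
    next
      fix X assume X: "X \<in> {f \<in> carrier (FQ (B (Suc n))). ?d n f = \<zero>\<^bsub>FQ (B n)\<^esub>}"
      then obtain x where x: "x \<in> carrier (F (B (Suc n)))" "X = reduce (B (Suc n)) x"
        using reduce_surj[of X] by blast
      then have dx: "d n x \<in> FI (B n)" using X by (simp add: dr reduce_zero_iff)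
      \<comment> \<open>The lift \<open>x\<close> is a cycle only modulo I. An element
        \<open>z\<close> of P I with the same differential turns it into a true cycle
        \<open>x\<close> minus \<open>z\<close> with the same reduction. For \<open>n = 0\<close>
        the differential lands in degree 0, where \<open>ex0\<close> applies; otherwise it is
        \<open>exS\<close> with the index lowered by one.\<close>
      have "\<exists>z\<in>FI (B (Suc n)). d n z = d n x"
      proof (cases n)
        case 0 then show ?thesis using ex0 dx by simp
      next
        case (Suc m) then show ?thesis using exS[of "d n x" m] dx x(1) P.d_d by simp
      qed
      then obtain z where z: "z \<in> FI (B (Suc n))" "d n z = d n x" by blast
      have zc: "z \<in> carrier (F (B (Suc n)))" using z by (simp add: valued_in_def)
      have "d n (x \<ominus>\<^bsub>F (B (Suc n))\<^esub> z) = \<zero>\<^bsub>F (B n)\<^esub>"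
        using x zc z by (simp add: a_minus_def PF.M.r_neg)
      then have "x \<ominus>\<^bsub>F (B (Suc n))\<^esub> z \<in> d (Suc n) ` carrier (F (B (Suc (Suc n))))"
        unfolding P.exact using x zc by simp
      then obtain w where w: "w \<in> carrier (F (B (Suc (Suc n))))" "x \<ominus>\<^bsub>F (B (Suc n))\<^esub> z = d (Suc n) w"
        by blast
      have "X = reduce (B (Suc n)) (z \<oplus>\<^bsub>F (B (Suc n))\<^esub> d (Suc n) w)"
        using split[OF z(1) x(1)] x(2) w(2) by simp
      also have "\<dots> = reduce (B (Suc n)) (d (Suc n) w)" using w by (intro cor z) simp
      finally show "X \<in> (\<lambda>x. reduce (B (Suc n)) (d (Suc n) x)) ` carrier (F (B (Suc (Suc n))))" using w by blast
    qed
  qed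
qed

end

section \<open>Tensor products modulo an ideal\<close>

text \<open>Boundaries are pulled back with surjectivity one degree up and injectivity in degree
  \<open>n\<close>; cycles are pulled back with surjectivity in degree \<open>n\<close> and
  injectivity one degree down.\<close>

lemma homology_iso_of_chain_iso:
  assumes "chain_complex R C d" "chain_complex R D e"
    and lin: "\<And>n. \<phi> n \<in> linear_maps R (C n) (D n)"
    and comm: "\<And>n x. x \<in> carrier (C (Suc n)) \<Longrightarrow> \<phi> n (d n x) = e n (\<phi> (Suc n) x)"
    and bij: "\<And>n. bij_betw (\<phi> n) (carrier (C n)) (carrier (D n))"
  shows "isomorphic_modules R (homology C d n) (homology D e n)"
proof -
  interpret C: chain_complex R C d by fact
  interpret D: chain_complex R D e by fact
  interpret Cn: module R "C n" by (rule C.mod)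
  interpret Dn: module R "D n" by (rule D.mod)
  have inj: "\<phi> m x = \<phi> m y \<Longrightarrow> x \<in> carrier (C m) \<Longrightarrow> y \<in> carrier (C m) \<Longrightarrow> x = y" for m x y
    using bij[of m] by (auto simp: bij_betw_def inj_on_def)
  have sur: "y \<in> carrier (D m) \<Longrightarrow> \<exists>x\<in>carrier (C m). y = \<phi> m x" for m y
    using bij[of m] by (auto simp: bij_betw_def)
  show ?thesis
  proof (rule homology_iso[where \<phi> = \<phi>, OF C.chain_complex_axioms D.chain_complex_axioms lin comm])
    fix x assume x: "x \<in> cycles C d n" and "\<phi> n x \<in> boundaries D e n"
    then obtain w where w: "w \<in> carrier (C (Suc n))" "\<phi> n x = e n (\<phi> (Suc n) w)"
      using sur by (auto simp: boundaries_def)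
    then have "x = d n w"
      using comm x by (intro inj[of n] C.cycles_closed) (auto intro: C.d_cycle)
    then show "x \<in> boundaries C d n" using w by (simp add: boundaries_def)
  next
    fix y assume y: "y \<in> cycles D e n"
    obtain x where x: "x \<in> carrier (C n)" "y = \<phi> n x" using sur[OF D.cycles_closed[OF y]] by blast
    have xc: "x \<in> cycles C d n"
    proof (cases n)
      case 0 then show ?thesis using x by (simp add: cycles_def)
    next
      case (Suc m)
      interpret \<phi>: abelian_group_hom "C m" "D m" "\<phi> m"
        using C.mod[of m] D.mod[of m] by (intro additive_maps_hom linear_maps_additive[OF lin]) (simp_all add: module_def)
      have xm: "x \<in> carrier (C (Suc m))" using x Suc by simp
      have "\<phi> m (d m x) = \<phi> m \<zero>\<^bsub>C m\<^esub>" using y x xm by (simp add: cycles_def Suc comm)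
      then have "d m x = \<zero>\<^bsub>C m\<^esub>" by (rule inj) (use linear_maps_closed[OF C.d_linear xm] in auto)
      then show ?thesis using xm by (simp add: cycles_def Suc)
    qed
    interpret C1: module R "C (Suc n)" by (rule C.mod)
    interpret e: abelian_group_hom "D (Suc n)" "D n" "e n"
      using D.mod[of "Suc n"] D.mod[of n] by (intro additive_maps_hom linear_maps_additive[OF D.d_linear]) (simp_all add: module_def)
    have "\<zero>\<^bsub>D n\<^esub> \<in> boundaries D e n"
      unfolding boundaries_def by (rule image_eqI[of _ _ "\<zero>\<^bsub>D (Suc n)\<^esub>"]) simp_all
    then have "y \<ominus>\<^bsub>D n\<^esub> \<phi> n x \<in> boundaries D e n"
      using D.cycles_closed[OF y] by (simp add: x(2) a_minus_def Dn.M.r_neg)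
    then show "\<exists>x\<in>cycles C d n. y \<ominus>\<^bsub>D n\<^esub> \<phi> n x \<in> boundaries D e n" using xc by blast
  qed
qed

section \<open>Comparing the tensor products over A and over A/I\<close>

locale algebra_ideal_module = algebra_ideal R A I + algebra_left_module R A N
  for R :: "'r ring" and A :: "('r, 'a) module" and I :: "'a set" and N :: "('a, 'n) module" +
  assumes IN: "\<lbrakk>a \<in> I; y \<in> carrier N\<rbrakk> \<Longrightarrow> a \<odot>\<^bsub>N\<^esub> y = \<zero>\<^bsub>N\<^esub>"
begin

abbreviation "NQ \<equiv> module_over_quot N"

lemma NQ_module: "algebra_left_module R Q NQ"
  by (intro algebra_left_module.intro Q_algebra
      left_module_over_quot[OF assoc_algebra_axioms I.ideal_axioms N.left_module_axioms IN])

lemma NQ_act: "a \<in> carrier A \<Longrightarrow> y \<in> carrier N \<Longrightarrow> (I +>\<^bsub>A\<^esub> a) \<odot>\<^bsub>NQ\<^esub> y = a \<odot>\<^bsub>N\<^esub> y"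
  by (rule module_over_quot_act[OF I.ideal_axioms])
    (use N.act_closed N.act_l_distr N.N.abelian_group_axioms IN in auto)

lemma Q_unit_multiple: assumes r: "r \<in> carrier R" shows "r \<odot>\<^bsub>Q\<^esub> \<one>\<^bsub>Q\<^esub> = I +>\<^bsub>A\<^esub> unit_multiple r"
proof -
  have st: "r \<odot>\<^bsub>A\<^esub> x \<in> I" if "x \<in> I" for x
  proof -
    have x: "x \<in> carrier A" using that I.a_subset by auto
    have "r \<odot>\<^bsub>A\<^esub> x = unit_multiple r \<otimes>\<^bsub>A\<^esub> x" using r x by (simp add: smult_mult_left)
    then show ?thesis using that r I.I_l_closed by simp
  qed
  show ?thesis
    using quot_act[of I A r "\<one>\<^bsub>A\<^esub>"] I.additive_subgroup_axioms abelian_group_axioms st r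
    by (simp add: smult_r_distr)
qed

text \<open>A scalar from I moves across the tensor sign and kills \<open>y\<close>. Summed over the
  support, this shows that P I contributes nothing to the tensor product with N.\<close>

lemma FI_tensor_zero:
  assumes x: "x \<in> FI B" and y: "y \<in> carrier N"
  shows "frag_of (x, y) \<in> tensor_rels A (F B) N"
proof -
  interpret B: right_module A "F B" by (rule F_module)
  note incl = tensor_rels_incl[OF F_module, of _ B] and zero = tensor_rels_zero[OF F_module, of B]
    and diff = tensor_rels_diff[OF F_module, of _ B] and plus = tensor_rels_add[OF F_module, of _ B]
  \<comment> \<open>The additivity generator for zero plus zero is minus the pair in question, so
    the pair itself is a relation; \<open>r0\<close> uses the same trick in the second slot.\<close>
  have l0: "frag_of (\<zero>\<^bsub>F B\<^esub>, y) \<in> tensor_rels A (F B) N" if "y \<in> carrier N" for y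
    using diff[OF zero incl[OF tensor_gens.intros(1)[of "\<zero>\<^bsub>F B\<^esub>" "F B" "\<zero>\<^bsub>F B\<^esub>" y]]] that by simp
  have r0: "frag_of (x, \<zero>\<^bsub>N\<^esub>) \<in> tensor_rels A (F B) N" if "x \<in> carrier (F B)" for x
    using diff[OF zero incl[OF tensor_gens.intros(2)[of x "F B" "\<zero>\<^bsub>N\<^esub>" N "\<zero>\<^bsub>N\<^esub>"]]] that by simp
  show ?thesis using x I.zero_closed I.a_subset
  proof (induction rule: free_valued_induct)
    case zero show ?case by (rule l0[OF y])
  next
    case (step c a x)
    note bv = basis_vec_closed[OF ring_axioms, of B c]
    have a: "a \<in> carrier A" using step I.a_subset by auto
    have xc: "x \<in> carrier (F B)" using step by (simp add: valued_in_def)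
    let ?ac = "a \<odot>\<^bsub>F B\<^esub> basis_vec A B c"
    have ac: "?ac \<in> carrier (F B)" by (rule B.act_closed[OF a bv])
    have "frag_of (?ac, y) - frag_of (basis_vec A B c, a \<odot>\<^bsub>N\<^esub> y) \<in> tensor_rels A (F B) N"
      by (rule incl[OF tensor_gens.intros(3)[OF bv a y]])
    then have "frag_of (?ac, y) - frag_of (basis_vec A B c, a \<odot>\<^bsub>N\<^esub> y) + frag_of (basis_vec A B c, a \<odot>\<^bsub>N\<^esub> y)
        \<in> tensor_rels A (F B) N"
      by (rule plus) (simp add: IN[OF \<open>a \<in> I\<close> y] r0[OF bv])
    then have 1: "frag_of (?ac, y) \<in> tensor_rels A (F B) N" by simp
    have "frag_of (?ac \<oplus>\<^bsub>F B\<^esub> x, y) - frag_of (?ac, y) - frag_of (x, y) \<in> tensor_rels A (F B) N"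
      by (rule incl[OF tensor_gens.intros(1)[OF ac xc y]])
    from plus[OF plus[OF this step.IH] 1] show ?case by simp
  qed
qed

text \<open>Vectors with the same reduction differ by an element of \<open>FI B\<close>, whose pairs
  with elements of N are relations. This is what makes the nonlinear \<open>lift\<close> usable
  inside tensor products.\<close>

lemma reduce_eq_tensor:
  assumes x: "x \<in> carrier (F B)" "x' \<in> carrier (F B)" and eq: "reduce B x = reduce B x'" and y: "y \<in> carrier N"
  shows "frag_of (x, y) - frag_of (x', y) \<in> tensor_rels A (F B) N"
proof -
  interpret B: right_module A "F B" by (rule F_module)
  obtain z where z: "z \<in> FI B" "x = x' \<oplus>\<^bsub>F B\<^esub> z" by (rule reduce_eq_imp[OF x eq])
  have "frag_of (x' \<oplus>\<^bsub>F B\<^esub> z, y) - frag_of (x', y) - frag_of (z, y) \<in> tensor_rels A (F B) N"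
    using x(2) y z(1) by (intro tensor_rels_incl[OF F_module] tensor_gens.intros(1)) (auto simp: valued_in_def)
  from tensor_rels_add[OF F_module this FI_tensor_zero[OF z(1) y]] show ?thesis by (simp add: z(2))
qed

lemma frag_map_reduce_rels:
  assumes z: "z \<in> tensor_rels A (F B) N"
  shows "frag_map (reduce B) z \<in> tensor_rels Q (FQ B) NQ"
proof -
  interpret NQ: algebra_left_module R Q NQ by (rule NQ_module)
  show ?thesis
  proof (rule tensor_rels_frag_extend[OF F_module z])
    show "frag_map (reduce B) w \<in> tensor_rels Q (FQ B) NQ" if "w \<in> tensor_gens A (F B) N" for w
      using that
    proof cases
      case (1 x x' y)
      then have "frag_map (reduce B) w = frag_of (reduce B x \<oplus>\<^bsub>FQ B\<^esub> reduce B x', y)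
          - frag_of (reduce B x, y) - frag_of (reduce B x', y)"
        by (simp add: frag_extend_diff reduce_add)
      then show ?thesis using 1
        by (simp only:) (intro NQ.tensor_rels_incl[OF FQ_module] tensor_gens.intros(1) reduce_closed, simp_all)
    next
      case (2 x y y')
      then have "frag_map (reduce B) w = frag_of (reduce B x, y \<oplus>\<^bsub>NQ\<^esub> y')
          - frag_of (reduce B x, y) - frag_of (reduce B x, y')"
        by (simp add: frag_extend_diff)
      then show ?thesis using 2
        by (simp only:) (intro NQ.tensor_rels_incl[OF FQ_module] tensor_gens.intros(2) reduce_closed, simp_all)
    next
      case (3 x a y)
      then have "frag_map (reduce B) w = frag_of ((I +>\<^bsub>A\<^esub> a) \<odot>\<^bsub>FQ B\<^esub> reduce B x, y)
          - frag_of (reduce B x, (I +>\<^bsub>A\<^esub> a) \<odot>\<^bsub>NQ\<^esub> y)"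
        using NQ_act[of a y] by (simp add: frag_extend_diff reduce_smult del: module_over_quot_sel(4))
      then show ?thesis using 3
        by (simp only:) (intro NQ.tensor_rels_incl[OF FQ_module] tensor_gens.intros(3) reduce_closed coset_in_Q, simp_all)
    qed
  qed (use NQ.tensor_rels_zero[OF FQ_module] NQ.tensor_rels_diff[OF FQ_module] in auto)
qed

text \<open>A generator over A/I lifts to a generator over A up to the failure of
  \<open>lift\<close> to be additive or compatible with scalars. That failure compares two vectors
  with equal reduction, so \<open>reduce_eq_tensor\<close> absorbs it.\<close>

lemma frag_map_lift_rels:
  assumes z: "z \<in> tensor_rels Q (FQ B) NQ"
  shows "frag_map (lift B) z \<in> tensor_rels A (F B) N"
proof -
  interpret NQ: algebra_left_module R Q NQ by (rule NQ_module)
  interpret B: right_module A "F B" by (rule F_module)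
  interpret QB: right_module Q "FQ B" by (rule FQ_module)
  note plus = tensor_rels_add[OF F_module]
  show ?thesis
  proof (rule NQ.tensor_rels_frag_extend[OF FQ_module z])
    show "frag_map (lift B) w \<in> tensor_rels A (F B) N" if "w \<in> tensor_gens Q (FQ B) NQ" for w
      using that
    proof cases
      case (1 X X' y)
      have y: "y \<in> carrier N" using 1 by simp
      have "frag_of (lift B (X \<oplus>\<^bsub>FQ B\<^esub> X'), y) - frag_of (lift B X \<oplus>\<^bsub>F B\<^esub> lift B X', y) \<in> tensor_rels A (F B) N"
        by (rule reduce_eq_tensor[OF _ _ _ y]) (use lift[OF 1(2)] lift[OF 1(3)] lift[OF QB.M.a_closed[OF 1(2,3)]] in \<open>simp_all add: reduce_add\<close>)
      from plus[OF this tensor_rels_incl[OF F_module tensor_gens.intros(1)[OF lift(1)[OF 1(2)] lift(1)[OF 1(3)] y]]]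
      show ?thesis by (simp add: 1(1) frag_extend_diff) (simp add: algebra_simps)
    next
      case (2 X y y')
      then show ?thesis
        using tensor_rels_incl[OF F_module tensor_gens.intros(2)[of "lift B X" "F B" y N y' A]] lift(1)[of X]
        by (simp add: frag_extend_diff)
    next
      case (3 X s y)
      have y: "y \<in> carrier N" using 3 by simp
      obtain a where a: "a \<in> carrier A" "s = I +>\<^bsub>A\<^esub> a" using Q_coset 3(3) by blast
      note l = lift[OF 3(2)] and sX = QB.act_closed[OF 3(3,2), unfolded a(2)]
      have al: "a \<odot>\<^bsub>F B\<^esub> lift B X \<in> carrier (F B)" by (rule B.act_closed[OF a(1) l(1)])
      have "frag_of (lift B (s \<odot>\<^bsub>FQ B\<^esub> X), y) - frag_of (a \<odot>\<^bsub>F B\<^esub> lift B X, y) \<in> tensor_rels A (F B) N"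
        by (rule reduce_eq_tensor[OF _ _ _ y])
          (simp_all add: lift(1)[OF sX] al reduce_smult[OF a(1) l(1)] lift(2)[OF sX] l(2) a(2) del: quot_algebra_sel)
      from plus[OF this tensor_rels_incl[OF F_module tensor_gens.intros(3)[OF lift(1)[OF 3(2)] a(1) y]]]
      show ?thesis using NQ_act[OF a(1) y] by (simp add: 3(1) a(2) frag_extend_diff del: module_over_quot_sel(4))
    qed
  qed (use tensor_rels_zero[OF F_module] tensor_rels_diff[OF F_module] in auto)
qed

text \<open>On representatives the inverse is given by \<open>lift\<close>: \<open>reduce\<close>
  after \<open>lift\<close> is the identity on formal sums, \<open>lift\<close> after
  \<open>reduce\<close> only modulo relations. The value of \<open>\<theta>\<close> on classes is
  exported so that compatibility with differentials becomes a computation with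
  representatives.\<close>

lemma tensor_reduce_iso:
  obtains \<theta> where "\<theta> \<in> linear_maps R (tensor A (F B) N) (tensor Q (FQ B) NQ)"
    and "bij_betw \<theta> (carrier (tensor A (F B) N)) (carrier (tensor Q (FQ B) NQ))"
    and "\<And>z. z \<in> carrier (tensor_pre A (F B) N)
      \<Longrightarrow> \<theta> (tensor_class A (F B) N z) = tensor_class Q (FQ B) NQ (frag_map (reduce B) z)"
proof -
  interpret NQ: algebra_left_module R Q NQ by (rule NQ_module)
  interpret QB: right_module Q "FQ B" by (rule FQ_module)
  let ?T = "tensor_pre A (F B) N" and ?TQ = "tensor_pre Q (FQ B) NQ"
  have rc: "frag_map (reduce B) z \<in> carrier ?TQ" if "z \<in> carrier ?T" for z
    using frag_map_carrier[OF Pi_I[OF reduce_closed]] that by simp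
  have lc: "frag_map (lift B) z \<in> carrier ?T" if "z \<in> carrier ?TQ" for z
    using frag_map_carrier[OF Pi_I[OF lift(1)]] that by simp
  have lr: "frag_map (lift B) (frag_map (reduce B) z) - z \<in> tensor_rels A (F B) N" if z: "z \<in> carrier ?T" for z
  proof -
    have "frag_map (\<lambda>x. lift B (reduce B x)) z - frag_map (\<lambda>x. x) z \<in> tensor_rels A (F B) N"
    proof (rule tensor_rels_ext[OF F_module])
      show "Poly_Mapping.keys z \<subseteq> carrier (F B) \<times> carrier N" using z by simp
      fix p assume "p \<in> carrier (F B) \<times> carrier N"
      then obtain x y where xy: "p = (x, y)" "x \<in> carrier (F B)" "y \<in> carrier N" by blast
      show "(case p of (x, y) \<Rightarrow> frag_of (lift B (reduce B x), y)) - (case p of (x, y) \<Rightarrow> frag_of (x, y))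
          \<in> tensor_rels A (F B) N"
        using reduce_eq_tensor[OF lift(1)[OF reduce_closed[OF xy(2)]] xy(2) lift(2)[OF reduce_closed[OF xy(2)]] xy(3)]
        by (simp add: xy(1))
    qed
    then show ?thesis by (simp only: frag_map_comp frag_map_id)
  qed
  have rl: "frag_map (reduce B) (frag_map (lift B) z) = z" if z: "z \<in> carrier ?TQ" for z
  proof -
    have "frag_map (\<lambda>x. reduce B (lift B x)) z = frag_map (\<lambda>x. x) z"
      by (rule frag_map_cong[of "carrier (FQ B)" _ _ _ "carrier N"]) (use z lift(2) in auto)
    then show ?thesis by (simp only: frag_map_comp frag_map_id)
  qed
  have f1: "frag_map (reduce B) \<in> additive_maps ?T ?TQ"
    unfolding additive_maps_def using rc by (simp add: frag_extend_add)
  have f2: "frag_map (reduce B) (s \<odot>\<^bsub>?T\<^esub> z) = s \<odot>\<^bsub>?TQ\<^esub> frag_map (reduce B) z"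
    if s: "s \<in> carrier R" and z: "z \<in> carrier ?T" for s z
  proof -
    have "frag_map (\<lambda>x. reduce B (unit_multiple s \<odot>\<^bsub>F B\<^esub> x)) z
        = frag_map (\<lambda>x. (s \<odot>\<^bsub>Q\<^esub> \<one>\<^bsub>Q\<^esub>) \<odot>\<^bsub>FQ B\<^esub> reduce B x) z"
      by (rule frag_map_cong[of "carrier (F B)" _ _ _ "carrier N"])
        (use s z Q_unit_multiple[OF s] in \<open>simp_all add: reduce_smult del: quot_algebra_sel\<close>)
    then show ?thesis by (simp only: tensor_pre_sel(4) frag_map_comp)
  qed
  have f3: "frag_map (reduce B) z \<in> tensor_rels Q (FQ B) NQ \<longleftrightarrow> z \<in> tensor_rels A (F B) N"
    if z: "z \<in> carrier ?T" for z
  proof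
    assume "frag_map (reduce B) z \<in> tensor_rels Q (FQ B) NQ"
    then have "frag_map (lift B) (frag_map (reduce B) z) \<in> tensor_rels A (F B) N"
      by (rule frag_map_lift_rels)
    from tensor_rels_diff[OF F_module this lr[OF z]] show "z \<in> tensor_rels A (F B) N" by simp
  qed (rule frag_map_reduce_rels)
  have f4: "\<exists>x\<in>carrier ?T. y \<ominus>\<^bsub>?TQ\<^esub> frag_map (reduce B) x \<in> tensor_rels Q (FQ B) NQ"
    if y: "y \<in> carrier ?TQ" for y
  proof (rule bexI[OF _ lc[OF y]])
    show "y \<ominus>\<^bsub>?TQ\<^esub> frag_map (reduce B) (frag_map (lift B) y) \<in> tensor_rels Q (FQ B) NQ"
      unfolding rl[OF y] tensor_pre_minus[OF y y] using NQ.tensor_rels_zero[OF FQ_module] by simp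
  qed
  show thesis
  proof (rule quot_module_iso[OF tensor_action_subgroup[OF F_module[of B]]
        NQ.tensor_action_subgroup[OF FQ_module[of B]] f1 f2 f3 f4, folded tensor_def])
    fix \<theta>
    assume bij: "bij_betw \<theta> (carrier (tensor A (F B) N)) (carrier (tensor Q (FQ B) NQ))"
      and cls: "\<And>z. z \<in> carrier ?T \<Longrightarrow> \<theta> (tensor_class A (F B) N z) = tensor_class Q (FQ B) NQ (frag_map (reduce B) z)"
      and "\<theta> \<in> additive_maps (tensor A (F B) N) (tensor Q (FQ B) NQ)"
      and "\<And>s X. s \<in> carrier R \<Longrightarrow> X \<in> carrier (tensor A (F B) N)
        \<Longrightarrow> \<theta> (s \<odot>\<^bsub>tensor A (F B) N\<^esub> X) = s \<odot>\<^bsub>tensor Q (FQ B) NQ\<^esub> \<theta> X"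
    then have "\<theta> \<in> linear_maps R (tensor A (F B) N) (tensor Q (FQ B) NQ)"
      by (simp add: linear_maps_def additive_maps_def)
    then show thesis by (rule that[OF _ bij cls])
  qed
qed

text \<open>The two complexes are isomorphic before homology is taken. Compatibility of the
  isomorphisms with the differentials comes down to \<open>reduced_map_reduce\<close>, the
  characteristic equation of the reduced differential.\<close>

lemma reduced_homology_iso:
  assumes P: "free_resolution A M B d \<epsilon>"
    and PQ: "free_resolution Q MQ B (\<lambda>n. descend (B (Suc n)) (\<lambda>x. reduce (B n) (d n x))) \<eta>"
  shows "isomorphic_modules R
    (homology (\<lambda>i. tensor A (F (B i)) N) (\<lambda>i. tensor_map A (F (B i)) N (d i)) n)
    (homology (\<lambda>i. tensor Q (FQ (B i)) NQ)
      (\<lambda>i. tensor_map Q (FQ (B i)) NQ (descend (B (Suc i)) (\<lambda>x. reduce (B i) (d i x)))) n)"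
proof -
  interpret NQ: algebra_left_module R Q NQ by (rule NQ_module)
  interpret P: free_resolution A M B d \<epsilon> by fact
  let ?d = "\<lambda>n. descend (B (Suc n)) (\<lambda>x. reduce (B n) (d n x))"
  have "\<exists>\<theta>. \<theta> \<in> linear_maps R (tensor A (F (B n)) N) (tensor Q (FQ (B n)) NQ)
    \<and> bij_betw \<theta> (carrier (tensor A (F (B n)) N)) (carrier (tensor Q (FQ (B n)) NQ))
    \<and> (\<forall>z\<in>carrier (tensor_pre A (F (B n)) N).
        \<theta> (tensor_class A (F (B n)) N z) = tensor_class Q (FQ (B n)) NQ (frag_map (reduce (B n)) z))" for n
    by (rule tensor_reduce_iso[of "B n"]) blast
  then obtain \<theta> where \<theta>: "\<And>n. \<theta> n \<in> linear_maps R (tensor A (F (B n)) N) (tensor Q (FQ (B n)) NQ)"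
    "\<And>n. bij_betw (\<theta> n) (carrier (tensor A (F (B n)) N)) (carrier (tensor Q (FQ (B n)) NQ))"
    "\<And>n z. z \<in> carrier (tensor_pre A (F (B n)) N)
      \<Longrightarrow> \<theta> n (tensor_class A (F (B n)) N z) = tensor_class Q (FQ (B n)) NQ (frag_map (reduce (B n)) z)"
    by metis
  show ?thesis
  proof (rule homology_iso_of_chain_iso[where \<phi> = \<theta>, OF tensor_chain_complex[OF P] NQ.tensor_chain_complex[OF PQ] \<theta>(1) _ \<theta>(2)])
    fix n Z assume "Z \<in> carrier (tensor A (F (B (Suc n))) N)"
    then obtain z where z: "z \<in> carrier (tensor_pre A (F (B (Suc n))) N)" "Z = tensor_class A (F (B (Suc n))) N z"
      unfolding tensor_carrier[OF F_module] by blast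
    have zk: "Poly_Mapping.keys z \<subseteq> carrier (F (B (Suc n))) \<times> carrier N" using z by simp
    have dz: "frag_map (d n) z \<in> carrier (tensor_pre A (F (B n)) N)"
      by (rule frag_map_in_carrier[OF F_module P.d_linear z(1)])
    have rz: "frag_map (reduce (B (Suc n))) z \<in> carrier (tensor_pre Q (FQ (B (Suc n))) NQ)"
      using frag_map_carrier[OF Pi_I[OF reduce_closed] zk] by simp
    have "frag_map (\<lambda>x. reduce (B n) (d n x)) z = frag_map (\<lambda>x. ?d n (reduce (B (Suc n)) x)) z"
      by (rule frag_map_cong[OF _ zk]) (simp add: reduced_map_reduce[OF P.d_linear])
    then show "\<theta> n (tensor_map A (F (B n)) N (d n) Z) = tensor_map Q (FQ (B n)) NQ (?d n) (\<theta> (Suc n) Z)"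
      unfolding z(2) tensor_map_class[OF F_module F_module P.d_linear z(1)] \<theta>(3)[OF z(1)] \<theta>(3)[OF dz]
        NQ.tensor_map_class[OF FQ_module FQ_module reduced_map_linear[OF P.d_linear] rz] frag_map_comp
      by simp
  qed
qed

end

section \<open>Ideals generated by commuting idempotents\<close>

text \<open>The clause about elements \<open>c\<close> commuting with \<open>E\<close> is there for
  the induction: applied to the next idempotent \<open>f\<close> it yields
  \<open>f \<otimes> e = e \<otimes> f\<close>. Membership in every left ideal above
  \<open>E\<close> takes the place of an explicit formula for \<open>e\<close>.\<close>

lemma (in ring) commuting_idempotents_join:
  assumes "finite E" "E \<subseteq> idempotents R" "\<forall>e\<in>E. \<forall>f\<in>E. e \<otimes> f = f \<otimes> e"
  shows "\<exists>e\<in>carrier R. (\<forall>x\<in>E. x \<otimes> e = x) \<and> (\<forall>J. left_ideal J R \<longrightarrow> E \<subseteq> J \<longrightarrow> e \<in> J)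
    \<and> (\<forall>c\<in>carrier R. (\<forall>x\<in>E. c \<otimes> x = x \<otimes> c) \<longrightarrow> c \<otimes> e = e \<otimes> c)"
  using assms
proof (induction E rule: finite_induct)
  case empty
  show ?case
  proof (rule bexI[of _ \<zero>])
    show "(\<forall>x\<in>{}. x \<otimes> \<zero> = x) \<and> (\<forall>J. left_ideal J R \<longrightarrow> {} \<subseteq> J \<longrightarrow> \<zero> \<in> J)
        \<and> (\<forall>c\<in>carrier R. (\<forall>x\<in>{}. c \<otimes> x = x \<otimes> c) \<longrightarrow> c \<otimes> \<zero> = \<zero> \<otimes> c)"
      by (auto simp: left_ideal_def dest: additive_subgroup.zero_closed)
  qed simp
next
  case (insert f E)
  obtain e where e: "e \<in> carrier R" "\<forall>x\<in>E. x \<otimes> e = x"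
    "\<forall>J. left_ideal J R \<longrightarrow> E \<subseteq> J \<longrightarrow> e \<in> J"
    "\<forall>c\<in>carrier R. (\<forall>x\<in>E. c \<otimes> x = x \<otimes> c) \<longrightarrow> c \<otimes> e = e \<otimes> c"
    using insert.IH insert.prems by blast
  have f: "f \<in> carrier R" "f \<otimes> f = f" using insert.prems by (auto simp: idempotents_def)
  have "\<forall>x\<in>E. f \<otimes> x = x \<otimes> f" using insert.prems by blast
  then have fe: "f \<otimes> e = e \<otimes> f" using e(4) f(1) by blast
  \<comment> \<open>This is the element for which \<open>\<one> \<ominus> ?g\<close> is the product
    of \<open>\<one> \<ominus> e\<close> and \<open>\<one> \<ominus> f\<close>. Members of
    \<open>E\<close> annihilate the first factor from the left, and \<open>f\<close>, which commutes
    with \<open>e\<close>, annihilates the second.\<close>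
  let ?g = "e \<oplus> (f \<ominus> e \<otimes> f)"
  have g: "x \<otimes> ?g = x \<otimes> e \<oplus> (x \<otimes> f \<ominus> x \<otimes> e \<otimes> f)" if "x \<in> carrier R" for x
    using that e(1) f(1) by (simp add: a_minus_def r_distr r_minus m_assoc)
  show ?case
  proof (intro bexI[of _ ?g] conjI ballI allI impI)
    show "?g \<in> carrier R" using e f by simp
    show "x \<otimes> ?g = x" if "x \<in> insert f E" for x
    proof (cases "x = f")
      case True
      have "f \<otimes> e \<otimes> f = f \<otimes> e" using e(1) f by (simp only: fe m_assoc)
      then show ?thesis using True g[OF f(1)] e(1) f by (simp add: a_minus_def a_lcomm r_neg)
    next
      case False
      then have x: "x \<in> E" "x \<in> carrier R" using that insert.prems by (auto simp: idempotents_def)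
      then show ?thesis using g[OF x(2)] e(2) f(1) by (simp add: a_minus_def r_neg)
    qed
    show "?g \<in> J" if J: "left_ideal J R" and "insert f E \<subseteq> J" for J
    proof -
      interpret J: additive_subgroup J R using J by (simp add: left_ideal_def)
      have "e \<in> J" "f \<in> J" using that e(3) by auto
      moreover have "e \<otimes> f \<in> J" using J \<open>f \<in> J\<close> e(1) by (simp add: left_ideal_def)
      ultimately show ?thesis by (auto simp: a_minus_def intro!: J.a_closed J.a_inv_closed)
    qed
    show "c \<otimes> ?g = ?g \<otimes> c" if c: "c \<in> carrier R" and "\<forall>x\<in>insert f E. c \<otimes> x = x \<otimes> c" for c
    proof -
      have ce: "c \<otimes> e = e \<otimes> c" and cf: "c \<otimes> f = f \<otimes> c" using that e(4) by blast+
      have "c \<otimes> (e \<otimes> f) = (e \<otimes> f) \<otimes> c"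
        using c e(1) f(1) ce cf m_assoc[of c e f] m_assoc[of e c f] m_assoc[of e f c] by presburger
      then show ?thesis using c e(1) f(1)
        by (simp add: a_minus_def r_distr l_distr r_minus l_minus ce cf)
    qed
  qed
qed

text \<open>The elements fixed by right multiplication with \<open>e\<close> form a left ideal, so
  it is enough that the idempotents in \<open>E\<close> are fixed.\<close>

lemma (in ring) gen_left_ideal_idempotents:
  assumes "finite E" "E \<subseteq> idempotents R" "\<forall>e\<in>E. \<forall>f\<in>E. e \<otimes> f = f \<otimes> e"
  shows "\<exists>e\<in>gen_left_ideal R E. \<forall>x\<in>gen_left_ideal R E. x \<otimes> e = x"
proof -
  obtain e where e: "e \<in> carrier R" "\<forall>x\<in>E. x \<otimes> e = x"
    "\<forall>J. left_ideal J R \<longrightarrow> E \<subseteq> J \<longrightarrow> e \<in> J"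
    using commuting_idempotents_join[OF assms] by blast
  let ?J = "{x \<in> carrier R. x \<otimes> e = x}"
  have "additive_subgroup ?J R"
  proof (rule additive_subgroup.intro, rule group.subgroupI[OF a_group])
    show "?J \<noteq> {}" using e(1) by (auto intro!: exI[of _ \<zero>])
    show "inv\<^bsub>add_monoid R\<^esub> x \<in> ?J" if "x \<in> ?J" for x
      using that e(1) by (simp add: a_inv_def[symmetric] l_minus)
  qed (use e(1) in \<open>auto simp: l_distr\<close>)
  then have "left_ideal ?J R" using e(1) by (auto simp: left_ideal_def m_assoc)
  moreover have "E \<subseteq> ?J" using e(2) assms(2) by (auto simp: idempotents_def)
  ultimately have "gen_left_ideal R E \<subseteq> ?J" by (auto simp: gen_left_ideal_def)
  moreover have "e \<in> gen_left_ideal R E" using e(3) by (auto simp: gen_left_ideal_def)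
  ultimately show ?thesis by blast
qed

text \<open>Since the summands are left ideals, uniqueness of the decomposition makes the components
  additive and left linear. Nothing is claimed about multiplication on the right, which need not
  preserve a summand.\<close>

lemma (in ring) internal_direct_sum_projections:
  assumes I: "ideal I R" and J: "\<And>i. i \<in> {1..k} \<Longrightarrow> left_ideal (J i) R"
    and sum: "internal_direct_sum R I k J"
  obtains p where "\<And>i x. i \<in> {1..k} \<Longrightarrow> x \<in> I \<Longrightarrow> p i x \<in> J i"
    and "\<And>i x y. i \<in> {1..k} \<Longrightarrow> x \<in> I \<Longrightarrow> y \<in> I \<Longrightarrow> p i (x \<oplus> y) = p i x \<oplus> p i y"
    and "\<And>i a x. i \<in> {1..k} \<Longrightarrow> a \<in> carrier R \<Longrightarrow> x \<in> I \<Longrightarrow> p i (a \<otimes> x) = a \<otimes> p i x"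
    and "\<And>x. x \<in> I \<Longrightarrow> x = (\<Oplus>i\<in>{1..k}. p i x)"
    and "\<And>i. i \<in> {1..k} \<Longrightarrow> J i \<subseteq> I"
proof -
  interpret I: ideal I R by (rule I)
  let ?K = "{1..k}"
  let ?s = "\<lambda>x. \<Oplus>i\<in>?K. x i"
  have bij: "bij_betw ?s (\<Pi>\<^sub>E i\<in>?K. J i) I" using sum by (simp add: internal_direct_sum_def)
  have JA: "additive_subgroup (J i) R" and Jl: "\<And>a x. a \<in> carrier R \<Longrightarrow> x \<in> J i \<Longrightarrow> a \<otimes> x \<in> J i"
    if "i \<in> ?K" for i
    using J[OF that] by (auto simp: left_ideal_def)
  have Jc: "x \<in> carrier R" if "i \<in> ?K" "x \<in> J i" for i x
    using additive_subgroup.a_subset[OF JA[OF that(1)]] that(2) by blast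
  define c where "c = inv_into (\<Pi>\<^sub>E i\<in>?K. J i) ?s"
  have c: "c x \<in> (\<Pi>\<^sub>E i\<in>?K. J i)" "?s (c x) = x" if "x \<in> I" for x
    using that bij inv_into_into[of x ?s "\<Pi>\<^sub>E i\<in>?K. J i"] f_inv_into_f[of x ?s "\<Pi>\<^sub>E i\<in>?K. J i"]
    by (auto simp: c_def bij_betw_def)
  have cu: "c (?s u) = u" if "u \<in> (\<Pi>\<^sub>E i\<in>?K. J i)" for u
    unfolding c_def by (rule bij_betw_inv_into_left[OF bij that])
  have cJ: "c x i \<in> J i" if "x \<in> I" "i \<in> ?K" for x i using c(1)[OF that(1)] that(2) by auto
  have cc: "c x \<in> ?K \<rightarrow> carrier R" if "x \<in> I" for x using cJ[OF that] Jc by auto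
  show thesis
  proof (rule that[of "\<lambda>i x. c x i"])
    show "c x i \<in> J i" if "i \<in> ?K" "x \<in> I" for i x using that cJ by blast
    show "x = (\<Oplus>i\<in>?K. c x i)" if "x \<in> I" for x using c(2)[OF that] by simp
  next
    fix i x y assume i: "i \<in> ?K" and x: "x \<in> I" and y: "y \<in> I"
    \<comment> \<open>The componentwise sum is an admissible family with total
      \<open>x \<oplus> y\<close>, so by injectivity of summation it is the family of components of
      \<open>x \<oplus> y\<close>. The argument for scalars follows the same pattern.\<close>
    let ?u = "\<lambda>i\<in>?K. c x i \<oplus> c y i"
    have "?u \<in> (\<Pi>\<^sub>E i\<in>?K. J i)"
      using cJ[OF x] cJ[OF y] additive_subgroup.a_closed[OF JA] by auto
    moreover have "?s ?u = (\<Oplus>i\<in>?K. c x i \<oplus> c y i)"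
      using cc[OF x] cc[OF y] by (intro finsum_cong') auto
    then have "?s ?u = x \<oplus> y" using cc[OF x] cc[OF y] c(2)[OF x] c(2)[OF y] by (simp add: finsum_addf)
    ultimately have "c (x \<oplus> y) = ?u" using cu[of ?u] by simp
    then show "c (x \<oplus> y) i = c x i \<oplus> c y i" using i by simp
  next
    fix i a x assume i: "i \<in> ?K" and a: "a \<in> carrier R" and x: "x \<in> I"
    let ?u = "\<lambda>i\<in>?K. a \<otimes> c x i"
    have "?u \<in> (\<Pi>\<^sub>E i\<in>?K. J i)" using cJ[OF x] Jl a by auto
    moreover have "?s ?u = (\<Oplus>i\<in>?K. a \<otimes> c x i)"
      using cc[OF x] a by (intro finsum_cong') auto
    then have "?s ?u = a \<otimes> x" using cc[OF x] c(2)[OF x] a finsum_rdistr[of ?K a "c x"] by simp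
    ultimately have "c (a \<otimes> x) = ?u" using cu[of ?u] by simp
    then show "c (a \<otimes> x) i = a \<otimes> c x i" using i by simp
  next
    fix i assume i: "i \<in> ?K"
    show "J i \<subseteq> I"
    proof
      fix x assume x: "x \<in> J i"
      \<comment> \<open>Placing \<open>x\<close> in position \<open>i\<close> and zeros elsewhere
        exhibits \<open>x\<close> as one of the sums that make up I.\<close>
      let ?u = "\<lambda>j\<in>?K. if j = i then x else \<zero>"
      have xc: "x \<in> carrier R" using Jc i x by blast
      have "?u \<in> (\<Pi>\<^sub>E i\<in>?K. J i)" using x additive_subgroup.zero_closed[OF JA] by auto
      then have "?s ?u \<in> I" by (rule bij_betw_apply[OF bij])
      moreover have "?s ?u = (\<Oplus>j\<in>?K. if i = j then x else \<zero>)"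
        using xc by (intro finsum_cong') auto
      then have "?s ?u = x" using xc i finsum_singleton[of i ?K "\<lambda>_. x"] by simp
      ultimately show "x \<in> I" by simp
    qed
  qed
qed

section \<open>Exactness of the subcomplex P I\<close>

context algebra_ideal begin

text \<open>On coefficients \<open>\<phi>\<close> is left multiplication by the matrix with entries
  \<open>\<phi> (basis_vec A B c) b\<close>, and a left linear \<open>p\<close> commutes with such a
  product. With \<open>p\<close> a projection onto a summand of I, this splits the differential of P
  I.\<close>

lemma
  assumes \<phi>: "\<phi> \<in> linear_maps A (F B) (F C)" and f: "f \<in> FI B"
    and p: "\<And>x. x \<in> I \<Longrightarrow> p x \<in> I" "\<And>x y. x \<in> I \<Longrightarrow> y \<in> I \<Longrightarrow> p (x \<oplus>\<^bsub>A\<^esub> y) = p x \<oplus>\<^bsub>A\<^esub> p y"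
      "\<And>a x. a \<in> carrier A \<Longrightarrow> x \<in> I \<Longrightarrow> p (a \<otimes>\<^bsub>A\<^esub> x) = a \<otimes>\<^bsub>A\<^esub> p x"
  shows coefficients_closed: "(\<lambda>b\<in>B. p (f b)) \<in> FI B"
    and linear_map_coefficients: "\<phi> (\<lambda>b\<in>B. p (f b)) = (\<lambda>c\<in>C. p (\<phi> f c))"
proof -
  interpret C: right_module A "F C" by (rule F_module)
  interpret B: right_module A "F B" by (rule F_module)
  interpret \<phi>: abelian_group_hom "F B" "F C" \<phi> by (rule C.linear_hom[OF F_module \<phi>])
  have Ic: "x \<in> carrier A" if "x \<in> I" for x using that I.a_subset by blast
  \<comment> \<open>Left linearity with the scalar zero gives this. It is what keeps the support
    finite when \<open>p\<close> is applied to all coefficients.\<close>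
  have p0: "p \<zero>\<^bsub>A\<^esub> = \<zero>\<^bsub>A\<^esub>" using p(3)[OF zero_closed I.zero_closed] Ic[OF p(1)[OF I.zero_closed]] by simp
  have cl: "(\<lambda>b\<in>B. p (g b)) \<in> FI B" if g: "g \<in> FI B" for g
  proof -
    have "finite {b \<in> B. (\<lambda>b\<in>B. p (g b)) b \<noteq> \<zero>\<^bsub>A\<^esub>}"
      by (rule finite_subset[of _ "{b \<in> B. g b \<noteq> \<zero>\<^bsub>A\<^esub>}"])
        (use g in \<open>auto simp: p0 valued_in_def free_rmodule_sel\<close>)
    then show ?thesis using g p(1) Ic by (auto simp: valued_in_def free_rmodule_sel)
  qed
  show "(\<lambda>b\<in>B. p (f b)) \<in> FI B" by (rule cl[OF f])
  note \<phi>I = linear_preserves_FI[OF \<phi>]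
  show "\<phi> (\<lambda>b\<in>B. p (f b)) = (\<lambda>c\<in>C. p (\<phi> f c))" using f I.zero_closed I.a_subset
  proof (induction rule: free_valued_induct)
    case zero
    have "(\<lambda>b\<in>B. p (\<zero>\<^bsub>F B\<^esub> b)) = \<zero>\<^bsub>F B\<^esub>" by (auto simp: free_rmodule_sel p0)
    then show ?case by (simp only: \<phi>.hom_zero) (auto simp: free_rmodule_sel p0)
  next
    case (step c a x)
    note bv = basis_vec_closed[OF ring_axioms, of B c]
    have a: "a \<in> carrier A" by (rule Ic[OF step(2)])
    have pa: "p a \<in> carrier A" by (rule Ic[OF p(1)[OF step(2)]])
    have xc: "x \<in> carrier (F B)" and xI: "\<And>b. b \<in> B \<Longrightarrow> x b \<in> I" using step(3) by (auto simp: valued_in_def)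
    have px: "(\<lambda>b\<in>B. p (x b)) \<in> carrier (F B)" using cl[OF step(3)] by (simp add: valued_in_def)
    have bvc: "basis_vec A B c b \<in> carrier A" if "b \<in> B" for b using bv that by (auto simp: free_rmodule_sel)
    have \<phi>c: "\<phi> (basis_vec A B c) b \<in> carrier A" if "b \<in> C" for b
      using linear_maps_closed[OF \<phi> bv] that by (auto simp: free_rmodule_sel)
    have \<phi>x: "\<phi> x b \<in> I" if "b \<in> C" for b using \<phi>I[OF step(3)] that by (simp add: valued_in_def)
    let ?f = "a \<odot>\<^bsub>F B\<^esub> basis_vec A B c \<oplus>\<^bsub>F B\<^esub> x"
    have "(\<lambda>b\<in>B. p (?f b)) = p a \<odot>\<^bsub>F B\<^esub> basis_vec A B c \<oplus>\<^bsub>F B\<^esub> (\<lambda>b\<in>B. p (x b))"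
      using I.I_l_closed[OF step(2)] xI bvc by (auto simp: free_rmodule_sel p(2,3) step(2))
    then have "\<phi> (\<lambda>b\<in>B. p (?f b)) = p a \<odot>\<^bsub>F C\<^esub> \<phi> (basis_vec A B c) \<oplus>\<^bsub>F C\<^esub> (\<lambda>c\<in>C. p (\<phi> x c))"
      by (simp only: C.linear_step[OF \<phi> step(1) pa px] step.IH)
    also have "\<dots> = (\<lambda>b\<in>C. p (\<phi> ?f b))"
      unfolding C.linear_step[OF \<phi> step(1) a xc]
      using I.I_l_closed[OF step(2)] \<phi>x \<phi>c by (auto simp: free_rmodule_sel p(2,3) step(2))
    finally show ?case .
  qed
qed

text \<open>Assembles preimages found for the single summands \<open>J i\<close> into one preimage
  of a vector with coefficients in I.\<close>

lemma valued_sum: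
  assumes \<phi>: "\<phi> \<in> linear_maps A (F B) (F C)" and "finite S"
    and g: "\<And>i c. i \<in> S \<Longrightarrow> c \<in> C \<Longrightarrow> g i c \<in> carrier A"
    and z: "\<And>i. i \<in> S \<Longrightarrow> \<exists>z\<in>FI B. \<phi> z = (\<lambda>c\<in>C. g i c)"
  shows "\<exists>z\<in>FI B. \<phi> z = (\<lambda>c\<in>C. \<Oplus>\<^bsub>A\<^esub>i\<in>S. g i c)"
  using assms(2) g z
proof (induction S rule: finite_induct)
  case empty
  interpret C: right_module A "F C" by (rule F_module)
  interpret B: right_module A "F B" by (rule F_module)
  interpret \<phi>: abelian_group_hom "F B" "F C" \<phi> by (rule C.linear_hom[OF F_module \<phi>])
  have "\<zero>\<^bsub>F B\<^esub> \<in> carrier (F B)" by simp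
  moreover have "\<zero>\<^bsub>F B\<^esub> b \<in> I" if "b \<in> B" for b using that I.zero_closed by (simp add: free_rmodule_sel)
  ultimately have "\<zero>\<^bsub>F B\<^esub> \<in> FI B" by (simp add: valued_in_def)
  moreover have "\<phi> \<zero>\<^bsub>F B\<^esub> = (\<lambda>c\<in>C. \<Oplus>\<^bsub>A\<^esub>i\<in>{}. g i c)"
    unfolding \<phi>.hom_zero by (simp add: free_rmodule_sel)
  ultimately show ?case by blast
next
  case (insert j S)
  interpret B: right_module A "F B" by (rule F_module)
  obtain z where z: "z \<in> FI B" "\<phi> z = (\<lambda>c\<in>C. \<Oplus>\<^bsub>A\<^esub>i\<in>S. g i c)"
    using insert.IH insert.prems by (meson insertI2)
  obtain w where w: "w \<in> FI B" "\<phi> w = (\<lambda>c\<in>C. g j c)" using insert.prems(2)[of j] by blast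
  have zw: "w \<in> carrier (F B)" "z \<in> carrier (F B)" using z w by (auto simp: valued_in_def)
  have "w \<oplus>\<^bsub>F B\<^esub> z \<in> carrier (F B)" using zw by simp
  moreover have "(w \<oplus>\<^bsub>F B\<^esub> z) b \<in> I" if "b \<in> B" for b
    using that z(1) w(1) by (simp add: free_rmodule_sel valued_in_def)
  ultimately have "w \<oplus>\<^bsub>F B\<^esub> z \<in> FI B" by (simp add: valued_in_def)
  moreover have "\<phi> (w \<oplus>\<^bsub>F B\<^esub> z) = (\<lambda>c\<in>C. \<Oplus>\<^bsub>A\<^esub>i\<in>insert j S. g i c)"
    unfolding linear_maps_add[OF \<phi> zw] w(2) z(2) using insert.prems(1) insert.hyps
    by (auto simp: free_rmodule_sel finsum_insert Pi_iff)
  ultimately show ?case by blast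
qed

text \<open>If \<open>x = x e\<^sub>i\<close> is the boundary of \<open>y\<close>, then it is also the boundary of \<open>y e\<^sub>i\<close>, which has
  coefficients in \<open>I\<close>.\<close>

lemma valued_boundary:
  assumes d: "d \<in> linear_maps A (F B) (F C)"
    and J: "\<And>i. i \<in> {1..k::nat} \<Longrightarrow> left_ideal (J i) A" and sum: "internal_direct_sum A I k J"
    and e: "\<And>i. i \<in> {1..k} \<Longrightarrow> e i \<in> J i" "\<And>i x. i \<in> {1..k} \<Longrightarrow> x \<in> J i \<Longrightarrow> x \<otimes>\<^bsub>A\<^esub> e i = x"
    and x: "x \<in> FI C"
    and im: "\<And>p. \<lbrakk>\<And>x. x \<in> I \<Longrightarrow> p x \<in> I; \<And>x y. x \<in> I \<Longrightarrow> y \<in> I \<Longrightarrow> p (x \<oplus>\<^bsub>A\<^esub> y) = p x \<oplus>\<^bsub>A\<^esub> p y;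
      \<And>a x. a \<in> carrier A \<Longrightarrow> x \<in> I \<Longrightarrow> p (a \<otimes>\<^bsub>A\<^esub> x) = a \<otimes>\<^bsub>A\<^esub> p x\<rbrakk>
      \<Longrightarrow> (\<lambda>c\<in>C. p (x c)) \<in> d ` carrier (F B)"
  shows "\<exists>z\<in>FI B. d z = x"
proof -
  interpret B: right_module A "F B" by (rule F_module)
  show ?thesis
  proof (rule internal_direct_sum_projections[OF I.ideal_axioms J sum])
    fix p
    assume p: "\<And>i x. i \<in> {1..k} \<Longrightarrow> x \<in> I \<Longrightarrow> p i x \<in> J i"
        "\<And>i x y. i \<in> {1..k} \<Longrightarrow> x \<in> I \<Longrightarrow> y \<in> I \<Longrightarrow> p i (x \<oplus>\<^bsub>A\<^esub> y) = p i x \<oplus>\<^bsub>A\<^esub> p i y"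
        "\<And>i a x. i \<in> {1..k} \<Longrightarrow> a \<in> carrier A \<Longrightarrow> x \<in> I \<Longrightarrow> p i (a \<otimes>\<^bsub>A\<^esub> x) = a \<otimes>\<^bsub>A\<^esub> p i x"
      and ps: "\<And>x. x \<in> I \<Longrightarrow> x = (\<Oplus>\<^bsub>A\<^esub>i\<in>{1..k}. p i x)" and JI: "\<And>i. i \<in> {1..k} \<Longrightarrow> J i \<subseteq> I"
    have xI: "x c \<in> I" if "c \<in> C" for c using x that by (simp add: valued_in_def)
    have "\<exists>z\<in>FI B. d z = (\<lambda>c\<in>C. p i (x c))" if i: "i \<in> {1..k}" for i
    proof -
      \<comment> \<open>\<open>im\<close> ranges over all left linear maps of I into itself because
        the projections become available only inside this proof.\<close>
      have "(\<lambda>c\<in>C. p i (x c)) \<in> d ` carrier (F B)"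
      proof (rule im)
        show "p i a \<in> I" if "a \<in> I" for a using p(1)[OF i that] JI[OF i] by blast
      qed (rule p(2)[OF i] p(3)[OF i]; assumption)+
      then obtain y where y: "y \<in> carrier (F B)" "d y = (\<lambda>c\<in>C. p i (x c))" by (metis imageE)
      have ei: "e i \<in> I" using JI[OF i] e(1)[OF i] by blast
      then have ec: "e i \<in> carrier A" using I.a_subset by blast
      have "e i \<odot>\<^bsub>F B\<^esub> y \<in> carrier (F B)" by (rule B.act_closed[OF ec y(1)])
      moreover have "(e i \<odot>\<^bsub>F B\<^esub> y) b \<in> I" if "b \<in> B" for b
        using that y(1) I.I_l_closed[OF ei] by (auto simp: free_rmodule_sel)
      ultimately have "e i \<odot>\<^bsub>F B\<^esub> y \<in> FI B" by (simp add: valued_in_def)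
      moreover have "d (e i \<odot>\<^bsub>F B\<^esub> y) = (\<lambda>c\<in>C. p i (x c))"
        unfolding linear_maps_smult[OF d ec y(1)] y(2) using e(2)[OF i p(1)[OF i xI]]
        by (auto simp: free_rmodule_sel)
      ultimately show ?thesis by blast
    qed
    moreover have "p i (x c) \<in> carrier A" if "i \<in> {1..k}" "c \<in> C" for i c
      using p(1)[OF that(1) xI[OF that(2)]] JI[OF that(1)] I.a_subset by blast
    ultimately obtain z where z: "z \<in> FI B" "d z = (\<lambda>c\<in>C. \<Oplus>\<^bsub>A\<^esub>i\<in>{1..k}. p i (x c))"
      using valued_sum[OF d, of "{1..k}" "\<lambda>i c. p i (x c)"] by auto
    have "(\<lambda>c\<in>C. \<Oplus>\<^bsub>A\<^esub>i\<in>{1..k}. p i (x c)) = (\<lambda>c\<in>C. x c)"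
      by (rule restrict_ext) (rule ps[OF xI, symmetric])
    also have "\<dots> = x" using x by (auto simp: valued_in_def free_rmodule_sel PiE_def extensional_restrict)
    finally show ?thesis using z by auto
  qed
qed

text \<open>Components of cycles are cycles: above degree 0 because \<open>p\<close> commutes with
  the differential, in degree 0 because \<open>\<epsilon>\<close> kills every vector with
  coefficients in I. Exactness of the full resolution then supplies the preimages from which
  \<open>valued_boundary\<close> builds one with coefficients in I.\<close>

lemma resolution_valued_exact:
  assumes P: "free_resolution A M B d \<epsilon>"
    and IM: "\<And>a x. \<lbrakk>a \<in> I; x \<in> carrier M\<rbrakk> \<Longrightarrow> a \<odot>\<^bsub>M\<^esub> x = \<zero>\<^bsub>M\<^esub>"
    and J: "\<And>i. i \<in> {1..k::nat} \<Longrightarrow> left_ideal (J i) A" and sum: "internal_direct_sum A I k J"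
    and e: "\<And>i. i \<in> {1..k} \<Longrightarrow> e i \<in> J i" "\<And>i x. i \<in> {1..k} \<Longrightarrow> x \<in> J i \<Longrightarrow> x \<otimes>\<^bsub>A\<^esub> e i = x"
  shows "x \<in> FI (B 0) \<Longrightarrow> \<exists>z\<in>FI (B (Suc 0)). d 0 z = x"
    and "x \<in> FI (B (Suc n)) \<Longrightarrow> d n x = \<zero>\<^bsub>F (B n)\<^esub> \<Longrightarrow> \<exists>z\<in>FI (B (Suc (Suc n))). d (Suc n) z = x"
proof -
  interpret P: free_resolution A M B d \<epsilon> by fact
  assume x: "x \<in> FI (B 0)"
  show "\<exists>z\<in>FI (B (Suc 0)). d 0 z = x"
  proof (rule valued_boundary[OF P.d_linear J sum e x])
    fix p assume p: "\<And>x. x \<in> I \<Longrightarrow> p x \<in> I" "\<And>x y. x \<in> I \<Longrightarrow> y \<in> I \<Longrightarrow> p (x \<oplus>\<^bsub>A\<^esub> y) = p x \<oplus>\<^bsub>A\<^esub> p y"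
      "\<And>a x. a \<in> carrier A \<Longrightarrow> x \<in> I \<Longrightarrow> p (a \<otimes>\<^bsub>A\<^esub> x) = a \<otimes>\<^bsub>A\<^esub> p x"
    have px: "(\<lambda>c\<in>B 0. p (x c)) \<in> FI (B 0)"
      by (rule coefficients_closed[OF linear_maps_id x p])
    have "\<epsilon> (\<lambda>c\<in>B 0. p (x c)) = \<zero>\<^bsub>M\<^esub>"
      by (rule P.linear_kills_valued[OF P.aug_linear px I.zero_closed I.a_subset IM])
    then show "(\<lambda>c\<in>B 0. p (x c)) \<in> d 0 ` carrier (F (B (Suc 0)))"
      unfolding P.exact_0 using px by (simp add: valued_in_def)
  qed
next
  interpret P: free_resolution A M B d \<epsilon> by fact
  assume x: "x \<in> FI (B (Suc n))" and dx: "d n x = \<zero>\<^bsub>F (B n)\<^esub>"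
  show "\<exists>z\<in>FI (B (Suc (Suc n))). d (Suc n) z = x"
  proof (rule valued_boundary[OF P.d_linear J sum e x])
    fix p assume p: "\<And>x. x \<in> I \<Longrightarrow> p x \<in> I" "\<And>x y. x \<in> I \<Longrightarrow> y \<in> I \<Longrightarrow> p (x \<oplus>\<^bsub>A\<^esub> y) = p x \<oplus>\<^bsub>A\<^esub> p y"
      "\<And>a x. a \<in> carrier A \<Longrightarrow> x \<in> I \<Longrightarrow> p (a \<otimes>\<^bsub>A\<^esub> x) = a \<otimes>\<^bsub>A\<^esub> p x"
    have px: "(\<lambda>c\<in>B (Suc n). p (x c)) \<in> FI (B (Suc n))"
      by (rule coefficients_closed[OF linear_maps_id x p])
    have p0: "p \<zero>\<^bsub>A\<^esub> = \<zero>\<^bsub>A\<^esub>"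
      using p(3)[OF zero_closed I.zero_closed] p(1)[OF I.zero_closed] I.a_subset by auto
    have "d n (\<lambda>c\<in>B (Suc n). p (x c)) = (\<lambda>c\<in>B n. p (d n x c))"
      by (rule linear_map_coefficients[OF P.d_linear x p])
    also have "\<dots> = \<zero>\<^bsub>F (B n)\<^esub>" unfolding dx by (auto simp: free_rmodule_sel p0)
    finally show "(\<lambda>c\<in>B (Suc n). p (x c)) \<in> d (Suc n) ` carrier (F (B (Suc (Suc n))))"
      unfolding P.exact using px by (simp add: valued_in_def)
  qed
qed

end

theorem theorem4p3:
  fixes R :: "'r ring" and A :: "('r, 'a) module"
    and M :: "('a, 'm) module" and N :: "('a, 'n) module"
    and I :: "'a set" and k :: nat and J :: "nat \<Rightarrow> 'a set"
  assumes "assoc_algebra R A"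
    and "right_module A M"
    and "left_module A N"
    and "ideal I A"
    and "\<And>a x. \<lbrakk>a \<in> I; x \<in> carrier M\<rbrakk> \<Longrightarrow> a \<odot>\<^bsub>M\<^esub> x = \<zero>\<^bsub>M\<^esub>"
    and "\<And>a y. \<lbrakk>a \<in> I; y \<in> carrier N\<rbrakk> \<Longrightarrow> a \<odot>\<^bsub>N\<^esub> y = \<zero>\<^bsub>N\<^esub>"
    and "\<And>i. i \<in> {1..k} \<Longrightarrow> left_ideal (J i) A"
    and "internal_direct_sum A I k J"
    and "\<And>i. i \<in> {1..k} \<Longrightarrow> \<exists>E. finite E \<and> E \<subseteq> idempotents A \<and>
           (\<forall>e\<in>E. \<forall>f\<in>E. e \<otimes>\<^bsub>A\<^esub> f = f \<otimes>\<^bsub>A\<^esub> e) \<and> J i = gen_left_ideal A E"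
  shows "\<forall>n. isomorphic_modules R (Tor A n M N)
           (Tor (quot_algebra A I) n (module_over_quot M) (module_over_quot N))"
proof
  fix n
  have AI: "algebra_ideal R A I" by (intro algebra_ideal.intro assms(1,4))
  interpret algebra_ideal_module R A I N
    by (intro algebra_ideal_module.intro AI algebra_left_module.intro algebra_ideal_module_axioms.intro assms(1,3,6))
  interpret NQ: algebra_left_module R Q NQ by (rule NQ_module)
  have "\<exists>e\<in>J i. \<forall>x\<in>J i. x \<otimes>\<^bsub>A\<^esub> e = x" if i: "i \<in> {1..k}" for i
    using assms(9)[OF i] gen_left_ideal_idempotents by metis
  then obtain e where e: "\<And>i. i \<in> {1..k} \<Longrightarrow> e i \<in> J i"
      "\<And>i x. i \<in> {1..k} \<Longrightarrow> x \<in> J i \<Longrightarrow> x \<otimes>\<^bsub>A\<^esub> e i = x"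
    by metis
  note P = standard_free_resolution[OF assms(2)]
  have MQ: "right_module Q (module_over_quot M)"
    by (rule right_module_over_quot[OF assms(1,4,2,5)])
  \<comment> \<open>This resolution over the quotient algebra is free on the cells of M over A, so
    it is not the one that enters \<open>Tor\<close> there.\<close>
  note PQ = reduced_resolution[OF P assms(5) resolution_valued_exact[OF P assms(5,7,8) e]]
  \<comment> \<open>The first isomorphism changes the algebra and keeps the basis; the second stays
    over the quotient algebra and changes the resolution of M.\<close>
  show "isomorphic_modules R (Tor A n M N) (Tor Q n (module_over_quot M) NQ)"
    unfolding Tor_def res_mod_def
    by (rule isomorphic_modules_trans[OF reduced_homology_iso[OF P PQ]
          NQ.free_resolution_homology_iso[OF PQ standard_free_resolution[OF MQ]]])
qed

end
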